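(* The Weil topos $\mathfrak{W}$ is an essential subquality of the Gaeta topos $\mathfrak{G}$ of $\mathbb{C}$; that is, the essential subtopos $\mathfrak{W}\to\mathfrak{G}$ induced by the full inclusion of the category of Weil algebras over $\mathbb{C}$ into the category of finitely generated directly indecomposable $\mathbb{C}$-algebras is an essential subquality of the canonical geometric morphism $p:\mathfrak{G}\to\mathbf{Set}$.
   Context: Algebras are commutative and unital. A Weil algebra over a field $k$ is a $k$-algebra $A$ which is local with maximal ideal $\mathfrak{m}$, such that $k\to A\to A/\mathfrak{m}$ is an isomorphism, $A$ is finitely generated as a $k$-module, and $\mathfrak{m}^n=0$ for some $n$. A ring is (directly) indecomposable if it has exactly two idempotents. Let $\mathcal{C}$ be the opposite of the (essentially small) category of finitely generated indecomposable $\mathbb{C}$-algebras and let $\mathcal{W}\subseteq\mathcal{C}^{\mathrm{op}}$ be the full subcategory of Weil algebras over $\mathbb{C}$. For a small category $\mathcal{A}$, $\widehat{\mathcal{A}}$ is the topos of presheaves of sets on $\mathcal{A}$. The Gaeta topos of $\mathbb{C}$ is the topos of sheaves on the opposite $\mathcal{D}$ of the category of finitely generated $\mathbb{C}$-algebras for the topology whose basic covers are the finite families $(D_i\to D)_{i\in I}$ with $\sum_i D_i\to D$ an isomorphism; it is identified (by restriction along $\mathcal{C}\to\mathcal{D}$) with $\mathfrak{G}=\widehat{\mathcal{C}}$. The Weil topos is $\mathfrak{W}=\mathbf{Set}^{\mathcal{W}}=\widehat{\mathcal{W}^{\mathrm{op}}}$. A full inclusion $\mathcal{B}\to\mathcal{A}$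 of small categories induces an essential subtopos $\widehat{\mathcal{B}}\to\widehat{\mathcal{A}}$ whose inverse image is restriction. A subtopos of a topos $\mathcal{E}$ is a geometric morphism $j:\mathcal{E}_j\to\mathcal{E}$ with $j_*$ full and faithful. A subtopos $k$ of $\mathcal{E}$ is above a subtopos $j$ if $j_*$ factors (up to isomorphism) through $k_*$. A geometric morphism is essential if its inverse image has a left adjoint. A geometric morphism $p:\mathcal{E}\to\mathcal{S}$ is local if $p_*$ has a full and faithful right adjoint $p^!$; its centre (level 0) is then the subtopos $\mathcal{S}\to\mathcal{E}$ with inverse image $p_*$ and direct image $p^!$. For local $p$ the canonical transformation $\phi:p^*\to p^!$ is the composite $p^*\xrightarrow{\eta_{p^*}}p^!p_*p^*\xrightarrow{p^!\alpha^{-1}}p^!$, where $\eta$ is the unit of $p_*\dashv p^!$ and $\alpha$ the (invertible) unit of $p^*\dashv p_*$. A local $p$ is a quality type if $\phi$ is an isomorphism. A subquality of a local $p:\mathcal{E}\to\mathcal{S}$ is a subtopos $j:\mathcal{E}_j\to\mathcal{E}$ above the centre of $p$ such that $pj:\mathcal{E}_j\to\mathcal{S}$ is a quality type. A subquality is essential if it is so as a subtopos. The canonical $p:\mathfrak{G}\to\mathbf{Set}$ is local. *)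

theory Defs
  imports
    Complex_Main
    "HOL-Algebra.Module"
    "HOL-Algebra.QuotRing"
    "HOL-Algebra.Ideal_Product"
    "HOL-Algebra.Generated_Rings"
    "HOL-Library.Equipollence"
begin

section \<open>Categories, functors, natural transformations\<close>

text \<open>Hom-sets are indexed by their endpoints and need not be disjoint, so composition and
  identities take objects as arguments: \<open>Cmp A X Y Z g f\<close> is \<open>g \<circ> f\<close> for
  \<open>f : X \<rightarrow> Y\<close> and \<open>g : Y \<rightarrow> Z\<close>.\<close>

record ('o, 'a) cat =
  Ob :: "'o set"
  Ar :: "'o \<Rightarrow> 'o \<Rightarrow> 'a set"
  Cmp :: "'o \<Rightarrow> 'o \<Rightarrow> 'o \<Rightarrow> 'a \<Rightarrow> 'a \<Rightarrow> 'a"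
  Ident :: "'o \<Rightarrow> 'a"

locale category =
  fixes A :: "('o, 'a) cat"
  assumes ident_in: "X \<in> Ob A \<Longrightarrow> Ident A X \<in> Ar A X X"
    and cmp_in: "\<lbrakk>X \<in> Ob A; Y \<in> Ob A; Z \<in> Ob A; f \<in> Ar A X Y; g \<in> Ar A Y Z\<rbrakk>
      \<Longrightarrow> Cmp A X Y Z g f \<in> Ar A X Z"
    and cmp_ident_left: "\<lbrakk>X \<in> Ob A; Y \<in> Ob A; f \<in> Ar A X Y\<rbrakk>
      \<Longrightarrow> Cmp A X Y Y (Ident A Y) f = f"
    and cmp_ident_right: "\<lbrakk>X \<in> Ob A; Y \<in> Ob A; f \<in> Ar A X Y\<rbrakk>
      \<Longrightarrow> Cmp A X X Y f (Ident A X) = f"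
    and cmp_assoc: "\<lbrakk>W \<in> Ob A; X \<in> Ob A; Y \<in> Ob A; Z \<in> Ob A;
        f \<in> Ar A W X; g \<in> Ar A X Y; h \<in> Ar A Y Z\<rbrakk>
      \<Longrightarrow> Cmp A W Y Z h (Cmp A W X Y g f) = Cmp A W X Z (Cmp A X Y Z h g) f"

definition opposite :: "('o, 'a) cat \<Rightarrow> ('o, 'a) cat" where
  "opposite A = \<lparr>Ob = Ob A, Ar = (\<lambda>X Y. Ar A Y X),
     Cmp = (\<lambda>X Y Z g f. Cmp A Z Y X f g), Ident = Ident A\<rparr>"

definition full_subcategory :: "('o, 'a) cat \<Rightarrow> 'o set \<Rightarrow> ('o, 'a) cat" where
  "full_subcategory A S = A\<lparr>Ob := S\<rparr>"

definition is_inverse :: "('o, 'a) cat \<Rightarrow> 'o \<Rightarrow> 'o \<Rightarrow> 'a \<Rightarrow> 'a \<Rightarrow> bool" where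
  "is_inverse A X Y f g \<longleftrightarrow> g \<in> Ar A Y X \<and>
     Cmp A X Y X g f = Ident A X \<and> Cmp A Y X Y f g = Ident A Y"

definition iso_arrow :: "('o, 'a) cat \<Rightarrow> 'o \<Rightarrow> 'o \<Rightarrow> 'a \<Rightarrow> bool" where
  "iso_arrow A X Y f \<longleftrightarrow> f \<in> Ar A X Y \<and> (\<exists>g. is_inverse A X Y f g)"

definition inv_arrow :: "('o, 'a) cat \<Rightarrow> 'o \<Rightarrow> 'o \<Rightarrow> 'a \<Rightarrow> 'a" where
  "inv_arrow A X Y f = (THE g. is_inverse A X Y f g)"

record ('o, 'a, 'p, 'b) fctr =
  fob :: "'o \<Rightarrow> 'p"
  far :: "'o \<Rightarrow> 'o \<Rightarrow> 'a \<Rightarrow> 'b"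

locale cat_functor = A: category A + B: category B
  for A :: "('o, 'a) cat" and B :: "('p, 'b) cat" +
  fixes F :: "('o, 'a, 'p, 'b) fctr"
  assumes fob_in: "X \<in> Ob A \<Longrightarrow> fob F X \<in> Ob B"
    and far_in: "\<lbrakk>X \<in> Ob A; Y \<in> Ob A; f \<in> Ar A X Y\<rbrakk>
      \<Longrightarrow> far F X Y f \<in> Ar B (fob F X) (fob F Y)"
    and far_ident: "X \<in> Ob A \<Longrightarrow> far F X X (Ident A X) = Ident B (fob F X)"
    and far_cmp: "\<lbrakk>X \<in> Ob A; Y \<in> Ob A; Z \<in> Ob A; f \<in> Ar A X Y; g \<in> Ar A Y Z\<rbrakk>
      \<Longrightarrow> far F X Z (Cmp A X Y Z g f) =
          Cmp B (fob F X) (fob F Y) (fob F Z) (far F Y Z g) (far F X Y f)"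

definition id_functor :: "('o, 'a, 'o, 'a) fctr" where
  "id_functor = \<lparr>fob = (\<lambda>X. X), far = (\<lambda>X Y f. f)\<rparr>"

definition comp_functor ::
  "('p, 'b, 'q, 'c) fctr \<Rightarrow> ('o, 'a, 'p, 'b) fctr \<Rightarrow> ('o, 'a, 'q, 'c) fctr" (infixl \<open>\<circ>\<^sub>F\<close> 55)
  where "G \<circ>\<^sub>F F = \<lparr>fob = (\<lambda>X. fob G (fob F X)),
    far = (\<lambda>X Y f. far G (fob F X) (fob F Y) (far F X Y f))\<rparr>"

definition full_and_faithful ::
  "('o, 'a) cat \<Rightarrow> ('p, 'b) cat \<Rightarrow> ('o, 'a, 'p, 'b) fctr \<Rightarrow> bool" where
  "full_and_faithful A B F \<longleftrightarrow> (\<forall>X\<in>Ob A. \<forall>Y\<in>Ob A.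
     bij_betw (far F X Y) (Ar A X Y) (Ar B (fob F X) (fob F Y)))"

definition nat_trans ::
  "('o, 'a) cat \<Rightarrow> ('p, 'b) cat \<Rightarrow> ('o, 'a, 'p, 'b) fctr \<Rightarrow> ('o, 'a, 'p, 'b) fctr
   \<Rightarrow> ('o \<Rightarrow> 'b) \<Rightarrow> bool" where
  "nat_trans A B F G t \<longleftrightarrow>
     (\<forall>X\<in>Ob A. t X \<in> Ar B (fob F X) (fob G X)) \<and>
     (\<forall>X\<in>Ob A. \<forall>Y\<in>Ob A. \<forall>f\<in>Ar A X Y.
        Cmp B (fob F X) (fob F Y) (fob G Y) (t Y) (far F X Y f) =
        Cmp B (fob F X) (fob G X) (fob G Y) (far G X Y f) (t X))"

definition nat_iso ::
  "('o, 'a) cat \<Rightarrow> ('p, 'b) cat \<Rightarrow> ('o, 'a, 'p, 'b) fctr \<Rightarrow> ('o, 'a, 'p, 'b) fctr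
   \<Rightarrow> ('o \<Rightarrow> 'b) \<Rightarrow> bool" where
  "nat_iso A B F G t \<longleftrightarrow> nat_trans A B F G t \<and>
     (\<forall>X\<in>Ob A. iso_arrow B (fob F X) (fob G X) (t X))"

definition adjunction ::
  "('o, 'a) cat \<Rightarrow> ('p, 'b) cat \<Rightarrow> ('o, 'a, 'p, 'b) fctr \<Rightarrow> ('p, 'b, 'o, 'a) fctr
   \<Rightarrow> ('o \<Rightarrow> 'a) \<Rightarrow> ('p \<Rightarrow> 'b) \<Rightarrow> bool" where
  "adjunction A B F G \<eta> \<epsilon> \<longleftrightarrow>
     cat_functor A B F \<and> cat_functor B A G \<and>
     nat_trans A A id_functor (G \<circ>\<^sub>F F) \<eta> \<and>
     nat_trans B B (F \<circ>\<^sub>F G) id_functor \<epsilon> \<and>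
     (\<forall>X\<in>Ob A. Cmp B (fob F X) (fob F (fob G (fob F X))) (fob F X)
        (\<epsilon> (fob F X)) (far F X (fob G (fob F X)) (\<eta> X)) = Ident B (fob F X)) \<and>
     (\<forall>Y\<in>Ob B. Cmp A (fob G Y) (fob G (fob F (fob G Y))) (fob G Y)
        (far G (fob F (fob G Y)) Y (\<epsilon> Y)) (\<eta> (fob G Y)) = Ident A (fob G Y))"


section \<open>Finite limits\<close>

definition cone ::
  "('i, 'u) cat \<Rightarrow> ('o, 'a) cat \<Rightarrow> ('i, 'u, 'o, 'a) fctr \<Rightarrow> 'o \<Rightarrow> ('i \<Rightarrow> 'a) \<Rightarrow> bool" where
  "cone J A D L \<pi> \<longleftrightarrow> L \<in> Ob A \<and> (\<forall>i\<in>Ob J. \<pi> i \<in> Ar A L (fob D i)) \<and>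
     (\<forall>i\<in>Ob J. \<forall>j\<in>Ob J. \<forall>u\<in>Ar J i j.
        Cmp A L (fob D i) (fob D j) (far D i j u) (\<pi> i) = \<pi> j)"

definition limit_cone ::
  "('i, 'u) cat \<Rightarrow> ('o, 'a) cat \<Rightarrow> ('i, 'u, 'o, 'a) fctr \<Rightarrow> 'o \<Rightarrow> ('i \<Rightarrow> 'a) \<Rightarrow> bool" where
  "limit_cone J A D L \<pi> \<longleftrightarrow> cone J A D L \<pi> \<and>
     (\<forall>M \<rho>. cone J A D M \<rho> \<longrightarrow>
        (\<exists>!h. h \<in> Ar A M L \<and> (\<forall>i\<in>Ob J. Cmp A M L (fob D i) (\<pi> i) h = \<rho> i)))"

definition finite_category :: "('i, 'u) cat \<Rightarrow> bool" where
  "finite_category J \<longleftrightarrow> category J \<and> finite (Ob J) \<and>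
     (\<forall>i\<in>Ob J. \<forall>j\<in>Ob J. finite (Ar J i j))"

text \<open>Every finite category is isomorphic to one whose objects and arrows are natural numbers.\<close>

definition left_exact ::
  "('o, 'a) cat \<Rightarrow> ('p, 'b) cat \<Rightarrow> ('o, 'a, 'p, 'b) fctr \<Rightarrow> bool" where
  "left_exact A B F \<longleftrightarrow>
     (\<forall>(J :: (nat, nat) cat) D L \<pi>.
        finite_category J \<and> cat_functor J A D \<and> limit_cone J A D L \<pi> \<longrightarrow>
        limit_cone J B (F \<circ>\<^sub>F D) (fob F L) (\<lambda>i. far F L (fob D i) (\<pi> i)))"


section \<open>Geometric morphisms\<close>

text \<open>A geometric morphism \<open>f : E \<rightarrow> S\<close> is given by \<open>f\<^sup>*\<close>, \<open>f\<^sub>*\<close> and the unit and counit of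
  \<open>f\<^sup>* \<stileturn> f\<^sub>*\<close>. The definitions below do not ask that \<open>E\<close> and \<open>S\<close> be toposes; they are used only
  for categories of presheaves of sets.\<close>

record ('e, 'f, 's, 't) geom =
  inv_img :: "('s, 't, 'e, 'f) fctr"
  dir_img :: "('e, 'f, 's, 't) fctr"
  gm_unit :: "'s \<Rightarrow> 't"
  gm_counit :: "'e \<Rightarrow> 'f"

definition geometric_morphism ::
  "('e, 'f) cat \<Rightarrow> ('s, 't) cat \<Rightarrow> ('e, 'f, 's, 't) geom \<Rightarrow> bool" where
  "geometric_morphism E S p \<longleftrightarrow>
     adjunction S E (inv_img p) (dir_img p) (gm_unit p) (gm_counit p) \<and>
     left_exact S E (inv_img p)"

text \<open>The composite of \<open>j : D \<rightarrow> E\<close> and \<open>p : E \<rightarrow> S\<close>.\<close>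

definition comp_geom ::
  "('d, 'c) cat \<Rightarrow> ('s, 't) cat \<Rightarrow> ('e, 'f, 's, 't) geom \<Rightarrow> ('d, 'c, 'e, 'f) geom
   \<Rightarrow> ('d, 'c, 's, 't) geom" where
  "comp_geom D S p j = \<lparr>
     inv_img = inv_img j \<circ>\<^sub>F inv_img p,
     dir_img = dir_img p \<circ>\<^sub>F dir_img j,
     gm_unit = (\<lambda>X.
       let Y = fob (inv_img p) X; Y' = fob (dir_img j) (fob (inv_img j) Y)
       in Cmp S X (fob (dir_img p) Y) (fob (dir_img p) Y')
            (far (dir_img p) Y Y' (gm_unit j Y)) (gm_unit p X)),
     gm_counit = (\<lambda>Z.
       let Y = fob (dir_img j) Z; Y' = fob (inv_img p) (fob (dir_img p) Y)
       in Cmp D (fob (inv_img j) Y') (fob (inv_img j) Y) Z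
            (gm_counit j Z) (far (inv_img j) Y' Y (gm_counit p Y)))\<rparr>"

definition essential ::
  "('e, 'f) cat \<Rightarrow> ('s, 't) cat \<Rightarrow> ('e, 'f, 's, 't) geom \<Rightarrow> bool" where
  "essential E S p \<longleftrightarrow> geometric_morphism E S p \<and>
     (\<exists>L \<eta> \<epsilon>. adjunction E S L (inv_img p) \<eta> \<epsilon>)"

definition subtopos ::
  "('d, 'c) cat \<Rightarrow> ('e, 'f) cat \<Rightarrow> ('d, 'c, 'e, 'f) geom \<Rightarrow> bool" where
  "subtopos D E j \<longleftrightarrow> geometric_morphism D E j \<and> full_and_faithful D E (dir_img j)"

text \<open>\<open>k : D' \<rightarrow> E\<close> is above \<open>j : D \<rightarrow> E\<close>.\<close>

definition above ::
  "('d1, 'c1) cat \<Rightarrow> ('d, 'c) cat \<Rightarrow> ('e, 'f) cat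
   \<Rightarrow> ('d1, 'c1, 'e, 'f) geom \<Rightarrow> ('d, 'c, 'e, 'f) geom \<Rightarrow> bool" where
  "above D' D E k j \<longleftrightarrow>
     (\<exists>H t. cat_functor D D' H \<and> nat_iso D E (dir_img j) (dir_img k \<circ>\<^sub>F H) t)"

text \<open>\<open>R\<close> is a full and faithful right adjoint \<open>p\<^sup>!\<close> of \<open>p\<^sub>*\<close>, with unit \<open>\<eta>\<close> and counit \<open>\<epsilon>\<close>.\<close>

definition local_data ::
  "('e, 'f) cat \<Rightarrow> ('s, 't) cat \<Rightarrow> ('e, 'f, 's, 't) geom
   \<Rightarrow> ('s, 't, 'e, 'f) fctr \<Rightarrow> ('e \<Rightarrow> 'f) \<Rightarrow> ('s \<Rightarrow> 't) \<Rightarrow> bool" where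
  "local_data E S p R \<eta> \<epsilon> \<longleftrightarrow> geometric_morphism E S p \<and>
     adjunction E S (dir_img p) R \<eta> \<epsilon> \<and> full_and_faithful S E R"

definition local_gm ::
  "('e, 'f) cat \<Rightarrow> ('s, 't) cat \<Rightarrow> ('e, 'f, 's, 't) geom \<Rightarrow> bool" where
  "local_gm E S p \<longleftrightarrow> (\<exists>R \<eta> \<epsilon>. local_data E S p R \<eta> \<epsilon>)"

definition centre ::
  "('e, 'f, 's, 't) geom \<Rightarrow> ('s, 't, 'e, 'f) fctr \<Rightarrow> ('e \<Rightarrow> 'f) \<Rightarrow> ('s \<Rightarrow> 't)
   \<Rightarrow> ('s, 't, 'e, 'f) geom" where
  "centre p R \<eta> \<epsilon> = \<lparr>inv_img = dir_img p, dir_img = R, gm_unit = \<eta>, gm_counit = \<epsilon>\<rparr>"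

text \<open>The component at \<open>X\<close> of \<open>\<phi> : p\<^sup>* \<rightarrow> p\<^sup>!\<close>; for local \<open>p\<close> the unit of \<open>p\<^sup>* \<stileturn> p\<^sub>*\<close> is
  invertible.\<close>

definition canonical_transf ::
  "('e, 'f) cat \<Rightarrow> ('s, 't) cat \<Rightarrow> ('e, 'f, 's, 't) geom
   \<Rightarrow> ('s, 't, 'e, 'f) fctr \<Rightarrow> ('e \<Rightarrow> 'f) \<Rightarrow> 's \<Rightarrow> 'f" where
  "canonical_transf E S p R \<eta> X =
     (let Y = fob (inv_img p) X; Z = fob (dir_img p) Y
      in Cmp E Y (fob R Z) (fob R X) (far R Z X (inv_arrow S X Z (gm_unit p X))) (\<eta> Y))"

text \<open>The adjunction \<open>p\<^sub>* \<stileturn> p\<^sup>!\<close> is determined by \<open>p\<close> up to isomorphism, so that the choice made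
  in the next two definitions does not matter.\<close>

definition quality_type ::
  "('e, 'f) cat \<Rightarrow> ('s, 't) cat \<Rightarrow> ('e, 'f, 's, 't) geom \<Rightarrow> bool" where
  "quality_type E S p \<longleftrightarrow> (\<exists>R \<eta> \<epsilon>. local_data E S p R \<eta> \<epsilon> \<and>
     nat_iso S E (inv_img p) R (canonical_transf E S p R \<eta>))"

definition subquality ::
  "('d, 'c) cat \<Rightarrow> ('e, 'f) cat \<Rightarrow> ('s, 't) cat
   \<Rightarrow> ('e, 'f, 's, 't) geom \<Rightarrow> ('d, 'c, 'e, 'f) geom \<Rightarrow> bool" where
  "subquality D E S p j \<longleftrightarrow> subtopos D E j \<and>
     (\<exists>R \<eta> \<epsilon>. local_data E S p R \<eta> \<epsilon> \<and> above D S E j (centre p R \<eta> \<epsilon>)) \<and>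
     quality_type D S (comp_geom D S p j)"

definition essential_subquality ::
  "('d, 'c) cat \<Rightarrow> ('e, 'f) cat \<Rightarrow> ('s, 't) cat
   \<Rightarrow> ('e, 'f, 's, 't) geom \<Rightarrow> ('d, 'c, 'e, 'f) geom \<Rightarrow> bool" where
  "essential_subquality D E S p j \<longleftrightarrow> subquality D E S p j \<and> essential D E j"


section \<open>The category of sets\<close>

text \<open>\<open>\<U>\<close> is the collection of small sets. Only the closure properties that matter for presheaves
  on categories with at most continuum many isomorphism classes and arrows between any two
  objects are required, so that Grothendieck universes with an infinite member are covered
  (\<open>set_universe_grothendieck\<close>), while HOL also has an example
  (\<open>set_universe_complex_sets\<close>).\<close>

definition set_universe :: "'u set set \<Rightarrow> bool" where
  "set_universe \<U> \<longleftrightarrow>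
     (\<exists>X\<in>\<U>. (UNIV :: complex set) \<lesssim> X) \<and>
     (\<forall>X\<in>\<U>. \<forall>Y. Y \<lesssim> X \<longrightarrow> Y \<in> \<U>) \<and>
     (\<forall>F :: complex \<Rightarrow> 'u set. range F \<subseteq> \<U> \<longrightarrow>
        (\<exists>Y\<in>\<U>. Sigma UNIV F \<lesssim> Y) \<and> (\<exists>Y\<in>\<U>. PiE UNIV F \<lesssim> Y))"

lemma set_universe_complex_sets: "set_universe (UNIV :: complex set set set)"
proof -
  have "infinite (UNIV :: complex set)"
    by (rule infinite_UNIV_char_0)
  then have "(card_of (UNIV \<times> UNIV :: (complex \<times> complex) set), card_of (UNIV :: complex set)) \<in> ordLeq"
    using card_of_Times_same_infinite ordIso_iff_ordLeq by blast
  then obtain e :: "complex \<times> complex \<Rightarrow> complex" where "inj e"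
    using card_of_ordLeq[of "UNIV :: (complex \<times> complex) set" "UNIV :: complex set"] by auto
  then have e_eq: "e p = e q \<longleftrightarrow> p = q" for p q by (simp add: inj_eq)
  have "(UNIV :: complex set) \<lesssim> (UNIV :: complex set set)"
    unfolding lepoll_def by (rule exI[of _ "\<lambda>z. {z}"]) (auto simp: inj_on_def)
  moreover have "Sigma UNIV F \<lesssim> (UNIV :: complex set set)" for F :: "complex \<Rightarrow> complex set set"
  proof -
    define g where "g z S = insert (e (0, z)) ((\<lambda>w. e (1, w)) ` S)" for z S
    have g0: "e (0, w) \<in> g z S \<longleftrightarrow> w = z" and g1: "e (1, w) \<in> g z S \<longleftrightarrow> w \<in> S" for w z S
      by (auto simp: g_def e_eq)
    have "z = z' \<and> S = S'" if eq: "g z S = g z' S'" for z z' S S'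
    proof
      show "z = z'" using g0[of z z S] g0[of z z' S'] eq by simp
      have "w \<in> S \<longleftrightarrow> w \<in> S'" for w using g1[of w z S] g1[of w z' S'] eq by simp
      then show "S = S'" by blast
    qed
    then have "inj_on (\<lambda>p. g (fst p) (snd p)) (Sigma UNIV F)"
      by (simp add: inj_on_def split_beta prod_eq_iff)
    then show ?thesis unfolding lepoll_def by blast
  qed
  moreover have "PiE UNIV F \<lesssim> (UNIV :: complex set set)" for F :: "complex \<Rightarrow> complex set set"
  proof -
    define g where "g f = {e (z, w) | z w. w \<in> f z}" for f :: "complex \<Rightarrow> complex set"
    have g_iff: "w \<in> f z \<longleftrightarrow> e (z, w) \<in> g f" for w z f by (auto simp: g_def e_eq)
    have "inj g" by (intro injI ext Set.set_eqI) (simp only: g_iff)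
    then show ?thesis unfolding lepoll_def by (intro exI[of _ g]) (simp add: inj_on_def)
  qed
  ultimately show ?thesis unfolding set_universe_def by blast
qed

lemma set_universe_grothendieck:
  fixes \<U> :: "'u set set"
  assumes inf: "X0 \<in> \<U>" "infinite X0"
    and sub: "\<And>X Y. X \<in> \<U> \<Longrightarrow> Y \<lesssim> X \<Longrightarrow> Y \<in> \<U>"
    and pow: "\<And>X. X \<in> \<U> \<Longrightarrow> \<exists>Y\<in>\<U>. Pow X \<lesssim> Y"
    and fam: "\<And>I F. I \<in> \<U> \<Longrightarrow> F ` I \<subseteq> \<U> \<Longrightarrow> \<exists>Y\<in>\<U>. Sigma I F \<lesssim> Y"
  shows "set_universe \<U>"
proof -
  define c :: "complex \<Rightarrow> (bool \<times> rat) set" where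
    "c z = {(b, q). real_of_rat q < (if b then Re z else Im z)}" for z
  have le: "x \<le> y" if "\<And>q. real_of_rat q < x \<Longrightarrow> real_of_rat q < y" for x y :: real
    using that of_rat_dense[of y x] by (meson less_asym not_le)
  have "Re z \<le> Re z' \<and> Im z \<le> Im z'" if "c z = c z'" for z z'
  proof
    have *: "(b, q) \<in> c z \<Longrightarrow> (b, q) \<in> c z'" for b q using that by simp
    show "Re z \<le> Re z'" using *[of True] by (intro le) (simp add: c_def)
    show "Im z \<le> Im z'" using *[of False] by (intro le) (simp add: c_def)
  qed
  then have c: "inj c" by (metis antisym complex_eqI injI)
  obtain n :: "nat \<Rightarrow> 'u" where n: "inj n" "range n \<subseteq> X0"
    using infinite_countable_subset[OF inf(2)] by blast
  have "inj (n \<circ> (to_nat :: bool \<times> rat \<Rightarrow> nat))"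
    using n(1) by (simp add: inj_compose)
  then have "inj (\<lambda>z. (n \<circ> to_nat) ` c z)"
    by (intro injI injD[OF c]) (simp only: inj_image_eq_iff)
  moreover have "range (\<lambda>z. (n \<circ> to_nat) ` c z) \<subseteq> Pow X0"
    using n(2) by auto
  ultimately have "(UNIV :: complex set) \<lesssim> Pow X0"
    unfolding lepoll_def by blast
  with pow[OF inf(1)] obtain X where X: "X \<in> \<U>" "(UNIV :: complex set) \<lesssim> X"
    using lepoll_trans by blast
  then obtain k :: "complex \<Rightarrow> 'u" where k: "inj k" "range k \<subseteq> X"
    unfolding lepoll_def by blast
  have I: "range k \<in> \<U>" using sub[OF X(1)] subset_imp_lepoll[OF k(2)] by blast
  have *: "(\<exists>Y\<in>\<U>. Sigma UNIV F \<lesssim> Y) \<and> (\<exists>Y\<in>\<U>. PiE UNIV F \<lesssim> Y)"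
    if F: "range F \<subseteq> \<U>" for F :: "complex \<Rightarrow> 'u set"
  proof -
    have "(F \<circ> inv_into UNIV k) ` range k \<subseteq> \<U>" using F by auto
    from fam[OF I this] obtain Y where Y: "Y \<in> \<U>" "Sigma (range k) (F \<circ> inv_into UNIV k) \<lesssim> Y" by blast
    have "Sigma UNIV F \<lesssim> Sigma (range k) (F \<circ> inv_into UNIV k)"
      unfolding lepoll_def using k(1)
      by (intro exI[of _ "\<lambda>(z, w). (k z, w)"]) (auto simp: inj_on_def)
    then have S: "Sigma UNIV F \<lesssim> Y" using Y(2) lepoll_trans by blast
    then obtain g where g: "inj_on g (Sigma UNIV F)" "g ` Sigma UNIV F \<subseteq> Y"
      unfolding lepoll_def by blast
    let ?G = "\<lambda>f. g ` range (\<lambda>z. (z, f z))"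
    have "inj_on ?G (PiE UNIV F)"
    proof (rule inj_onI)
      fix f f' assume f: "f \<in> PiE UNIV F" "f' \<in> PiE UNIV F" and eq: "?G f = ?G f'"
      have "range (\<lambda>z. (z, f z)) = range (\<lambda>z. (z, f' z))"
        by (rule inj_on_image_eq_iff[OF g(1), THEN iffD1, OF _ _ eq]) (use f in auto)
      then show "f = f'" by (auto simp: set_eq_iff image_iff)
    qed
    moreover have "?G f \<in> Pow Y" if "f \<in> PiE UNIV F" for f
    proof -
      have "range (\<lambda>z. (z, f z)) \<subseteq> Sigma UNIV F" using that by auto
      then show ?thesis using g(2) by blast
    qed
    ultimately have "PiE UNIV F \<lesssim> Pow Y"
      unfolding lepoll_def by blast
    with pow[OF Y(1)] have "\<exists>Y\<in>\<U>. PiE UNIV F \<lesssim> Y" using lepoll_trans by blast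
    with S Y(1) show ?thesis by blast
  qed
  show ?thesis unfolding set_universe_def using X sub * by blast
qed

definition set_cat :: "'u set set \<Rightarrow> ('u set, 'u \<Rightarrow> 'u) cat" where
  "set_cat \<U> = \<lparr>Ob = \<U>, Ar = (\<lambda>X Y. X \<rightarrow>\<^sub>E Y),
     Cmp = (\<lambda>X Y Z g f. compose X g f), Ident = (\<lambda>X. \<lambda>x\<in>X. x)\<rparr>"


section \<open>Presheaves\<close>

text \<open>Objects and arrows of presheaf categories are made \<open>undefined\<close> outside their domain, so that
  equality is the intended one.\<close>

definition restrict_functor ::
  "('o, 'a) cat \<Rightarrow> ('o, 'a, 'p, 'b) fctr \<Rightarrow> ('o, 'a, 'p, 'b) fctr" where
  "restrict_functor A F = \<lparr>fob = restrict (fob F) (Ob A),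
     far = (\<lambda>X Y. if X \<in> Ob A \<and> Y \<in> Ob A then restrict (far F X Y) (Ar A X Y)
                   else (\<lambda>_. undefined))\<rparr>"

type_synonym ('o, 'a, 'u) psh = "('o, 'a, 'u set, 'u \<Rightarrow> 'u) fctr"

definition presheaf_cat ::
  "'u set set \<Rightarrow> ('o, 'a) cat \<Rightarrow> (('o, 'a, 'u) psh, 'o \<Rightarrow> 'u \<Rightarrow> 'u) cat" where
  "presheaf_cat \<U> A = \<lparr>
     Ob = {F. cat_functor (opposite A) (set_cat \<U>) F \<and> restrict_functor (opposite A) F = F},
     Ar = (\<lambda>F G. {t. nat_trans (opposite A) (set_cat \<U>) F G t \<and> t \<in> extensional (Ob A)}),
     Cmp = (\<lambda>F G H t s. \<lambda>X\<in>Ob A.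
       Cmp (set_cat \<U>) (fob F X) (fob G X) (fob H X) (t X) (s X)),
     Ident = (\<lambda>F. \<lambda>X\<in>Ob A. Ident (set_cat \<U>) (fob F X))\<rparr>"

definition constant_presheaf ::
  "('o, 'a) cat \<Rightarrow> ('u set, 'u \<Rightarrow> 'u, ('o, 'a, 'u) psh, 'o \<Rightarrow> 'u \<Rightarrow> 'u) fctr" where
  "constant_presheaf A = \<lparr>
     fob = (\<lambda>S. restrict_functor (opposite A)
       \<lparr>fob = (\<lambda>X. S), far = (\<lambda>X Y f. \<lambda>x\<in>S. x)\<rparr>),
     far = (\<lambda>S T h. \<lambda>X\<in>Ob A. h)\<rparr>"

text \<open>The canonical geometric morphism from presheaves to sets, determined up to isomorphism by its
  inverse image.\<close>

definition canonical_geom ::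
  "'u set set \<Rightarrow> ('o, 'a) cat
   \<Rightarrow> (('o, 'a, 'u) psh, 'o \<Rightarrow> 'u \<Rightarrow> 'u, 'u set, 'u \<Rightarrow> 'u) geom \<Rightarrow> bool" where
  "canonical_geom \<U> A p \<longleftrightarrow> geometric_morphism (presheaf_cat \<U> A) (set_cat \<U>) p \<and>
     inv_img p = constant_presheaf A"

text \<open>Restriction of presheaves to a full subcategory \<open>B\<close>, whose arrows are literally arrows of the
  larger category.\<close>

definition restriction ::
  "('o, 'a) cat \<Rightarrow>
   (('o, 'a, 'u) psh, 'o \<Rightarrow> 'u \<Rightarrow> 'u, ('o, 'a, 'u) psh, 'o \<Rightarrow> 'u \<Rightarrow> 'u) fctr" where
  "restriction B = \<lparr>fob = restrict_functor (opposite B), far = (\<lambda>F G t. restrict t (Ob B))\<rparr>"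

definition induced_geom ::
  "'u set set \<Rightarrow> ('o, 'a) cat \<Rightarrow> ('o, 'a) cat
   \<Rightarrow> (('o, 'a, 'u) psh, 'o \<Rightarrow> 'u \<Rightarrow> 'u, ('o, 'a, 'u) psh, 'o \<Rightarrow> 'u \<Rightarrow> 'u) geom \<Rightarrow> bool" where
  "induced_geom \<U> B A j \<longleftrightarrow> geometric_morphism (presheaf_cat \<U> B) (presheaf_cat \<U> A) j \<and>
     inv_img j = restriction B"


section \<open>Algebras\<close>

definition complex_field :: "complex ring" where
  "complex_field = \<lparr>carrier = UNIV, mult = (*), one = 1, zero = 0, add = (+)\<rparr>"

definition algebra_hom :: "'k ring \<Rightarrow> ('k, 'u) module \<Rightarrow> ('k, 'u) module \<Rightarrow> ('u \<Rightarrow> 'u) set" where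
  "algebra_hom K A B = {h \<in> ring_hom A B. h \<in> extensional (carrier A) \<and>
     (\<forall>c\<in>carrier K. \<forall>x\<in>carrier A. h (c \<odot>\<^bsub>A\<^esub> x) = c \<odot>\<^bsub>B\<^esub> h x)}"

text \<open>The subalgebra generated by \<open>S\<close> is the subring generated by \<open>S\<close> and the scalars.\<close>

definition fg_algebra :: "'k ring \<Rightarrow> ('k, 'u) module \<Rightarrow> bool" where
  "fg_algebra K A \<longleftrightarrow> algebra K A \<and>
     (\<exists>S. finite S \<and> S \<subseteq> carrier A \<and>
        generate_ring A (S \<union> (\<lambda>c. c \<odot>\<^bsub>A\<^esub> \<one>\<^bsub>A\<^esub>) ` carrier K) = carrier A)"

definition indecomposable :: "('u, 'm) ring_scheme \<Rightarrow> bool" where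
  "indecomposable A \<longleftrightarrow> card {e \<in> carrier A. e \<otimes>\<^bsub>A\<^esub> e = e} = 2"

definition fg_module :: "'k ring \<Rightarrow> ('k, 'u) module \<Rightarrow> bool" where
  "fg_module K M \<longleftrightarrow> module K M \<and>
     (\<exists>S. finite S \<and> S \<subseteq> carrier M \<and>
        (\<forall>x\<in>carrier M. \<exists>c\<in>S \<rightarrow> carrier K. x = (\<Oplus>\<^bsub>M\<^esub>s\<in>S. c s \<odot>\<^bsub>M\<^esub> s)))"

primrec ideal_power :: "('u, 'm) ring_scheme \<Rightarrow> 'u set \<Rightarrow> nat \<Rightarrow> 'u set" where
  "ideal_power A I 0 = carrier A"
| "ideal_power A I (Suc n) = ideal_prod A I (ideal_power A I n)"

definition weil_algebra :: "'k ring \<Rightarrow> ('k, 'u) module \<Rightarrow> bool" where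
  "weil_algebra K A \<longleftrightarrow> field K \<and> algebra K A \<and> fg_module K A \<and>
     (\<exists>\<mm>. maximalideal \<mm> A \<and> (\<forall>I. maximalideal I A \<longrightarrow> I = \<mm>) \<and>
        (\<lambda>c. \<mm> +>\<^bsub>A\<^esub> (c \<odot>\<^bsub>A\<^esub> \<one>\<^bsub>A\<^esub>)) \<in> ring_iso K (A Quot \<mm>) \<and>
        (\<exists>n. ideal_power A \<mm> n = {\<zero>\<^bsub>A\<^esub>}))"


section \<open>The Gaeta topos and the Weil topos\<close>

text \<open>The algebras have carriers among the subsets of \<open>'u\<close>. If \<open>set_universe \<U>\<close>, then \<open>\<U>\<close> has
  a member at least as large as the complex numbers; hence all finitely generated algebras are
  represented up to isomorphism, and those considered here have their carriers in \<open>\<U>\<close>.\<close>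

definition fg_indec_algebras :: "((complex, 'u) module, 'u \<Rightarrow> 'u) cat" where
  "fg_indec_algebras = \<lparr>
     Ob = {A. fg_algebra complex_field A \<and> indecomposable A},
     Ar = algebra_hom complex_field,
     Cmp = (\<lambda>A B C g f. compose (carrier A) g f),
     Ident = (\<lambda>A. \<lambda>x\<in>carrier A. x)\<rparr>"

definition gaeta_site :: "((complex, 'u) module, 'u \<Rightarrow> 'u) cat" where
  "gaeta_site = opposite fg_indec_algebras"

definition weil_algebras :: "((complex, 'u) module, 'u \<Rightarrow> 'u) cat" where
  "weil_algebras = full_subcategory (opposite gaeta_site) {A. weil_algebra complex_field A}"

definition gaeta_topos ::
  "'u set set \<Rightarrow> (((complex, 'u) module, 'u \<Rightarrow> 'u, 'u) psh, (complex, 'u) module \<Rightarrow> 'u \<Rightarrow> 'u) cat"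
  where "gaeta_topos \<U> = presheaf_cat \<U> gaeta_site"

definition weil_topos ::
  "'u set set \<Rightarrow> (((complex, 'u) module, 'u \<Rightarrow> 'u, 'u) psh, (complex, 'u) module \<Rightarrow> 'u \<Rightarrow> 'u) cat"
  where "weil_topos \<U> = presheaf_cat \<U> (opposite weil_algebras)"

definition gaeta_canonical ::
  "'u set set \<Rightarrow> (((complex, 'u) module, 'u \<Rightarrow> 'u, 'u) psh, (complex, 'u) module \<Rightarrow> 'u \<Rightarrow> 'u,
     'u set, 'u \<Rightarrow> 'u) geom \<Rightarrow> bool" where
  "gaeta_canonical \<U> p \<longleftrightarrow> canonical_geom \<U> gaeta_site p"

definition weil_inclusion ::
  "'u set set \<Rightarrow> (((complex, 'u) module, 'u \<Rightarrow> 'u, 'u) psh, (complex, 'u) module \<Rightarrow> 'u \<Rightarrow> 'u,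
     ((complex, 'u) module, 'u \<Rightarrow> 'u, 'u) psh, (complex, 'u) module \<Rightarrow> 'u \<Rightarrow> 'u) geom \<Rightarrow> bool" where
  "weil_inclusion \<U> j \<longleftrightarrow> induced_geom \<U> (opposite weil_algebras) gaeta_site j"

end

theory Submission
  imports Defs
begin

text \<open>Write \<open>\<Gamma>\<close> for evaluation at the algebra of complex numbers,
  which is terminal in \<open>gaeta_site\<close>, so that \<open>\<Gamma>\<close> is right adjoint
  to the constant presheaf functor. Among Weil algebras the algebra of complex numbers is a zero
  object, because the augmentation of a Weil algebra is its only point; hence in the Weil topos
  the constant presheaf functor is also \<^emph>\<open>right\<close> adjoint to
  \<open>\<Gamma>\<close>, which makes \<open>p j\<close> a quality type. Restriction
  \<open>j\<^sup>*\<close> commutes with \<open>\<Gamma>\<close>, so \<open>j\<^sub>*\<close>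
  applied to constant presheaves is right adjoint to \<open>p\<^sub>*\<close>; thus the centre of
  \<open>p\<close> factors through \<open>j\<close> by construction. Both Kan extensions along the
  inclusion exist because Weil algebras, being determined by structure constants, form at most
  continuum many isomorphism classes, and there are at most continuum many homomorphisms between
  finitely generated algebras.\<close>

section \<open>Adjunctions and universal arrows\<close>

text \<open>The theorem speaks of every \<open>p\<close> and \<open>j\<close> with the prescribed
  inverse image, so their direct images, units and counits are arbitrary. Concrete adjoints
  (evaluation, Kan extensions) are built once, and properties are transported along the isomorphism
  between two adjoints of one functor. The property that travels is invertibility of a counit: it
  gives full faithfulness of the right adjoint and, for \<open>p j\<close>, invertibility of the
  canonical transformation. This is why counits are tracked explicitly throughout. The second
  obstacle is size. A presheaf takes values in members of \<open>\<U>\<close>, whose elements have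
  type \<open>'u\<close>, whereas the natural descriptions of Kan extensions live in function types
  over large index sets. They are formed in their own type, bounded by means of representatives, and
  only then encoded in \<open>'u\<close>. Algebra enters through two facts only: a Weil algebra has
  an augmentation with nilpotent kernel, and the cardinalities involved are at most that of the
  complex numbers.\<close>

context category begin

lemmas cat_simps = ident_in cmp_in cmp_ident_left cmp_ident_right
lemmas cat_assoc = cmp_assoc [symmetric]

lemma inverse_unique:
  assumes "X \<in> Ob A" "Y \<in> Ob A" "f \<in> Ar A X Y" "is_inverse A X Y f g" "is_inverse A X Y f h"
  shows "g = h"
proof -
  have g: "g \<in> Ar A Y X" and h: "h \<in> Ar A Y X" using assms by (auto simp: is_inverse_def)
  have "g = Cmp A Y X X (Cmp A X Y X h f) g" using assms g by (simp add: cat_simps is_inverse_def)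
  also have "\<dots> = Cmp A Y Y X h (Cmp A Y X Y f g)" using assms g h by (simp add: cat_assoc)
  also have "\<dots> = h" using assms h by (simp add: cat_simps is_inverse_def)
  finally show ?thesis .
qed

lemma is_inverse_inv_arrow:
  assumes "X \<in> Ob A" "Y \<in> Ob A" "iso_arrow A X Y f"
  shows "is_inverse A X Y f (inv_arrow A X Y f)"
proof -
  have "\<exists>!g. is_inverse A X Y f g"
    using assms inverse_unique[OF assms(1,2)] by (auto simp: iso_arrow_def)
  then show ?thesis unfolding inv_arrow_def by (rule theI')
qed

lemma iso_arrow_cmp:
  assumes "X \<in> Ob A" "Y \<in> Ob A" "Z \<in> Ob A" "iso_arrow A X Y f" "iso_arrow A Y Z g"
  shows "iso_arrow A X Z (Cmp A X Y Z g f)"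
proof -
  obtain f' g' where f': "is_inverse A X Y f f'" and g': "is_inverse A Y Z g g'"
    using assms by (auto simp: iso_arrow_def)
  have m: "f \<in> Ar A X Y" "g \<in> Ar A Y Z" "f' \<in> Ar A Y X" "g' \<in> Ar A Z Y"
    using assms f' g' by (auto simp: iso_arrow_def is_inverse_def)
  have "Cmp A X Z X (Cmp A Z Y X f' g') (Cmp A X Y Z g f)
      = Cmp A X Y X f' (Cmp A X Y Y (Cmp A Y Z Y g' g) f)"
    using m assms(1-3) by (simp add: cat_simps cat_assoc)
  then have 1: "Cmp A X Z X (Cmp A Z Y X f' g') (Cmp A X Y Z g f) = Ident A X"
    using f' g' m assms(1-3) by (simp add: is_inverse_def cat_simps)
  have "Cmp A Z X Z (Cmp A X Y Z g f) (Cmp A Z Y X f' g')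
      = Cmp A Z Y Z g (Cmp A Z Y Y (Cmp A Y X Y f f') g')"
    using m assms(1-3) by (simp add: cat_simps cat_assoc)
  then have 2: "Cmp A Z X Z (Cmp A X Y Z g f) (Cmp A Z Y X f' g') = Ident A Z"
    using f' g' m assms(1-3) by (simp add: is_inverse_def cat_simps)
  show ?thesis unfolding iso_arrow_def is_inverse_def
    using 1 2 m assms(1-3) by (auto simp: cat_simps intro!: exI[of _ "Cmp A Z Y X f' g'"])
qed

lemma iso_arrow_ident: "X \<in> Ob A \<Longrightarrow> iso_arrow A X X (Ident A X)"
  by (auto simp: iso_arrow_def is_inverse_def cat_simps intro!: exI[of _ "Ident A X"])

lemma iso_arrow_inv:
  assumes "X \<in> Ob A" "Y \<in> Ob A" "iso_arrow A X Y f"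
  shows "iso_arrow A Y X (inv_arrow A X Y f)"
  using is_inverse_inv_arrow[OF assms] assms(3)
  by (auto simp: iso_arrow_def is_inverse_def)

text \<open>A one-sided inverse of an invertible arrow must be its inverse. Together with a triangle
  identity this turns invertibility of a counit into invertibility of a unit component.\<close>

lemma iso_arrow_right_inverse:
  assumes "X \<in> Ob A" "Y \<in> Ob A" "iso_arrow A X Y f" "g \<in> Ar A Y X"
    "Cmp A Y X Y f g = Ident A Y"
  shows "iso_arrow A Y X g"
proof -
  obtain f' where f': "is_inverse A X Y f f'" and m: "f \<in> Ar A X Y"
    using assms by (auto simp: iso_arrow_def)
  then have m': "f' \<in> Ar A Y X" by (auto simp: is_inverse_def)
  have "f' = Cmp A Y Y X f' (Cmp A Y X Y f g)" using assms m' by (simp add: cat_simps)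
  also have "\<dots> = Cmp A Y X X (Cmp A X Y X f' f) g" using assms(1-4) m m' by (rule_tac cmp_assoc)
  also have "\<dots> = g" using assms f' by (simp add: is_inverse_def cat_simps)
  finally show ?thesis using f' m by (auto simp: iso_arrow_def is_inverse_def)
qed

end

lemma category_opposite: "category A \<Longrightarrow> category (opposite A)"
  by (unfold_locales) (auto simp: opposite_def category.cat_simps category.cmp_assoc)

lemma opposite_sel [simp]: "Ob (opposite A) = Ob A" "Ar (opposite A) X Y = Ar A Y X"
  "Cmp (opposite A) X Y Z g f = Cmp A Z Y X f g" "Ident (opposite A) = Ident A"
  by (simp_all add: opposite_def)

lemma opposite_opposite [simp]: "opposite (opposite A) = A"
  by (simp add: opposite_def)

context cat_functor begin

lemmas functor_simps = fob_in far_in far_ident far_cmp A.cat_simps B.cat_simps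

lemma far_iso:
  assumes "X \<in> Ob A" "Y \<in> Ob A" "iso_arrow A X Y f"
  shows "iso_arrow B (fob F X) (fob F Y) (far F X Y f)"
proof -
  obtain g where g: "is_inverse A X Y f g" and m: "f \<in> Ar A X Y"
    using assms by (auto simp: iso_arrow_def)
  then have m': "g \<in> Ar A Y X" by (auto simp: is_inverse_def)
  have "is_inverse B (fob F X) (fob F Y) (far F X Y f) (far F Y X g)"
    using g m m' assms(1,2) by (simp add: is_inverse_def functor_simps flip: far_cmp)
  then show ?thesis using m assms(1,2) by (auto simp: iso_arrow_def functor_simps)
qed

end

lemma fctr_eqI:
  assumes "\<And>X. fob F X = fob G X" "\<And>X Y f. far F X Y f = far G X Y f"
  shows "F = (G :: ('o, 'a, 'p, 'b) fctr)"
  using assms by (cases F; cases G) (auto simp: fun_eq_iff)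

lemma comp_functor_sel [simp]: "fob (G \<circ>\<^sub>F F) X = fob G (fob F X)"
  "far (G \<circ>\<^sub>F F) X Y f = far G (fob F X) (fob F Y) (far F X Y f)"
  by (simp_all add: comp_functor_def)

lemma id_functor_sel [simp]: "fob id_functor X = X" "far id_functor X Y f = f"
  by (simp_all add: id_functor_def)

lemma cat_functor_comp:
  assumes "cat_functor A B F" "cat_functor B C G"
  shows "cat_functor A C (G \<circ>\<^sub>F F)"
proof -
  interpret F: cat_functor A B F by fact
  interpret G: cat_functor B C G by fact
  show ?thesis by unfold_locales (simp_all add: F.functor_simps G.functor_simps)
qed

lemma nat_transD:
  assumes "nat_trans A B F G t"
  shows "X \<in> Ob A \<Longrightarrow> t X \<in> Ar B (fob F X) (fob G X)"
    and "\<lbrakk>X \<in> Ob A; Y \<in> Ob A; f \<in> Ar A X Y\<rbrakk> \<Longrightarrow>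
        Cmp B (fob F X) (fob F Y) (fob G Y) (t Y) (far F X Y f) =
        Cmp B (fob F X) (fob G X) (fob G Y) (far G X Y f) (t X)"
  using assms by (auto simp: nat_trans_def)

text \<open>\<open>(R, e)\<close> is a terminal object of the comma category of \<open>F\<close>
  over \<open>Y\<close>. A right adjoint of \<open>F\<close> is a choice of such data for every
  \<open>Y\<close>, so adjunctions can be built object by object.\<close>

definition couniversal ::
  "('o, 'a) cat \<Rightarrow> ('p, 'b) cat \<Rightarrow> ('o, 'a, 'p, 'b) fctr \<Rightarrow> 'p \<Rightarrow> 'o \<Rightarrow> 'b \<Rightarrow> bool" where
  "couniversal A B F Y R e \<longleftrightarrow> Y \<in> Ob B \<and> R \<in> Ob A \<and> e \<in> Ar B (fob F R) Y \<and>
     (\<forall>X\<in>Ob A. \<forall>f\<in>Ar B (fob F X) Y.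
        \<exists>!g. g \<in> Ar A X R \<and> Cmp B (fob F X) (fob F R) Y e (far F X R g) = f)"

lemma couniversalD:
  assumes "couniversal A B F Y R e"
  shows "Y \<in> Ob B" "R \<in> Ob A" "e \<in> Ar B (fob F R) Y"
    and "X \<in> Ob A \<Longrightarrow> f \<in> Ar B (fob F X) Y \<Longrightarrow>
        \<exists>g. g \<in> Ar A X R \<and> Cmp B (fob F X) (fob F R) Y e (far F X R g) = f"
  using assms unfolding couniversal_def by blast+

lemma couniversal_cancel:
  assumes "couniversal A B F Y R e" "cat_functor A B F" "X \<in> Ob A" "g \<in> Ar A X R" "h \<in> Ar A X R"
    "Cmp B (fob F X) (fob F R) Y e (far F X R g) = Cmp B (fob F X) (fob F R) Y e (far F X R h)"
  shows "g = h"
proof -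
  interpret F: cat_functor A B F by fact
  have "Cmp B (fob F X) (fob F R) Y e (far F X R h) \<in> Ar B (fob F X) Y"
    using assms(1,3,5) by (simp add: couniversal_def F.functor_simps)
  then show ?thesis using assms unfolding couniversal_def by blast
qed

text \<open>Both arrows have the transpose \<open>e\<close>, and transposition is injective. The
  other composite is the same statement with the two universal arrows exchanged.\<close>

lemma couniversal_inverse:
  assumes F: "cat_functor A B F" and u: "couniversal A B F Y R e" and u': "couniversal A B F Y R' e'"
    and t: "t \<in> Ar A R R'" and t': "t' \<in> Ar A R' R"
    and te: "Cmp B (fob F R) (fob F R') Y e' (far F R R' t) = e"
    and te': "Cmp B (fob F R') (fob F R) Y e (far F R' R t') = e'"
  shows "Cmp A R R' R t' t = Ident A R"
proof (rule couniversal_cancel[OF u F])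
  interpret F: cat_functor A B F by fact
  note s = F.functor_simps F.A.cat_assoc F.B.cat_assoc t t' couniversalD(1-3)[OF u] couniversalD(1-3)[OF u']
  have "Cmp B (fob F R) (fob F R) Y e (far F R R (Cmp A R R' R t' t))
    = Cmp B (fob F R) (fob F R') Y (Cmp B (fob F R') (fob F R) Y e (far F R' R t')) (far F R R' t)"
    by (simp add: s)
  then show "Cmp B (fob F R) (fob F R) Y e (far F R R (Cmp A R R' R t' t))
    = Cmp B (fob F R) (fob F R) Y e (far F R R (Ident A R))"
    by (simp add: te te' s)
  show "R \<in> Ob A" "Cmp A R R' R t' t \<in> Ar A R R" "Ident A R \<in> Ar A R R" by (simp_all add: s)
qed

text \<open>Arrows into \<open>fob G Y\<close> are separated by their transposes along
  \<open>\<epsilon> Y\<close>; hence one triangle identity already forces naturality of the unit and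
  the other triangle identity. The unit is a parameter because \<open>comp_geom\<close> prescribes a
  formula for it.\<close>

lemma adjunction_of_unit:
  assumes F: "cat_functor A B F" and G: "cat_functor B A G"
    and eps: "nat_trans B B (F \<circ>\<^sub>F G) id_functor \<epsilon>"
    and univ: "\<And>Y. Y \<in> Ob B \<Longrightarrow> couniversal A B F Y (fob G Y) (\<epsilon> Y)"
    and eta: "\<And>X. X \<in> Ob A \<Longrightarrow> \<eta> X \<in> Ar A X (fob G (fob F X))"
    and tri: "\<And>X. X \<in> Ob A \<Longrightarrow> Cmp B (fob F X) (fob F (fob G (fob F X))) (fob F X)
        (\<epsilon> (fob F X)) (far F X (fob G (fob F X)) (\<eta> X)) = Ident B (fob F X)"
  shows "adjunction A B F G \<eta> \<epsilon>"
proof -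
  interpret F: cat_functor A B F by fact
  interpret G: cat_functor B A G by fact
  note s = F.functor_simps G.functor_simps F.A.cat_assoc F.B.cat_assoc eta
  have eps_in: "\<epsilon> Y \<in> Ar B (fob F (fob G Y)) Y" if "Y \<in> Ob B" for Y
    using nat_transD(1)[OF eps that] by simp
  have eps_nat: "Cmp B (fob F (fob G Y)) (fob F (fob G Z)) Z (\<epsilon> Z) (far F (fob G Y) (fob G Z) (far G Y Z f))
    = Cmp B (fob F (fob G Y)) Y Z f (\<epsilon> Y)" if "Y \<in> Ob B" "Z \<in> Ob B" "f \<in> Ar B Y Z" for Y Z f
    using nat_transD(2)[OF eps that] by simp
  have "Cmp A X Y (fob G (fob F Y)) (\<eta> Y) f
      = Cmp A X (fob G (fob F X)) (fob G (fob F Y)) (far G (fob F X) (fob F Y) (far F X Y f)) (\<eta> X)"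
    if X: "X \<in> Ob A" and Y: "Y \<in> Ob A" and f: "f \<in> Ar A X Y" for X Y f
  \<comment> \<open>Both sides of the naturality square have the transpose
    \<open>far F X Y f\<close>.\<close>
  proof (rule couniversal_cancel[OF univ F])
    let ?FX = "fob F X" and ?FY = "fob F Y" and ?GX = "fob G (fob F X)" and ?GY = "fob G (fob F Y)"
    have "Cmp B ?FX (fob F ?GY) ?FY (\<epsilon> ?FY) (far F X ?GY (Cmp A X Y ?GY (\<eta> Y) f))
      = Cmp B ?FX ?FY ?FY (Cmp B ?FY (fob F ?GY) ?FY (\<epsilon> ?FY) (far F Y ?GY (\<eta> Y))) (far F X Y f)"
      using X Y f by (simp add: s eps_in)
    also have "\<dots> = Cmp B ?FX ?FX ?FY (far F X Y f)
         (Cmp B ?FX (fob F ?GX) ?FX (\<epsilon> ?FX) (far F X ?GX (\<eta> X)))"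
      using X Y f by (simp add: s eps_in tri)
    also have "\<dots> = Cmp B ?FX (fob F ?GX) ?FY (Cmp B (fob F ?GX) ?FX ?FY (far F X Y f) (\<epsilon> ?FX))
         (far F X ?GX (\<eta> X))"
      using X Y f by (simp add: s eps_in)
    also have "\<dots> = Cmp B ?FX (fob F ?GX) ?FY (Cmp B (fob F ?GX) (fob F ?GY) ?FY (\<epsilon> ?FY)
           (far F ?GX ?GY (far G ?FX ?FY (far F X Y f)))) (far F X ?GX (\<eta> X))"
      using X Y f by (simp add: s eps_nat)
    also have "\<dots> = Cmp B ?FX (fob F ?GY) ?FY (\<epsilon> ?FY)
         (far F X ?GY (Cmp A X ?GX ?GY (far G ?FX ?FY (far F X Y f)) (\<eta> X)))"
      using X Y f by (simp add: s eps_in)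
    finally show "Cmp B ?FX (fob F ?GY) ?FY (\<epsilon> ?FY) (far F X ?GY (Cmp A X Y ?GY (\<eta> Y) f))
      = Cmp B ?FX (fob F ?GY) ?FY (\<epsilon> ?FY)
         (far F X ?GY (Cmp A X ?GX ?GY (far G ?FX ?FY (far F X Y f)) (\<eta> X)))" .
  qed (use X Y f in \<open>simp_all add: s\<close>)
  then have nat: "nat_trans A A id_functor (G \<circ>\<^sub>F F) \<eta>" by (simp add: nat_trans_def eta)
  have "Cmp A (fob G Y) (fob G (fob F (fob G Y))) (fob G Y)
        (far G (fob F (fob G Y)) Y (\<epsilon> Y)) (\<eta> (fob G Y)) = Ident A (fob G Y)"
    if Y: "Y \<in> Ob B" for Y
  proof (rule couniversal_cancel[OF univ F])
    let ?G = "fob G Y" let ?FG = "fob F ?G" let ?GFG = "fob G ?FG"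
    have "Cmp B ?FG ?FG Y (\<epsilon> Y) (far F ?G ?G (Cmp A ?G ?GFG ?G (far G ?FG Y (\<epsilon> Y)) (\<eta> ?G)))
      = Cmp B ?FG (fob F ?GFG) Y (Cmp B (fob F ?GFG) ?FG Y (\<epsilon> Y) (far F ?GFG ?G (far G ?FG Y (\<epsilon> Y))))
          (far F ?G ?GFG (\<eta> ?G))"
      using Y by (simp add: s eps_in)
    also have "\<dots> = Cmp B ?FG ?FG Y (\<epsilon> Y) (Cmp B ?FG (fob F ?GFG) ?FG (\<epsilon> ?FG) (far F ?G ?GFG (\<eta> ?G)))"
      using Y by (simp add: s eps_in eps_nat)
    also have "\<dots> = Cmp B ?FG ?FG Y (\<epsilon> Y) (far F ?G ?G (Ident A ?G))"
      using Y by (simp add: s tri)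
    finally show "Cmp B ?FG ?FG Y (\<epsilon> Y) (far F ?G ?G (Cmp A ?G ?GFG ?G (far G ?FG Y (\<epsilon> Y)) (\<eta> ?G)))
      = Cmp B ?FG ?FG Y (\<epsilon> Y) (far F ?G ?G (Ident A ?G))" .
  qed (use Y in \<open>simp_all add: s eps_in\<close>)
  then show ?thesis unfolding adjunction_def using F G eps nat tri by blast
qed

lemma adjunction_of_counit:
  assumes F: "cat_functor A B F" and G: "cat_functor B A G"
    and eps: "nat_trans B B (F \<circ>\<^sub>F G) id_functor \<epsilon>"
    and univ: "\<And>Y. Y \<in> Ob B \<Longrightarrow> couniversal A B F Y (fob G Y) (\<epsilon> Y)"
  shows "\<exists>\<eta>. adjunction A B F G \<eta> \<epsilon>"
proof -
  interpret F: cat_functor A B F by fact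
  have "\<exists>g. g \<in> Ar A X (fob G (fob F X)) \<and> Cmp B (fob F X) (fob F (fob G (fob F X))) (fob F X)
      (\<epsilon> (fob F X)) (far F X (fob G (fob F X)) g) = Ident B (fob F X)" if "X \<in> Ob A" for X
    using that by (intro couniversalD(4)[OF univ]) (simp_all add: F.functor_simps)
  then obtain \<eta> where "\<And>X. X \<in> Ob A \<Longrightarrow> \<eta> X \<in> Ar A X (fob G (fob F X)) \<and>
      Cmp B (fob F X) (fob F (fob G (fob F X))) (fob F X)
      (\<epsilon> (fob F X)) (far F X (fob G (fob F X)) (\<eta> X)) = Ident B (fob F X)"
    by metis
  then have "adjunction A B F G \<eta> \<epsilon>" by (intro adjunction_of_unit assms) auto
  then show ?thesis by blast
qed

text \<open>The object map and the counit of the adjunction are exactly the given ones, so whatever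
  was shown of \<open>\<epsilon>\<close>, such as invertibility, remains available. On arrows,
  \<open>f\<close> is sent to the factorization of \<open>f\<close> after
  \<open>\<epsilon> Y\<close>.\<close>

lemma right_adjoint_exists:
  assumes F: "cat_functor A B F"
    and univ: "\<And>Y. Y \<in> Ob B \<Longrightarrow> couniversal A B F Y (R Y) (\<epsilon> Y)"
  shows "\<exists>G \<eta>. fob G = R \<and> adjunction A B F G \<eta> \<epsilon>"
proof -
  interpret F: cat_functor A B F by fact
  note D = couniversalD[OF univ]
  note s = F.functor_simps F.A.cat_assoc F.B.cat_assoc D(1-3)
  have "\<exists>g. g \<in> Ar A (R Y) (R Z) \<and> Cmp B (fob F (R Y)) (fob F (R Z)) Z (\<epsilon> Z) (far F (R Y) (R Z) g)
      = Cmp B (fob F (R Y)) Y Z f (\<epsilon> Y)" if "Y \<in> Ob B" "Z \<in> Ob B" "f \<in> Ar B Y Z" for Y Z f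
    using that by (intro D(4)) (simp_all add: s)
  then obtain r where r: "\<And>Y Z f. \<lbrakk>Y \<in> Ob B; Z \<in> Ob B; f \<in> Ar B Y Z\<rbrakk> \<Longrightarrow> r Y Z f \<in> Ar A (R Y) (R Z)"
    and nat: "\<And>Y Z f. \<lbrakk>Y \<in> Ob B; Z \<in> Ob B; f \<in> Ar B Y Z\<rbrakk> \<Longrightarrow>
      Cmp B (fob F (R Y)) (fob F (R Z)) Z (\<epsilon> Z) (far F (R Y) (R Z) (r Y Z f))
      = Cmp B (fob F (R Y)) Y Z f (\<epsilon> Y)"
    by metis
  define G where "G = \<lparr>fob = R, far = r\<rparr>"
  have "r Y Y (Ident B Y) = Ident A (R Y)" if Y: "Y \<in> Ob B" for Y
    by (rule couniversal_cancel[OF univ F, of Y "R Y"]) (use Y in \<open>simp_all add: s r nat\<close>)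
  moreover have "r X Z (Cmp B X Y Z g f) = Cmp A (R X) (R Y) (R Z) (r Y Z g) (r X Y f)"
    if X: "X \<in> Ob B" "Y \<in> Ob B" "Z \<in> Ob B" and f: "f \<in> Ar B X Y" "g \<in> Ar B Y Z" for X Y Z f g
  proof (rule couniversal_cancel[OF univ F])
    have "Cmp B (fob F (R X)) (fob F (R Z)) Z (\<epsilon> Z)
        (far F (R X) (R Z) (Cmp A (R X) (R Y) (R Z) (r Y Z g) (r X Y f)))
      = Cmp B (fob F (R X)) (fob F (R Y)) Z (Cmp B (fob F (R Y)) (fob F (R Z)) Z (\<epsilon> Z)
          (far F (R Y) (R Z) (r Y Z g))) (far F (R X) (R Y) (r X Y f))"
      using X f by (simp add: s r)
    also have "\<dots> = Cmp B (fob F (R X)) X Z (Cmp B X Y Z g f) (\<epsilon> X)"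
      using X f by (simp add: s r nat)
    finally show "Cmp B (fob F (R X)) (fob F (R Z)) Z (\<epsilon> Z) (far F (R X) (R Z) (r X Z (Cmp B X Y Z g f)))
      = Cmp B (fob F (R X)) (fob F (R Z)) Z (\<epsilon> Z)
        (far F (R X) (R Z) (Cmp A (R X) (R Y) (R Z) (r Y Z g) (r X Y f)))"
      using X f by (simp add: s r nat)
  qed (use X f in \<open>simp_all add: s r\<close>)
  ultimately have G: "cat_functor B A G"
    by unfold_locales (simp_all add: G_def s r)
  have "nat_trans B B (F \<circ>\<^sub>F G) id_functor \<epsilon>"
    by (simp add: nat_trans_def G_def s nat)
  from adjunction_of_counit[OF F G this] univ have "\<exists>\<eta>. adjunction A B F G \<eta> \<epsilon>" by (auto simp: G_def)
  then show ?thesis by (intro exI[of _ G]) (simp add: G_def)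
qed

section \<open>Consequences of an adjunction: uniqueness, transfer along isomorphisms,
  composition\<close>

lemma adjunctionD:
  assumes "adjunction A B F G \<eta> \<epsilon>"
  shows "cat_functor A B F" "cat_functor B A G"
    "nat_trans A A id_functor (G \<circ>\<^sub>F F) \<eta>" "nat_trans B B (F \<circ>\<^sub>F G) id_functor \<epsilon>"
    "X \<in> Ob A \<Longrightarrow> \<eta> X \<in> Ar A X (fob G (fob F X))"
    "Y \<in> Ob B \<Longrightarrow> \<epsilon> Y \<in> Ar B (fob F (fob G Y)) Y"
    "\<lbrakk>X \<in> Ob A; X' \<in> Ob A; f \<in> Ar A X X'\<rbrakk> \<Longrightarrow> Cmp A X X' (fob G (fob F X')) (\<eta> X') f
      = Cmp A X (fob G (fob F X)) (fob G (fob F X')) (far G (fob F X) (fob F X') (far F X X' f)) (\<eta> X)"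
    "\<lbrakk>Y \<in> Ob B; Z \<in> Ob B; h \<in> Ar B Y Z\<rbrakk> \<Longrightarrow>
      Cmp B (fob F (fob G Y)) (fob F (fob G Z)) Z (\<epsilon> Z) (far F (fob G Y) (fob G Z) (far G Y Z h))
      = Cmp B (fob F (fob G Y)) Y Z h (\<epsilon> Y)"
    "X \<in> Ob A \<Longrightarrow> Cmp B (fob F X) (fob F (fob G (fob F X))) (fob F X)
        (\<epsilon> (fob F X)) (far F X (fob G (fob F X)) (\<eta> X)) = Ident B (fob F X)"
    "Y \<in> Ob B \<Longrightarrow> Cmp A (fob G Y) (fob G (fob F (fob G Y))) (fob G Y)
        (far G (fob F (fob G Y)) Y (\<epsilon> Y)) (\<eta> (fob G Y)) = Ident A (fob G Y)"
  using assms nat_transD[of A A id_functor "G \<circ>\<^sub>F F" \<eta>] nat_transD[of B B "F \<circ>\<^sub>F G" id_functor \<epsilon>]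
  unfolding adjunction_def by simp_all

lemma adjunction_couniversal:
  assumes adj: "adjunction A B F G \<eta> \<epsilon>" and Y: "Y \<in> Ob B"
  shows "couniversal A B F Y (fob G Y) (\<epsilon> Y)"
proof -
  interpret F: cat_functor A B F using adj by (rule adjunctionD)
  interpret G: cat_functor B A G using adj by (rule adjunctionD)
  note D = adjunctionD(5-10)[OF adj]
  note s = F.functor_simps G.functor_simps D(1,2) F.A.cat_assoc F.B.cat_assoc Y
  let ?G = "fob G Y"
  have "\<exists>!g. g \<in> Ar A X ?G \<and> Cmp B (fob F X) (fob F ?G) Y (\<epsilon> Y) (far F X ?G g) = f"
    if X: "X \<in> Ob A" and f: "f \<in> Ar B (fob F X) Y" for X f
  proof (rule ex1I)
    let ?GF = "fob G (fob F X)"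
    let ?g = "Cmp A X ?GF ?G (far G (fob F X) Y f) (\<eta> X)"
    have "Cmp B (fob F X) (fob F ?G) Y (\<epsilon> Y) (far F X ?G ?g)
      = Cmp B (fob F X) (fob F ?GF) Y (Cmp B (fob F ?GF) (fob F ?G) Y (\<epsilon> Y)
          (far F ?GF ?G (far G (fob F X) Y f))) (far F X ?GF (\<eta> X))"
      using X f by (simp add: s)
    also have "\<dots> = Cmp B (fob F X) (fob F X) Y f
        (Cmp B (fob F X) (fob F ?GF) (fob F X) (\<epsilon> (fob F X)) (far F X ?GF (\<eta> X)))"
      using X f by (simp add: s D(4))
    also have "\<dots> = f" using X f by (simp add: s D(5))
    finally show "?g \<in> Ar A X ?G \<and> Cmp B (fob F X) (fob F ?G) Y (\<epsilon> Y) (far F X ?G ?g) = f"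
      using X f by (simp add: s)
    fix g assume "g \<in> Ar A X ?G \<and> Cmp B (fob F X) (fob F ?G) Y (\<epsilon> Y) (far F X ?G g) = f"
    then have g: "g \<in> Ar A X ?G" and fg: "f = Cmp B (fob F X) (fob F ?G) Y (\<epsilon> Y) (far F X ?G g)" by auto
    have "?g = Cmp A X (fob G (fob F ?G)) ?G (far G (fob F ?G) Y (\<epsilon> Y))
        (Cmp A X ?GF (fob G (fob F ?G)) (far G (fob F X) (fob F ?G) (far F X ?G g)) (\<eta> X))"
      using X f g by (simp add: s fg)
    also have "\<dots> = Cmp A X ?G ?G (Cmp A ?G (fob G (fob F ?G)) ?G (far G (fob F ?G) Y (\<epsilon> Y)) (\<eta> ?G)) g"
      using X g by (simp add: s D(3))
    also have "\<dots> = g" using X g by (simp add: s D(6))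
    finally show "g = ?g" by simp
  qed
  then show ?thesis by (simp add: couniversal_def s)
qed

text \<open>The comparison is the factorization of one counit through the other. Its compatibility
  with the counits is recorded because transferring invertibility of a counit depends on it.\<close>

lemma right_adjoint_unique:
  assumes adj: "adjunction A B F G \<eta> \<epsilon>" and adj': "adjunction A B F G' \<eta>' \<epsilon>'"
  shows "\<exists>\<theta>. nat_iso B A G G' \<theta> \<and> (\<forall>Y\<in>Ob B.
    Cmp B (fob F (fob G Y)) (fob F (fob G' Y)) Y (\<epsilon>' Y) (far F (fob G Y) (fob G' Y) (\<theta> Y)) = \<epsilon> Y)"
proof -
  interpret F: cat_functor A B F using adj by (rule adjunctionD)
  interpret G: cat_functor B A G using adj by (rule adjunctionD)
  interpret G': cat_functor B A G' using adj' by (rule adjunctionD)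
  note D = adjunctionD(5-10)[OF adj]
  note D' = adjunctionD(5-10)[OF adj']
  note s = F.functor_simps G.functor_simps G'.functor_simps D(1,2) D'(1,2) F.A.cat_assoc F.B.cat_assoc
  note u = adjunction_couniversal[OF adj] and u' = adjunction_couniversal[OF adj']
  have "\<exists>t. t \<in> Ar A (fob G Y) (fob G' Y) \<and> Cmp B (fob F (fob G Y)) (fob F (fob G' Y)) Y (\<epsilon>' Y)
      (far F (fob G Y) (fob G' Y) t) = \<epsilon> Y" if "Y \<in> Ob B" for Y
    using that by (intro couniversalD(4)[OF u']) (simp_all add: s)
  then obtain \<theta> where t: "\<And>Y. Y \<in> Ob B \<Longrightarrow> \<theta> Y \<in> Ar A (fob G Y) (fob G' Y)"
    and te: "\<And>Y. Y \<in> Ob B \<Longrightarrow> Cmp B (fob F (fob G Y)) (fob F (fob G' Y)) Y (\<epsilon>' Y)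
      (far F (fob G Y) (fob G' Y) (\<theta> Y)) = \<epsilon> Y" by metis
  have "\<exists>t. t \<in> Ar A (fob G' Y) (fob G Y) \<and> Cmp B (fob F (fob G' Y)) (fob F (fob G Y)) Y (\<epsilon> Y)
      (far F (fob G' Y) (fob G Y) t) = \<epsilon>' Y" if "Y \<in> Ob B" for Y
    using that by (intro couniversalD(4)[OF u]) (simp_all add: s)
  then obtain \<theta>' where t': "\<And>Y. Y \<in> Ob B \<Longrightarrow> \<theta>' Y \<in> Ar A (fob G' Y) (fob G Y)"
    and te': "\<And>Y. Y \<in> Ob B \<Longrightarrow> Cmp B (fob F (fob G' Y)) (fob F (fob G Y)) Y (\<epsilon> Y)
      (far F (fob G' Y) (fob G Y) (\<theta>' Y)) = \<epsilon>' Y" by metis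
  have "Cmp A (fob G Y) (fob G' Y) (fob G Y) (\<theta>' Y) (\<theta> Y) = Ident A (fob G Y)" if "Y \<in> Ob B" for Y
    using that by (intro couniversal_inverse[OF F.cat_functor_axioms u u' t t' te te'])
  moreover have "Cmp A (fob G' Y) (fob G Y) (fob G' Y) (\<theta> Y) (\<theta>' Y) = Ident A (fob G' Y)" if "Y \<in> Ob B" for Y
    using that by (intro couniversal_inverse[OF F.cat_functor_axioms u' u t' t te' te])
  ultimately have iso: "iso_arrow A (fob G Y) (fob G' Y) (\<theta> Y)" if "Y \<in> Ob B" for Y
    using that t[OF that] t'[OF that] unfolding iso_arrow_def is_inverse_def by blast
  have "Cmp A (fob G Y) (fob G Z) (fob G' Z) (\<theta> Z) (far G Y Z f)
      = Cmp A (fob G Y) (fob G' Y) (fob G' Z) (far G' Y Z f) (\<theta> Y)"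
    if Y: "Y \<in> Ob B" "Z \<in> Ob B" "f \<in> Ar B Y Z" for Y Z f
  proof (rule couniversal_cancel[OF u' F.cat_functor_axioms])
    let ?Y = "fob G Y" and ?Z = "fob G Z" and ?Y' = "fob G' Y" and ?Z' = "fob G' Z"
    let ?L = "Cmp A ?Y ?Z ?Z' (\<theta> Z) (far G Y Z f)"
    let ?R = "Cmp A ?Y ?Y' ?Z' (far G' Y Z f) (\<theta> Y)"
    have "Cmp B (fob F ?Y) (fob F ?Z') Z (\<epsilon>' Z) (far F ?Y ?Z' ?L)
      = Cmp B (fob F ?Y) (fob F ?Z) Z (Cmp B (fob F ?Z) (fob F ?Z') Z (\<epsilon>' Z)
      (far F ?Z ?Z' (\<theta> Z))) (far F ?Y ?Z (far G Y Z f))"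
      using Y by (simp add: s t)
    also have "\<dots> = Cmp B (fob F ?Y) Y Z f (Cmp B (fob F ?Y) (fob F ?Y') Y (\<epsilon>' Y)
      (far F ?Y ?Y' (\<theta> Y)))"
      using Y by (simp only: te D(4))
    also have "\<dots> = Cmp B (fob F ?Y) (fob F ?Y') Z (Cmp B (fob F ?Y') Y Z f (\<epsilon>' Y))
      (far F ?Y ?Y' (\<theta> Y))"
      using Y by (simp add: s t)
    also have "\<dots> = Cmp B (fob F ?Y) (fob F ?Z') Z (\<epsilon>' Z) (far F ?Y ?Z' ?R)"
      using Y by (subst D'(4) [symmetric]) (simp_all add: s t)
    finally show "Cmp B (fob F ?Y) (fob F ?Z') Z (\<epsilon>' Z) (far F ?Y ?Z' ?L)
      = Cmp B (fob F ?Y) (fob F ?Z') Z (\<epsilon>' Z) (far F ?Y ?Z' ?R)" .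
  qed (use Y in \<open>simp_all add: s t\<close>)
  then have "nat_iso B A G G' \<theta>" using iso t by (simp add: nat_iso_def nat_trans_def)
  then show ?thesis using te by blast
qed

text \<open>The second counit is the first one after \<open>F\<close> applied to the comparison
  isomorphism. This carries facts about a concretely built adjoint to the arbitrary one inside a
  geometric morphism.\<close>

lemma counit_iso_transfer:
  assumes adj: "adjunction A B F G \<eta> \<epsilon>" and adj': "adjunction A B F G' \<eta>' \<epsilon>'"
    and iso: "\<And>Y. Y \<in> Ob B \<Longrightarrow> iso_arrow B (fob F (fob G Y)) Y (\<epsilon> Y)" and Y: "Y \<in> Ob B"
  shows "iso_arrow B (fob F (fob G' Y)) Y (\<epsilon>' Y)"
proof -
  interpret F: cat_functor A B F using adj by (rule adjunctionD)
  interpret G: cat_functor B A G using adj by (rule adjunctionD)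
  interpret G': cat_functor B A G' using adj' by (rule adjunctionD)
  obtain \<theta> where t: "nat_iso B A G' G \<theta>" and te: "\<And>Y. Y \<in> Ob B \<Longrightarrow>
    Cmp B (fob F (fob G' Y)) (fob F (fob G Y)) Y (\<epsilon> Y) (far F (fob G' Y) (fob G Y) (\<theta> Y)) = \<epsilon>' Y"
    using right_adjoint_unique[OF adj' adj] by blast
  have "iso_arrow A (fob G' Y) (fob G Y) (\<theta> Y)" using t Y by (simp add: nat_iso_def)
  then have "iso_arrow B (fob F (fob G' Y)) (fob F (fob G Y)) (far F (fob G' Y) (fob G Y) (\<theta> Y))"
    using Y by (simp add: F.far_iso G.functor_simps G'.functor_simps)
  then show ?thesis using iso Y te[OF Y, symmetric]
    by (simp add: F.B.iso_arrow_cmp F.functor_simps G.functor_simps G'.functor_simps)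
qed

text \<open>Up to transposition, the action of \<open>G\<close> on arrows out of \<open>Y\<close> is
  precomposition with \<open>\<epsilon> Y\<close>. The witness \<open>?k\<close> transposes and then
  undoes this precomposition.\<close>

lemma full_and_faithful_of_counit_iso:
  assumes adj: "adjunction A B F G \<eta> \<epsilon>"
    and iso: "\<And>Y. Y \<in> Ob B \<Longrightarrow> iso_arrow B (fob F (fob G Y)) Y (\<epsilon> Y)"
  shows "full_and_faithful B A G"
  unfolding full_and_faithful_def
proof (intro ballI)
  interpret F: cat_functor A B F using adj by (rule adjunctionD)
  interpret G: cat_functor B A G using adj by (rule adjunctionD)
  note D = adjunctionD(5-10)[OF adj]
  note s = F.functor_simps G.functor_simps D(1,2) F.A.cat_assoc F.B.cat_assoc
  fix Y Z assume Y: "Y \<in> Ob B" and Z: "Z \<in> Ob B"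
  obtain e where e: "e \<in> Ar B Y (fob F (fob G Y))"
    "Cmp B (fob F (fob G Y)) Y (fob F (fob G Y)) e (\<epsilon> Y) = Ident B (fob F (fob G Y))"
    "Cmp B Y (fob F (fob G Y)) Y (\<epsilon> Y) e = Ident B Y"
    using iso[OF Y] by (auto simp: iso_arrow_def is_inverse_def)
  let ?FG = "fob F (fob G Y)"
  let ?k = "\<lambda>g. Cmp B Y ?FG Z (Cmp B ?FG (fob F (fob G Z)) Z (\<epsilon> Z) (far F (fob G Y) (fob G Z) g)) e"
  show "bij_betw (far G Y Z) (Ar B Y Z) (Ar A (fob G Y) (fob G Z))"
  proof (rule bij_betw_byWitness[where f' = ?k])
    show "\<forall>f\<in>Ar B Y Z. ?k (far G Y Z f) = f"
      using Y Z e by (simp add: D(4) s)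
    show "\<forall>g\<in>Ar A (fob G Y) (fob G Z). far G Y Z (?k g) = g"
    proof
      fix g assume g: "g \<in> Ar A (fob G Y) (fob G Z)"
      show "far G Y Z (?k g) = g"
      proof (rule couniversal_cancel[OF adjunction_couniversal[OF adj Z] F.cat_functor_axioms])
        show "Cmp B ?FG (fob F (fob G Z)) Z (\<epsilon> Z) (far F (fob G Y) (fob G Z) (far G Y Z (?k g)))
            = Cmp B ?FG (fob F (fob G Z)) Z (\<epsilon> Z) (far F (fob G Y) (fob G Z) g)"
          using Y Z e g by (subst D(4)) (simp_all add: s)
      qed (use Y Z e g in \<open>simp_all add: s\<close>)
    qed
  qed (use Y Z e in \<open>auto simp: s\<close>)
qed

text \<open>The direct image of an arbitrary \<open>p\<close> is merely isomorphic to evaluation, so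
  adjunctions proved for evaluation have to be moved to it. The new counit is spelled out in order
  that its invertibility can be read off from that of \<open>\<epsilon>\<close> and
  \<open>\<theta>\<close>.\<close>

lemma left_adjoint_transfer:
  assumes adj: "adjunction A B F G \<eta> \<epsilon>" and F': "cat_functor A B F'" and t: "nat_iso A B F' F \<theta>"
  defines "\<epsilon>' \<equiv> \<lambda>Y. Cmp B (fob F' (fob G Y)) (fob F (fob G Y)) Y (\<epsilon> Y) (\<theta> (fob G Y))"
  shows "\<exists>\<eta>'. adjunction A B F' G \<eta>' \<epsilon>'"
proof (rule adjunction_of_counit)
  interpret F: cat_functor A B F using adj by (rule adjunctionD)
  interpret G: cat_functor B A G using adj by (rule adjunctionD)
  interpret F': cat_functor A B F' by fact
  note D = adjunctionD(5-10)[OF adj]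
  have tn: "nat_trans A B F' F \<theta>" using t by (simp add: nat_iso_def)
  have iso: "X \<in> Ob A \<Longrightarrow> iso_arrow B (fob F' X) (fob F X) (\<theta> X)" for X using t by (simp add: nat_iso_def)
  note s = F.functor_simps G.functor_simps F'.functor_simps D(1,2) F.A.cat_assoc F.B.cat_assoc
    nat_transD(1)[OF tn]
  show "cat_functor B A G" "cat_functor A B F'" by unfold_locales
  have "Cmp B (fob F' (fob G Y)) (fob F' (fob G Z)) Z (\<epsilon>' Z) (far F' (fob G Y) (fob G Z) (far G Y Z f))
     = Cmp B (fob F' (fob G Y)) Y Z f (\<epsilon>' Y)" if Y: "Y \<in> Ob B" "Z \<in> Ob B" "f \<in> Ar B Y Z" for Y Z f
  proof -
    let ?Y = "fob G Y" and ?Z = "fob G Z"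
    have "Cmp B (fob F' ?Y) (fob F' ?Z) Z (\<epsilon>' Z) (far F' ?Y ?Z (far G Y Z f))
      = Cmp B (fob F' ?Y) (fob F ?Z) Z (\<epsilon> Z) (Cmp B (fob F' ?Y) (fob F' ?Z)
         (fob F ?Z) (\<theta> ?Z) (far F' ?Y ?Z (far G Y Z f)))"
      using Y by (simp add: \<epsilon>'_def s)
    also have "\<dots> = Cmp B (fob F' ?Y) (fob F ?Y) Z (Cmp B (fob F ?Y) (fob F ?Z) Z
       (\<epsilon> Z) (far F ?Y ?Z (far G Y Z f))) (\<theta> ?Y)"
      using Y by (simp add: nat_transD(2)[OF tn] s)
    finally show ?thesis using Y by (simp add: D(4)) (simp add: \<epsilon>'_def s)
  qed
  then show "nat_trans B B (F' \<circ>\<^sub>F G) id_functor \<epsilon>'"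
    by (simp add: nat_trans_def s \<epsilon>'_def)
  fix Y assume Y: "Y \<in> Ob B"
  note u = adjunction_couniversal[OF adj Y]
  have "\<exists>!g. g \<in> Ar A X (fob G Y) \<and> Cmp B (fob F' X) (fob F' (fob G Y)) Y (\<epsilon>' Y) (far F' X (fob G Y) g) = f"
    if X: "X \<in> Ob A" and f: "f \<in> Ar B (fob F' X) Y" for X f
  proof -
    obtain i where i: "i \<in> Ar B (fob F X) (fob F' X)"
      "Cmp B (fob F' X) (fob F X) (fob F' X) i (\<theta> X) = Ident B (fob F' X)"
      "Cmp B (fob F X) (fob F' X) (fob F X) (\<theta> X) i = Ident B (fob F X)"
      using iso[OF X] by (auto simp: iso_arrow_def is_inverse_def)
    \<comment> \<open>Naturality of \<open>\<theta>\<close> moves it to the right end, so a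
      factorization problem for \<open>F'\<close> becomes the one for \<open>F\<close> precomposed
      with the invertible arrow \<open>\<theta> X\<close>.\<close>
    have eq: "Cmp B (fob F' X) (fob F' (fob G Y)) Y (\<epsilon>' Y) (far F' X (fob G Y) g)
      = Cmp B (fob F' X) (fob F X) Y (Cmp B (fob F X) (fob F (fob G Y)) Y (\<epsilon> Y) (far F X (fob G Y) g)) (\<theta> X)"
      if g: "g \<in> Ar A X (fob G Y)" for g
      using X Y g nat_transD(2)[OF tn X _ g] by (simp add: \<epsilon>'_def s)
    have fi: "Cmp B (fob F X) (fob F' X) Y f i \<in> Ar B (fob F X) Y" using X Y f i by (simp add: s)
    have iff: "Cmp B (fob F' X) (fob F X) Y h (\<theta> X) = f \<longleftrightarrow> h = Cmp B (fob F X) (fob F' X) Y f i"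
      if "h \<in> Ar B (fob F X) Y" for h
      using X Y f i that by (auto simp: s)
    have "\<exists>!g. g \<in> Ar A X (fob G Y) \<and> Cmp B (fob F X) (fob F (fob G Y)) Y (\<epsilon> Y) (far F X (fob G Y) g)
        = Cmp B (fob F X) (fob F' X) Y f i"
      using u X fi unfolding couniversal_def by blast
    moreover have "(g \<in> Ar A X (fob G Y) \<and> Cmp B (fob F' X) (fob F' (fob G Y)) Y (\<epsilon>' Y) (far F' X (fob G Y) g) = f)
      \<longleftrightarrow> (g \<in> Ar A X (fob G Y) \<and> Cmp B (fob F X) (fob F (fob G Y)) Y (\<epsilon> Y) (far F X (fob G Y) g)
        = Cmp B (fob F X) (fob F' X) Y f i)" for g
    proof (cases "g \<in> Ar A X (fob G Y)")
      case True
      then have "Cmp B (fob F X) (fob F (fob G Y)) Y (\<epsilon> Y) (far F X (fob G Y) g) \<in> Ar B (fob F X) Y"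
        using X Y by (simp add: s)
      then show ?thesis using eq[OF True] iff by simp
    qed simp
    ultimately show ?thesis by simp
  qed
  then show "couniversal A B F' Y (fob G Y) (\<epsilon>' Y)"
    using Y by (simp add: couniversal_def s \<epsilon>'_def)
qed

lemma full_and_faithful_comp:
  assumes "cat_functor A B F" "full_and_faithful A B F" "full_and_faithful B C G"
  shows "full_and_faithful A C (G \<circ>\<^sub>F F)"
  unfolding full_and_faithful_def
proof (intro ballI)
  interpret F: cat_functor A B F by fact
  fix X Y assume "X \<in> Ob A" "Y \<in> Ob A"
  then have "bij_betw (far F X Y) (Ar A X Y) (Ar B (fob F X) (fob F Y))"
    "bij_betw (far G (fob F X) (fob F Y)) (Ar B (fob F X) (fob F Y))
       (Ar C (fob G (fob F X)) (fob G (fob F Y)))"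
    using assms by (simp_all add: full_and_faithful_def F.fob_in)
  then show "bij_betw (far (G \<circ>\<^sub>F F) X Y) (Ar A X Y) (Ar C (fob (G \<circ>\<^sub>F F) X) (fob (G \<circ>\<^sub>F F) Y))"
    using bij_betw_trans by (fastforce simp: comp_functor_def comp_def)
qed

text \<open>The unit and counit are literally those of \<open>comp_geom\<close>, so this gives the
  adjunction part of a composite geometric morphism without further comparison.\<close>

lemma adjunction_comp:
  assumes adj: "adjunction A B F G \<eta> \<epsilon>" and adj': "adjunction B C F' G' \<eta>' \<epsilon>'"
  shows "adjunction A C (F' \<circ>\<^sub>F F) (G \<circ>\<^sub>F G')
    (\<lambda>X. Cmp A X (fob G (fob F X)) (fob G (fob G' (fob F' (fob F X))))
       (far G (fob F X) (fob G' (fob F' (fob F X))) (\<eta>' (fob F X))) (\<eta> X))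
    (\<lambda>Z. Cmp C (fob F' (fob F (fob G (fob G' Z)))) (fob F' (fob G' Z)) Z
       (\<epsilon>' Z) (far F' (fob F (fob G (fob G' Z))) (fob G' Z) (\<epsilon> (fob G' Z))))"
proof (rule adjunction_of_unit)
  interpret F: cat_functor A B F using adj by (rule adjunctionD)
  interpret G: cat_functor B A G using adj by (rule adjunctionD)
  interpret F': cat_functor B C F' using adj' by (rule adjunctionD)
  interpret G': cat_functor C B G' using adj' by (rule adjunctionD)
  note D = adjunctionD(5-10)[OF adj] and D' = adjunctionD(5-10)[OF adj']
  note s = F.functor_simps G.functor_simps F'.functor_simps G'.functor_simps D(1,2) D'(1,2)
    F.A.cat_assoc F.B.cat_assoc F'.B.cat_assoc
  note u = adjunction_couniversal[OF adj] and u' = adjunction_couniversal[OF adj']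
  show "cat_functor A C (F' \<circ>\<^sub>F F)" "cat_functor C A (G \<circ>\<^sub>F G')"
    by (rule cat_functor_comp; unfold_locales)+
  define e where "e Z = Cmp C (fob F' (fob F (fob G (fob G' Z)))) (fob F' (fob G' Z)) Z
       (\<epsilon>' Z) (far F' (fob F (fob G (fob G' Z))) (fob G' Z) (\<epsilon> (fob G' Z)))" for Z
  define h where "h X = Cmp A X (fob G (fob F X)) (fob G (fob G' (fob F' (fob F X))))
       (far G (fob F X) (fob G' (fob F' (fob F X))) (\<eta>' (fob F X))) (\<eta> X)" for X
  let ?F = "\<lambda>X. fob F' (fob F X)" and ?G = "\<lambda>X. fob G (fob G' X)"
  have h: "X \<in> Ob A \<Longrightarrow> h X \<in> Ar A X (?G (?F X))" for X by (simp add: h_def s)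
  have e: "Z \<in> Ob C \<Longrightarrow> e Z \<in> Ar C (?F (?G Z)) Z" for Z by (simp add: e_def s)
  \<comment> \<open>Transposing along the composite counit is transposing along
    \<open>\<epsilon>\<close> and then along \<open>\<epsilon>'\<close>. Existence and uniqueness of
    factorizations then follow by treating the two stages one after the other.\<close>
  have flat: "Cmp C (?F X) (?F (?G Z)) Z (e Z) (far F' (fob F X) (fob F (?G Z)) (far F X (?G Z) g))
    = Cmp C (?F X) (fob F' (fob G' Z)) Z (\<epsilon>' Z) (far F' (fob F X) (fob G' Z)
       (Cmp B (fob F X) (fob F (?G Z)) (fob G' Z) (\<epsilon> (fob G' Z)) (far F X (?G Z) g)))"
    if "X \<in> Ob A" "Z \<in> Ob C" "g \<in> Ar A X (?G Z)" for X Z g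
    using that by (simp add: s e_def)
  have "Cmp C (?F (?G Y)) (?F (?G Z)) Z (e Z) (far F' (fob F (?G Y)) (fob F (?G Z))
          (far F (?G Y) (?G Z) (far G (fob G' Y) (fob G' Z) (far G' Y Z f))))
        = Cmp C (?F (?G Y)) Y Z f (e Y)" if Y: "Y \<in> Ob C" "Z \<in> Ob C" "f \<in> Ar C Y Z" for Y Z f
  proof -
    have "Cmp C (?F (?G Y)) (?F (?G Z)) Z (e Z) (far F' (fob F (?G Y)) (fob F (?G Z))
          (far F (?G Y) (?G Z) (far G (fob G' Y) (fob G' Z) (far G' Y Z f))))
      = Cmp C (?F (?G Y)) (fob F' (fob G' Z)) Z (\<epsilon>' Z) (far F' (fob F (?G Y)) (fob G' Z)
          (Cmp B (fob F (?G Y)) (fob G' Y) (fob G' Z) (far G' Y Z f) (\<epsilon> (fob G' Y))))"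
      using Y by (subst flat) (simp_all add: s D(4))
    also have "\<dots> = Cmp C (?F (?G Y)) (fob F' (fob G' Y)) Z (Cmp C (fob F' (fob G' Y)) (fob F' (fob G' Z)) Z
          (\<epsilon>' Z) (far F' (fob G' Y) (fob G' Z) (far G' Y Z f)))
          (far F' (fob F (?G Y)) (fob G' Y) (\<epsilon> (fob G' Y)))"
      using Y by (simp add: s)
    also have "\<dots> = Cmp C (?F (?G Y)) Y Z f (e Y)" using Y by (subst D'(4)) (simp_all add: s e_def)
    finally show ?thesis .
  qed
  then show "nat_trans C C (F' \<circ>\<^sub>F F \<circ>\<^sub>F (G \<circ>\<^sub>F G')) id_functor e"
    by (simp add: nat_trans_def e)
  fix Z assume Z: "Z \<in> Ob C"
  have "\<exists>!g. g \<in> Ar A X (?G Z) \<and>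
     Cmp C (?F X) (?F (?G Z)) Z (e Z) (far F' (fob F X) (fob F (?G Z)) (far F X (?G Z) g)) = f"
    if X: "X \<in> Ob A" and f: "f \<in> Ar C (?F X) Z" for X f
  proof -
    obtain k where k: "k \<in> Ar B (fob F X) (fob G' Z)"
      and kf: "Cmp C (?F X) (fob F' (fob G' Z)) Z (\<epsilon>' Z) (far F' (fob F X) (fob G' Z) k) = f"
      using couniversalD(4)[OF u'[OF Z], of "fob F X" f] X f by (auto simp: s)
    obtain g where g: "g \<in> Ar A X (?G Z)"
      and gk: "Cmp B (fob F X) (fob F (?G Z)) (fob G' Z) (\<epsilon> (fob G' Z)) (far F X (?G Z) g) = k"
      using couniversalD(4)[OF u, of "fob G' Z" X k] X k Z by (auto simp: s)
    show ?thesis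
    proof (rule ex1I)
      show "g \<in> Ar A X (?G Z) \<and>
        Cmp C (?F X) (?F (?G Z)) Z (e Z) (far F' (fob F X) (fob F (?G Z)) (far F X (?G Z) g)) = f"
        using flat X Z g gk kf by simp
      fix g' assume g': "g' \<in> Ar A X (?G Z) \<and>
        Cmp C (?F X) (?F (?G Z)) Z (e Z) (far F' (fob F X) (fob F (?G Z)) (far F X (?G Z) g')) = f"
      have "Cmp B (fob F X) (fob F (?G Z)) (fob G' Z) (\<epsilon> (fob G' Z)) (far F X (?G Z) g') = k"
      proof (rule couniversal_cancel[OF u'[OF Z] F'.cat_functor_axioms, of "fob F X"])
        show "Cmp C (?F X) (fob F' (fob G' Z)) Z (\<epsilon>' Z) (far F' (fob F X) (fob G' Z)
            (Cmp B (fob F X) (fob F (?G Z)) (fob G' Z) (\<epsilon> (fob G' Z)) (far F X (?G Z) g')))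
          = Cmp C (?F X) (fob F' (fob G' Z)) Z (\<epsilon>' Z) (far F' (fob F X) (fob G' Z) k)"
          using flat[OF X Z, of g'] g' kf by simp
      qed (use g' X Z k in \<open>simp_all add: s\<close>)
      then show "g' = g"
        by (intro couniversal_cancel[OF u[of "fob G' Z"] F.cat_functor_axioms, of X])
          (use X Z g g' gk in \<open>simp_all add: s\<close>)
    qed
  qed
  then show "couniversal A C (F' \<circ>\<^sub>F F) Z (fob (G \<circ>\<^sub>F G') Z) (e Z)"
    using Z by (simp add: couniversal_def s e)
next
  interpret F: cat_functor A B F using adj by (rule adjunctionD)
  interpret G: cat_functor B A G using adj by (rule adjunctionD)
  interpret F': cat_functor B C F' using adj' by (rule adjunctionD)
  interpret G': cat_functor C B G' using adj' by (rule adjunctionD)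
  note D = adjunctionD(5-10)[OF adj] and D' = adjunctionD(5-10)[OF adj']
  note s = F.functor_simps G.functor_simps F'.functor_simps G'.functor_simps D(1,2) D'(1,2)
    F.A.cat_assoc F.B.cat_assoc F'.B.cat_assoc
  fix X assume X: "X \<in> Ob A"
  let ?FX = "fob F X" let ?M = "fob G' (fob F' ?FX)" let ?N = "fob G ?M"
  let ?h = "Cmp A X (fob G ?FX) ?N (far G ?FX ?M (\<eta>' ?FX)) (\<eta> X)"
  show "?h \<in> Ar A X (fob (G \<circ>\<^sub>F G') (fob (F' \<circ>\<^sub>F F) X))" using X by (simp add: s)
  have "Cmp B ?FX (fob F ?N) ?M (\<epsilon> ?M) (far F X ?N ?h)
    = Cmp B ?FX (fob F (fob G ?FX)) ?M (Cmp B (fob F (fob G ?FX)) (fob F ?N) ?M (\<epsilon> ?M)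
        (far F (fob G ?FX) ?N (far G ?FX ?M (\<eta>' ?FX)))) (far F X (fob G ?FX) (\<eta> X))"
    using X by (simp add: s)
  also have "\<dots> = Cmp B ?FX ?FX ?M (\<eta>' ?FX)
      (Cmp B ?FX (fob F (fob G ?FX)) ?FX (\<epsilon> ?FX) (far F X (fob G ?FX) (\<eta> X)))"
    using X by (subst D(4)) (simp_all add: s)
  also have "\<dots> = \<eta>' ?FX" using X by (simp add: D(5)) (simp add: s)
  \<comment> \<open>The inner transpose of the composite unit is \<open>\<eta>'\<close>, so the
    remaining triangle identity is the one for the outer adjunction.\<close>
  finally have *: "Cmp B ?FX (fob F ?N) ?M (\<epsilon> ?M) (far F X ?N ?h) = \<eta>' ?FX" .
  have "Cmp C (fob F' ?FX) (fob F' (fob F ?N)) (fob F' ?FX)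
      (Cmp C (fob F' (fob F ?N)) (fob F' ?M) (fob F' ?FX) (\<epsilon>' (fob F' ?FX))
         (far F' (fob F ?N) ?M (\<epsilon> ?M))) (far F' ?FX (fob F ?N) (far F X ?N ?h))
     = Cmp C (fob F' ?FX) (fob F' ?M) (fob F' ?FX) (\<epsilon>' (fob F' ?FX)) (far F' ?FX ?M
         (Cmp B ?FX (fob F ?N) ?M (\<epsilon> ?M) (far F X ?N ?h)))"
    using X by (simp add: s)
  also have "\<dots> = Ident C (fob F' ?FX)" unfolding * using X by (simp add: D'(5) s)
  finally show "Cmp C (fob (F' \<circ>\<^sub>F F) X)
      (fob (F' \<circ>\<^sub>F F) (fob (G \<circ>\<^sub>F G') (fob (F' \<circ>\<^sub>F F) X))) (fob (F' \<circ>\<^sub>F F) X)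
      (Cmp C (fob F' (fob F (fob G (fob G' (fob (F' \<circ>\<^sub>F F) X)))))
         (fob F' (fob G' (fob (F' \<circ>\<^sub>F F) X))) (fob (F' \<circ>\<^sub>F F) X) (\<epsilon>' (fob (F' \<circ>\<^sub>F F) X))
         (far F' (fob F (fob G (fob G' (fob (F' \<circ>\<^sub>F F) X)))) (fob G' (fob (F' \<circ>\<^sub>F F) X))
            (\<epsilon> (fob G' (fob (F' \<circ>\<^sub>F F) X)))))
      (far (F' \<circ>\<^sub>F F) X (fob (G \<circ>\<^sub>F G') (fob (F' \<circ>\<^sub>F F) X)) ?h)
    = Ident C (fob (F' \<circ>\<^sub>F F) X)"
    by simp
qed

section \<open>Duality: left adjoints obtained as right adjoints between opposite categories\<close>

definition opposite_functor :: "('o, 'a, 'p, 'b) fctr \<Rightarrow> ('o, 'a, 'p, 'b) fctr" where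
  "opposite_functor F = \<lparr>fob = fob F, far = (\<lambda>X Y. far F Y X)\<rparr>"

lemma opposite_functor_sel [simp]: "fob (opposite_functor F) = fob F"
  "far (opposite_functor F) X Y = far F Y X"
  by (simp_all add: opposite_functor_def)

lemma cat_functor_opposite:
  assumes "cat_functor A B F"
  shows "cat_functor (opposite A) (opposite B) (opposite_functor F)"
proof -
  interpret cat_functor A B F by fact
  interpret A': category "opposite A" by (intro category_opposite) unfold_locales
  interpret B': category "opposite B" by (intro category_opposite) unfold_locales
  show ?thesis by unfold_locales (simp_all add: functor_simps)
qed

lemma nat_trans_opposite:
  "nat_trans A B F G t \<Longrightarrow>
     nat_trans (opposite A) (opposite B) (opposite_functor G) (opposite_functor F) t"
  by (simp add: nat_trans_def)

lemma opposite_functor_comp: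
  "opposite_functor F \<circ>\<^sub>F opposite_functor G = opposite_functor (F \<circ>\<^sub>F G)"
  by (rule fctr_eqI) simp_all

lemma opposite_functor_id: "opposite_functor id_functor = id_functor"
  by (rule fctr_eqI) simp_all

lemma adjunction_opposite:
  assumes "adjunction A B F G \<eta> \<epsilon>"
  shows "adjunction (opposite B) (opposite A) (opposite_functor G) (opposite_functor F) \<epsilon> \<eta>"
proof -
  note D = adjunctionD[OF assms]
  show ?thesis unfolding adjunction_def
    using D(9,10) nat_trans_opposite[OF D(3)] nat_trans_opposite[OF D(4)]
      cat_functor_opposite[OF D(1)] cat_functor_opposite[OF D(2)]
    by (simp add: opposite_functor_comp opposite_functor_id)
qed

lemma left_adjoint_exists:
  assumes G: "cat_functor B A G"
    and univ: "\<And>X. X \<in> Ob A \<Longrightarrow> \<exists>L e. couniversal (opposite B) (opposite A) (opposite_functor G) X L e"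
  shows "\<exists>F \<eta> \<epsilon>. adjunction A B F G \<eta> \<epsilon>"
proof -
  obtain L \<eta> where "\<And>X. X \<in> Ob A \<Longrightarrow> couniversal (opposite B) (opposite A) (opposite_functor G) X (L X) (\<eta> X)"
    using univ by metis
  then obtain H \<epsilon> where "adjunction (opposite B) (opposite A) (opposite_functor G) H \<epsilon> \<eta>"
    using right_adjoint_exists[OF cat_functor_opposite[OF G], of L \<eta>] by auto
  from adjunction_opposite[OF this]
  have "adjunction A B (opposite_functor H) (opposite_functor (opposite_functor G)) \<eta> \<epsilon>" by simp
  moreover have "opposite_functor (opposite_functor G) = G" by (rule fctr_eqI) simp_all
  ultimately show ?thesis by auto
qed

text \<open>Cones under \<open>G\<close> transpose to cones over the original diagram. Through this
  lemma the left adjoint of restriction serves twice: it makes the subtopos essential, and it shows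
  that restriction is left exact, hence an inverse image.\<close>

lemma right_adjoint_left_exact:
  assumes adj: "adjunction A B F G \<eta> \<epsilon>"
  shows "left_exact B A G"
  unfolding left_exact_def
proof (intro allI impI, elim conjE)
  interpret F: cat_functor A B F using adj by (rule adjunctionD)
  interpret G: cat_functor B A G using adj by (rule adjunctionD)
  note D = adjunctionD(5-10)[OF adj]
  note u = adjunction_couniversal[OF adj]
  fix J :: "(nat, nat) cat" and E L \<pi>
  assume "cat_functor J B E" and lim: "limit_cone J B E L \<pi>"
  interpret E: cat_functor J B E by fact
  note s = F.functor_simps G.functor_simps E.functor_simps D(1,2) F.A.cat_assoc F.B.cat_assoc
  have c: "cone J B E L \<pi>" using lim by (simp add: limit_cone_def)
  have L: "L \<in> Ob B" and pi: "\<And>i. i \<in> Ob J \<Longrightarrow> \<pi> i \<in> Ar B L (fob E i)"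
    and pi_nat: "\<And>i j w. \<lbrakk>i \<in> Ob J; j \<in> Ob J; w \<in> Ar J i j\<rbrakk>
      \<Longrightarrow> Cmp B L (fob E i) (fob E j) (far E i j w) (\<pi> i) = \<pi> j"
    using c by (auto simp: cone_def)
  note s = s L pi
  have "cone J A (G \<circ>\<^sub>F E) (fob G L) (\<lambda>i. far G L (fob E i) (\<pi> i))"
    by (simp add: cone_def s pi_nat flip: G.far_cmp)
  moreover have "\<exists>!h. h \<in> Ar A M (fob G L) \<and> (\<forall>i\<in>Ob J.
      Cmp A M (fob G L) (fob G (fob E i)) (far G L (fob E i) (\<pi> i)) h = \<rho> i)"
    if "cone J A (G \<circ>\<^sub>F E) M \<rho>" for M \<rho>
  proof -
    have M: "M \<in> Ob A" and rho: "\<And>i. i \<in> Ob J \<Longrightarrow> \<rho> i \<in> Ar A M (fob G (fob E i))"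
      and rho_nat: "\<And>i j w. \<lbrakk>i \<in> Ob J; j \<in> Ob J; w \<in> Ar J i j\<rbrakk>
      \<Longrightarrow> Cmp A M (fob G (fob E i)) (fob G (fob E j)) (far G (fob E i) (fob E j) (far E i j w)) (\<rho> i) = \<rho> j"
      using that by (auto simp: cone_def)
    \<comment> \<open>\<open>?b Y\<close> is transposition from arrows into \<open>fob G Y\<close>
      to arrows into \<open>Y\<close>: natural in \<open>Y\<close> by \<open>b_nat\<close> and
      injective by \<open>b_inj\<close>.\<close>
    let ?b = "\<lambda>Y g. Cmp B (fob F M) (fob F (fob G Y)) Y (\<epsilon> Y) (far F M (fob G Y) g)"
    have b_nat: "?b Y' (Cmp A M (fob G Y) (fob G Y') (far G Y Y' f) g) = Cmp B (fob F M) Y Y' f (?b Y g)"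
      if "Y \<in> Ob B" "Y' \<in> Ob B" "f \<in> Ar B Y Y'" "g \<in> Ar A M (fob G Y)" for Y Y' f g
    proof -
      have "?b Y' (Cmp A M (fob G Y) (fob G Y') (far G Y Y' f) g)
        = Cmp B (fob F M) (fob F (fob G Y)) Y' (Cmp B (fob F (fob G Y)) (fob F (fob G Y')) Y' (\<epsilon> Y')
           (far F (fob G Y) (fob G Y') (far G Y Y' f))) (far F M (fob G Y) g)"
        using that M by (simp add: s)
      also have "\<dots> = Cmp B (fob F M) Y Y' f (?b Y g)"
        using that M by (subst D(4)) (simp_all add: s)
      finally show ?thesis .
    qed
    have b_in: "?b Y g \<in> Ar B (fob F M) Y" if "Y \<in> Ob B" "g \<in> Ar A M (fob G Y)" for Y g
      using that M by (simp add: s)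
    have b_inj: "g = g'" if "Y \<in> Ob B" "g \<in> Ar A M (fob G Y)" "g' \<in> Ar A M (fob G Y)" "?b Y g = ?b Y g'" for Y g g'
      by (rule couniversal_cancel[OF u F.cat_functor_axioms, of Y M]) (use that M in auto)
    have "cone J B E (fob F M) (\<lambda>i. ?b (fob E i) (\<rho> i))"
      by (simp add: cone_def M F.fob_in b_in E.fob_in E.far_in rho rho_nat flip: b_nat)
    then have ex1: "\<exists>!h. h \<in> Ar B (fob F M) L \<and> (\<forall>i\<in>Ob J. Cmp B (fob F M) L (fob E i) (\<pi> i) h = ?b (fob E i) (\<rho> i))"
      using lim unfolding limit_cone_def by blast
    then obtain h where h: "h \<in> Ar B (fob F M) L"
      "\<forall>i\<in>Ob J. Cmp B (fob F M) L (fob E i) (\<pi> i) h = ?b (fob E i) (\<rho> i)" by blast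
    obtain g where g: "g \<in> Ar A M (fob G L)" "?b L g = h"
      using couniversalD(4)[OF u[OF L] M h(1)] by blast
    \<comment> \<open>Because transposition is natural and injective, a mediating arrow into
      \<open>fob G L\<close> corresponds to a mediating arrow into \<open>L\<close>.\<close>
    have iff: "Cmp A M (fob G L) (fob G (fob E i)) (far G L (fob E i) (\<pi> i)) k = \<rho> i
      \<longleftrightarrow> Cmp B (fob F M) L (fob E i) (\<pi> i) (?b L k) = ?b (fob E i) (\<rho> i)"
      if "i \<in> Ob J" "k \<in> Ar A M (fob G L)" for i k
    proof -
      have m: "Cmp A M (fob G L) (fob G (fob E i)) (far G L (fob E i) (\<pi> i)) k \<in> Ar A M (fob G (fob E i))"
        using that M by (simp add: s)
      have "Cmp A M (fob G L) (fob G (fob E i)) (far G L (fob E i) (\<pi> i)) k = \<rho> i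
        \<longleftrightarrow> ?b (fob E i) (Cmp A M (fob G L) (fob G (fob E i)) (far G L (fob E i) (\<pi> i)) k) = ?b (fob E i) (\<rho> i)"
        using b_inj[OF E.fob_in[OF that(1)] m rho[OF that(1)]] by auto
      then show ?thesis using b_nat[OF L E.fob_in[OF that(1)] pi[OF that(1)] that(2)] by simp
    qed
    show ?thesis
    proof (rule ex1I)
      show "g \<in> Ar A M (fob G L) \<and> (\<forall>i\<in>Ob J.
        Cmp A M (fob G L) (fob G (fob E i)) (far G L (fob E i) (\<pi> i)) g = \<rho> i)"
        using g h iff by simp
      fix g' assume g': "g' \<in> Ar A M (fob G L) \<and> (\<forall>i\<in>Ob J.
        Cmp A M (fob G L) (fob G (fob E i)) (far G L (fob E i) (\<pi> i)) g' = \<rho> i)"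
      then have "?b L g' \<in> Ar B (fob F M) L \<and>
          (\<forall>i\<in>Ob J. Cmp B (fob F M) L (fob E i) (\<pi> i) (?b L g') = ?b (fob E i) (\<rho> i))"
        using iff b_in L by blast
      then have "?b L g' = h" using ex1 h by blast
      then show "g' = g" using b_inj L g g' by blast
    qed
  qed
  ultimately show "limit_cone J A (G \<circ>\<^sub>F E) (fob G L) (\<lambda>i. far G L (fob E i) (\<pi> i))"
    by (simp add: limit_cone_def)
qed

section \<open>Composite geometric morphisms and the canonical transformation\<close>

lemma left_exact_comp:
  assumes F: "cat_functor A B F" and "left_exact A B F" "left_exact B C G"
  shows "left_exact A C (G \<circ>\<^sub>F F)"
  unfolding left_exact_def
proof (intro allI impI, elim conjE)
  fix J :: "(nat, nat) cat" and D L \<pi>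
  assume J: "finite_category J" and D: "cat_functor J A D" and lim: "limit_cone J A D L \<pi>"
  have "limit_cone J B (F \<circ>\<^sub>F D) (fob F L) (\<lambda>i. far F L (fob D i) (\<pi> i))"
    using assms(2) J D lim by (auto simp: left_exact_def)
  then have "limit_cone J C (G \<circ>\<^sub>F (F \<circ>\<^sub>F D)) (fob G (fob F L))
      (\<lambda>i. far G (fob F L) (fob (F \<circ>\<^sub>F D) i) (far F L (fob D i) (\<pi> i)))"
    using assms(3) J cat_functor_comp[OF D F] unfolding left_exact_def by blast
  moreover have "G \<circ>\<^sub>F (F \<circ>\<^sub>F D) = G \<circ>\<^sub>F F \<circ>\<^sub>F D" by (rule fctr_eqI) simp_all
  ultimately show "limit_cone J C (G \<circ>\<^sub>F F \<circ>\<^sub>F D) (fob (G \<circ>\<^sub>F F) L)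
      (\<lambda>i. far (G \<circ>\<^sub>F F) L (fob D i) (\<pi> i))" by simp
qed

lemma geometric_morphism_comp:
  assumes j: "geometric_morphism D E j" and p: "geometric_morphism E S p"
  shows "geometric_morphism D S (comp_geom D S p j)"
proof -
  note adj = j[unfolded geometric_morphism_def, THEN conjunct1]
    p[unfolded geometric_morphism_def, THEN conjunct1]
  have "left_exact S D (inv_img j \<circ>\<^sub>F inv_img p)"
    using j p adjunctionD(1)[OF adj(2)] by (auto simp: geometric_morphism_def intro: left_exact_comp)
  then show ?thesis using adjunction_comp[OF adj(2,1)]
    by (simp add: geometric_morphism_def comp_geom_def Let_def)
qed

text \<open>Here \<open>inv_img p\<close> is both left and right adjoint to
  \<open>dir_img p\<close>. Invertibility of the counit \<open>\<epsilon>\<close> makes it full and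
  faithful; then the unit of the first adjunction is invertible, the unit of the second is
  invertible at objects \<open>fob (inv_img p) X\<close>, and the canonical transformation is
  composed of invertible arrows.\<close>

lemma canonical_transf_iso:
  assumes adj: "adjunction S E (inv_img p) (dir_img p) (gm_unit p) (gm_counit p)"
    and adj': "adjunction E S (dir_img p) (inv_img p) \<eta> \<epsilon>"
    and iso: "\<And>X. X \<in> Ob S \<Longrightarrow> iso_arrow S (fob (dir_img p) (fob (inv_img p) X)) X (\<epsilon> X)"
  shows "nat_iso S E (inv_img p) (inv_img p) (canonical_transf E S p (inv_img p) \<eta>)"
proof -
  define F G \<alpha> \<beta> where "F = inv_img p" "G = dir_img p" "\<alpha> = gm_unit p" "\<beta> = gm_counit p"
  note adj = adj[folded this] and adj' = adj'[folded this] and iso = iso[folded this]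
  interpret F: cat_functor S E F using adj by (rule adjunctionD)
  interpret G: cat_functor E S G using adj by (rule adjunctionD)
  note D = adjunctionD(5-10)[OF adj] and D' = adjunctionD(5-10)[OF adj']
  note s = F.functor_simps G.functor_simps D(1,2) D'(1,2) F.A.cat_assoc F.B.cat_assoc
  have ff: "full_and_faithful S E F" by (rule full_and_faithful_of_counit_iso[OF adj' iso])
  have eta_iso: "iso_arrow E (fob F X) (fob F (fob G (fob F X))) (\<eta> (fob F X))" if X: "X \<in> Ob S" for X
  proof -
    have "iso_arrow E (fob F (fob G (fob F X))) (fob F X) (far F (fob G (fob F X)) X (\<epsilon> X))"
      using F.far_iso iso X by (simp add: s)
    \<comment> \<open>By the triangle identity, \<open>\<eta>\<close> at \<open>fob F X\<close> is a
      right inverse of the invertible arrow obtained from \<open>\<epsilon> X\<close>.\<close>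
    then show ?thesis by (rule F.B.iso_arrow_right_inverse[rotated 2]) (use X D'(6) in \<open>simp_all add: s\<close>)
  qed
  have alpha_iso: "iso_arrow S X (fob G (fob F X)) (\<alpha> X)" if X: "X \<in> Ob S" for X
  proof -
    let ?Z = "fob G (fob F X)"
    have "far F ?Z X ` Ar S ?Z X = Ar E (fob F ?Z) (fob F X)" and inj: "inj_on (far F X X) (Ar S X X)"
      using ff X by (auto simp: full_and_faithful_def bij_betw_def s)
    \<comment> \<open>\<open>F\<close> is full, so the counit \<open>\<beta>\<close> at
      \<open>fob F X\<close> comes from an arrow \<open>k\<close>. This is the inverse of
      \<open>\<alpha> X\<close>: one identity uses that \<open>F\<close> is faithful, the other is
      checked on transposes.\<close>
    then obtain k where k: "k \<in> Ar S ?Z X" "far F ?Z X k = \<beta> (fob F X)"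
      using X by (metis (no_types, lifting) D(2) F.fob_in imageE)
    have "far F X X (Cmp S X ?Z X k (\<alpha> X)) = far F X X (Ident S X)"
      using X k D(5) by (simp add: s)
    then have 1: "Cmp S X ?Z X k (\<alpha> X) = Ident S X"
      by (rule inj_onD[OF inj]) (use X k in \<open>simp_all add: s\<close>)
    have "Cmp S ?Z X ?Z (\<alpha> X) k = Ident S ?Z"
    proof (rule couniversal_cancel[OF adjunction_couniversal[OF adj] F.cat_functor_axioms])
      have "Cmp E (fob F ?Z) (fob F ?Z) (fob F X) (\<beta> (fob F X)) (far F ?Z ?Z (Cmp S ?Z X ?Z (\<alpha> X) k))
        = Cmp E (fob F ?Z) (fob F X) (fob F X) (Cmp E (fob F X) (fob F ?Z) (fob F X) (\<beta> (fob F X)) (far F X ?Z (\<alpha> X)))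
            (\<beta> (fob F X))"
        using X k by (simp add: s)
      then show "Cmp E (fob F ?Z) (fob F ?Z) (fob F X) (\<beta> (fob F X)) (far F ?Z ?Z (Cmp S ?Z X ?Z (\<alpha> X) k))
        = Cmp E (fob F ?Z) (fob F ?Z) (fob F X) (\<beta> (fob F X)) (far F ?Z ?Z (Ident S ?Z))"
        using X D(5) by (simp add: s)
    qed (use X k in \<open>simp_all add: s\<close>)
    with 1 show ?thesis using X k by (auto simp: iso_arrow_def is_inverse_def s)
  qed
  define i where "i X = inv_arrow S X (fob G (fob F X)) (\<alpha> X)" for X
  have i: "is_inverse S X (fob G (fob F X)) (\<alpha> X) (i X)" if "X \<in> Ob S" for X
    unfolding i_def using that alpha_iso by (intro F.A.is_inverse_inv_arrow) (simp_all add: s)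
  have i_in: "i X \<in> Ar S (fob G (fob F X)) X" if "X \<in> Ob S" for X
    using i[OF that] by (simp add: is_inverse_def)
  have i_iso: "iso_arrow S (fob G (fob F X)) X (i X)" if "X \<in> Ob S" for X
    unfolding i_def using that alpha_iso by (intro F.A.iso_arrow_inv) (simp_all add: s)
  \<comment> \<open>The components \<open>i X\<close> are inverse to a natural transformation, so
    they are natural too; the square for \<open>\<alpha>\<close> is conjugated by them.\<close>
  have i_nat: "Cmp S (fob G (fob F X)) (fob G (fob F Y)) Y (i Y) (far G (fob F X) (fob F Y) (far F X Y f))
      = Cmp S (fob G (fob F X)) X Y f (i X)" if X: "X \<in> Ob S" "Y \<in> Ob S" "f \<in> Ar S X Y" for X Y f
  proof -
    let ?X = "fob G (fob F X)" and ?Y = "fob G (fob F Y)" and ?f = "far G (fob F X) (fob F Y) (far F X Y f)"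
    have "Cmp S ?X ?Y Y (i Y) ?f = Cmp S ?X ?Y Y (i Y) (Cmp S ?X ?X ?Y ?f (Cmp S ?X X ?X (\<alpha> X) (i X)))"
      using X i[of X] by (simp add: is_inverse_def s)
    also have "\<dots> = Cmp S ?X ?Y Y (i Y) (Cmp S ?X X ?Y (Cmp S X ?X ?Y ?f (\<alpha> X)) (i X))"
      using X by (simp add: s i_in)
    also have "\<dots> = Cmp S ?X X Y (Cmp S X Y Y (Cmp S Y ?Y Y (i Y) (\<alpha> Y)) f) (i X)"
      using X by (subst D(3)[symmetric]) (simp_all add: s i_in)
    also have "\<dots> = Cmp S ?X X Y f (i X)"
      using X i[of Y] by (simp add: is_inverse_def s i_in)
    finally show ?thesis .
  qed
  define c where "c X = Cmp E (fob F X) (fob F (fob G (fob F X))) (fob F X)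
      (far F (fob G (fob F X)) X (i X)) (\<eta> (fob F X))" for X
  have "iso_arrow E (fob F X) (fob F X) (c X)" if X: "X \<in> Ob S" for X
    unfolding c_def using X eta_iso i_iso F.far_iso by (intro F.B.iso_arrow_cmp) (simp_all add: s)
  moreover have "Cmp E (fob F X) (fob F Y) (fob F Y) (c Y) (far F X Y f)
      = Cmp E (fob F X) (fob F X) (fob F Y) (far F X Y f) (c X)"
    if X: "X \<in> Ob S" "Y \<in> Ob S" "f \<in> Ar S X Y" for X Y f
  proof -
    let ?X = "fob G (fob F X)" and ?Y = "fob G (fob F Y)" and ?f = "far G (fob F X) (fob F Y) (far F X Y f)"
    have "Cmp E (fob F X) (fob F Y) (fob F Y) (c Y) (far F X Y f)
      = Cmp E (fob F X) (fob F ?Y) (fob F Y) (far F ?Y Y (i Y))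
          (Cmp E (fob F X) (fob F Y) (fob F ?Y) (\<eta> (fob F Y)) (far F X Y f))"
      using X by (simp add: c_def s i_in)
    also have "\<dots> = Cmp E (fob F X) (fob F ?X) (fob F Y)
         (far F ?X Y (Cmp S ?X ?Y Y (i Y) ?f)) (\<eta> (fob F X))"
      using X by (subst D'(3)) (simp_all add: s i_in)
    also have "\<dots> = Cmp E (fob F X) (fob F X) (fob F Y) (far F X Y f) (c X)"
      using X by (simp add: i_nat) (simp add: s i_in c_def)
    finally show ?thesis .
  qed
  ultimately have "nat_iso S E F F c" by (simp add: nat_iso_def nat_trans_def iso_arrow_def)
  moreover have "canonical_transf E S p (inv_img p) \<eta> = c"
    by (simp add: canonical_transf_def c_def i_def Let_def fun_eq_iff F_G_\<alpha>_\<beta>_def)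
  ultimately show ?thesis by (simp add: F_G_\<alpha>_\<beta>_def)
qed


section \<open>Small sets\<close>

text \<open>Extends membership in \<open>\<U>\<close> to sets over any type, such as sets of
  functions or tuples: they only have to fit into a member of \<open>\<U>\<close>.\<close>

definition is_small :: "'u set set \<Rightarrow> 'v set \<Rightarrow> bool" where
  "is_small \<U> T \<longleftrightarrow> (\<exists>Y\<in>\<U>. T \<lesssim> Y)"

lemma is_small_lepoll: "is_small \<U> T \<Longrightarrow> T' \<lesssim> T \<Longrightarrow> is_small \<U> T'"
  unfolding is_small_def using lepoll_trans by blast

lemma is_small_encode:
  assumes "set_universe \<U>" "is_small \<U> T"
  obtains i where "inj_on i T" "i ` T \<in> \<U>"
proof -
  obtain Y i where Y: "Y \<in> \<U>" "inj_on i T" "i ` T \<subseteq> Y"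
    using assms(2) by (auto simp: is_small_def lepoll_def)
  have "i ` T \<in> \<U>" using assms(1) Y(1) subset_imp_lepoll[OF Y(3)] by (auto simp: set_universe_def)
  then show ?thesis using that Y(2) by blast
qed

text \<open>\<open>set_universe\<close> only knows families indexed by all complex numbers. A
  smaller index set is embedded there, and the family is padded outside its image.\<close>

lemma set_universe_indexed_family:
  fixes F :: "'i \<Rightarrow> 'u set"
  assumes U: "set_universe \<U>" and I: "I \<lesssim> (UNIV :: complex set)" and F: "\<And>i. i \<in> I \<Longrightarrow> F i \<in> \<U>"
  shows "is_small \<U> (Sigma I F)" "is_small \<U> (PiE I F)"
proof -
  obtain k :: "'i \<Rightarrow> complex" where k: "inj_on k I" using I by (auto simp: lepoll_def)
  obtain X0 where "X0 \<in> \<U>" "(UNIV :: complex set) \<lesssim> X0" using U by (auto simp: set_universe_def)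
  \<comment> \<open>The padding has to be a singleton: empty padding would make the product empty,
    while one point changes neither the product nor the fact that the sum embeds.\<close>
  then have sub: "{undefined} \<in> \<U>"
    using U singleton_lepoll[of undefined 0 UNIV] lepoll_trans
    by (metis UNIV_I insert_absorb set_universe_def)
  define F' where "F' z = (if z \<in> k ` I then F (inv_into I k z) else {undefined})" for z
  have F'k: "F' (k i) = F i" if "i \<in> I" for i using that k by (simp add: F'_def)
  have "range F' \<subseteq> \<U>" using F sub by (auto simp: F'_def inv_into_into)
  then have S: "is_small \<U> (Sigma UNIV F')" and P: "is_small \<U> (PiE UNIV F')"
    using U by (auto simp: set_universe_def is_small_def)
  have "Sigma I F \<lesssim> Sigma UNIV F'"
    unfolding lepoll_def by (rule exI[of _ "\<lambda>(i, x). (k i, x)"])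
      (use k in \<open>auto simp: inj_on_def F'k\<close>)
  then show "is_small \<U> (Sigma I F)" using S is_small_lepoll by blast
  \<comment> \<open>On the padded indices the value must be \<open>undefined\<close>, the only point
    available there.\<close>
  let ?e = "\<lambda>f z. if z \<in> k ` I then f (inv_into I k z) else undefined"
  have "inj_on ?e (PiE I F)"
  proof (rule inj_onI)
    fix f g assume fg: "f \<in> PiE I F" "g \<in> PiE I F" "?e f = ?e g"
    show "f = g"
    proof (rule PiE_ext[OF fg(1,2)])
      fix i assume "i \<in> I"
      then show "f i = g i" using fun_cong[OF fg(3), of "k i"] k by simp
    qed
  qed
  moreover have "?e f \<in> PiE UNIV F'" if f: "f \<in> PiE I F" for f
    using k PiE_mem[OF f] by (auto simp: F'_def)
  ultimately have "PiE I F \<lesssim> PiE UNIV F'" unfolding lepoll_def by blast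
  then show "is_small \<U> (PiE I F)" using P is_small_lepoll by blast
qed

lemma complex_times_complex_lepoll: "(UNIV :: complex set) \<times> (UNIV :: complex set) \<lesssim> (UNIV :: complex set)"
proof -
  have "infinite (UNIV :: complex set)" by (rule infinite_UNIV_char_0)
  then have "(card_of (UNIV \<times> UNIV :: (complex \<times> complex) set), card_of (UNIV :: complex set)) \<in> ordLeq"
    using card_of_Times_same_infinite ordIso_iff_ordLeq by blast
  then show ?thesis
    unfolding lepoll_def using card_of_ordLeq[of "UNIV :: (complex \<times> complex) set" "UNIV :: complex set"]
    by auto
qed

lemma Sigma_lepoll_complex:
  assumes "I \<lesssim> (UNIV :: complex set)" "\<And>i. i \<in> I \<Longrightarrow> F i \<lesssim> (UNIV :: complex set)"
  shows "Sigma I F \<lesssim> (UNIV :: complex set)"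
proof -
  have "Sigma I F \<lesssim> I \<times> (UNIV :: complex set)" using assms(2) by (intro Sigma_lepoll_mono) auto
  also have "\<dots> \<lesssim> (UNIV :: complex set) \<times> (UNIV :: complex set)" by (intro times_lepoll_mono assms) auto
  finally show ?thesis using complex_times_complex_lepoll lepoll_trans by blast
qed


section \<open>Presheaf categories\<close>

lemma set_cat_sel [simp]: "Ob (set_cat \<U>) = \<U>" "Ar (set_cat \<U>) X Y = X \<rightarrow>\<^sub>E Y"
  "Cmp (set_cat \<U>) X Y Z g f = compose X g f" "Ident (set_cat \<U>) X = (\<lambda>x\<in>X. x)"
  by (simp_all add: set_cat_def)

lemma category_set_cat: "category (set_cat \<U>)"
  by unfold_locales (auto simp: compose_def PiE_def extensional_def fun_eq_iff Pi_iff)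

lemma restrict_functor_sel [simp]:
  "fob (restrict_functor A F) = restrict (fob F) (Ob A)"
  "X \<in> Ob A \<Longrightarrow> Y \<in> Ob A \<Longrightarrow> far (restrict_functor A F) X Y = restrict (far F X Y) (Ar A X Y)"
  by (simp_all add: restrict_functor_def)

lemma restrict_functor_idem [simp]:
  "restrict_functor A (restrict_functor A F) = restrict_functor A F"
  by (rule fctr_eqI) (auto simp: restrict_functor_def)

lemma presheaf_cat_sel [simp]:
  "Cmp (presheaf_cat \<U> A) F G H t s = (\<lambda>X\<in>Ob A. compose (fob F X) (t X) (s X))"
  "Ident (presheaf_cat \<U> A) F = (\<lambda>X\<in>Ob A. \<lambda>x\<in>fob F X. x)"
  by (simp_all add: presheaf_cat_def)

lemma presheafD:
  assumes F: "F \<in> Ob (presheaf_cat \<U> A)"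
  shows "X \<in> Ob A \<Longrightarrow> fob F X \<in> \<U>"
    "\<lbrakk>X \<in> Ob A; Y \<in> Ob A; f \<in> Ar A X Y\<rbrakk> \<Longrightarrow> far F Y X f \<in> fob F Y \<rightarrow>\<^sub>E fob F X"
    "\<lbrakk>X \<in> Ob A; Y \<in> Ob A; f \<in> Ar A X Y; x \<in> fob F Y\<rbrakk> \<Longrightarrow> far F Y X f x \<in> fob F X"
    "\<lbrakk>X \<in> Ob A; x \<in> fob F X\<rbrakk> \<Longrightarrow> far F X X (Ident A X) x = x"
    "\<lbrakk>X \<in> Ob A; Y \<in> Ob A; Z \<in> Ob A; f \<in> Ar A X Y; g \<in> Ar A Y Z; x \<in> fob F Z\<rbrakk> \<Longrightarrow>
      far F Z X (Cmp A X Y Z g f) x = far F Y X f (far F Z Y g x)"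
    "restrict_functor (opposite A) F = F"
proof -
  interpret F: cat_functor "opposite A" "set_cat \<U>" F using F by (simp add: presheaf_cat_def)
  show "X \<in> Ob A \<Longrightarrow> fob F X \<in> \<U>" using F.fob_in[of X] by simp
  show *: "\<lbrakk>X \<in> Ob A; Y \<in> Ob A; f \<in> Ar A X Y\<rbrakk> \<Longrightarrow> far F Y X f \<in> fob F Y \<rightarrow>\<^sub>E fob F X"
    using F.far_in[of Y X f] by simp
  then show "\<lbrakk>X \<in> Ob A; Y \<in> Ob A; f \<in> Ar A X Y; x \<in> fob F Y\<rbrakk> \<Longrightarrow> far F Y X f x \<in> fob F X" by blast
  show "\<lbrakk>X \<in> Ob A; x \<in> fob F X\<rbrakk> \<Longrightarrow> far F X X (Ident A X) x = x"
    using F.far_ident[of X] by simp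
  show "\<lbrakk>X \<in> Ob A; Y \<in> Ob A; Z \<in> Ob A; f \<in> Ar A X Y; g \<in> Ar A Y Z; x \<in> fob F Z\<rbrakk> \<Longrightarrow>
      far F Z X (Cmp A X Y Z g f) x = far F Y X f (far F Z Y g x)"
    using F.far_cmp[of Z Y X g f] by (simp add: compose_def)
  show "restrict_functor (opposite A) F = F" using F by (simp add: presheaf_cat_def)
qed

lemma presheaf_intro:
  assumes A: "category A" and F: "restrict_functor (opposite A) F = F"
    and "\<And>X. X \<in> Ob A \<Longrightarrow> fob F X \<in> \<U>"
    and in_fob: "\<And>X Y f. \<lbrakk>X \<in> Ob A; Y \<in> Ob A; f \<in> Ar A X Y\<rbrakk> \<Longrightarrow> far F Y X f \<in> fob F Y \<rightarrow>\<^sub>E fob F X"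
    and id: "\<And>X x. \<lbrakk>X \<in> Ob A; x \<in> fob F X\<rbrakk> \<Longrightarrow> far F X X (Ident A X) x = x"
    and cmp: "\<And>X Y Z f g x. \<lbrakk>X \<in> Ob A; Y \<in> Ob A; Z \<in> Ob A; f \<in> Ar A X Y; g \<in> Ar A Y Z; x \<in> fob F Z\<rbrakk> \<Longrightarrow>
      far F Z X (Cmp A X Y Z g f) x = far F Y X f (far F Z Y g x)"
  shows "F \<in> Ob (presheaf_cat \<U> A)"
proof -
  interpret A: category A by fact
  interpret category "opposite A" using A by (rule category_opposite)
  interpret S: category "set_cat \<U>" by (rule category_set_cat)
  have "cat_functor (opposite A) (set_cat \<U>) F"
  proof unfold_locales
    fix X Y Z f g assume X: "X \<in> Ob (opposite A)" "Y \<in> Ob (opposite A)" "Z \<in> Ob (opposite A)"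
      "f \<in> Ar (opposite A) X Y" "g \<in> Ar (opposite A) Y Z"
    have "far F X Z (Cmp A Z Y X f g) \<in> fob F X \<rightarrow>\<^sub>E fob F Z"
      using X by (intro in_fob A.cmp_in[of Z Y X]) simp_all
    moreover have "compose (fob F X) (far F Y Z g) (far F X Y f) \<in> fob F X \<rightarrow>\<^sub>E fob F Z"
      using X in_fob[of Y X f] in_fob[of Z Y g] by (auto simp: compose_def)
    ultimately have "far F X Z (Cmp A Z Y X f g) = compose (fob F X) (far F Y Z g) (far F X Y f)"
      by (rule PiE_ext) (use X cmp in \<open>simp_all add: compose_def\<close>)
    then show "far F X Z (Cmp (opposite A) X Y Z g f)
        = Cmp (set_cat \<U>) (fob F X) (fob F Y) (fob F Z) (far F Y Z g) (far F X Y f)" by simp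
  next
    fix X assume X: "X \<in> Ob (opposite A)"
    have "far F X X (Ident A X) = (\<lambda>x\<in>fob F X. x)"
      by (rule PiE_ext[of _ "fob F X" "\<lambda>_. fob F X"]) (use X id in_fob A.ident_in in auto)
    then show "far F X X (Ident (opposite A) X) = Ident (set_cat \<U>) (fob F X)" by simp
  qed (use assms in auto)
  with F show ?thesis by (simp add: presheaf_cat_def)
qed

lemma presheaf_arrow_iff:
  assumes F: "F \<in> Ob (presheaf_cat \<U> A)" and G: "G \<in> Ob (presheaf_cat \<U> A)"
  shows "t \<in> Ar (presheaf_cat \<U> A) F G \<longleftrightarrow> t \<in> extensional (Ob A) \<and>
    (\<forall>X\<in>Ob A. t X \<in> fob F X \<rightarrow>\<^sub>E fob G X) \<and>
    (\<forall>X\<in>Ob A. \<forall>Y\<in>Ob A. \<forall>f\<in>Ar A X Y. \<forall>x\<in>fob F Y. t X (far F Y X f x) = far G Y X f (t Y x))"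
proof -
  have "compose (fob F Y) (t X) (far F Y X f) = compose (fob F Y) (far G Y X f) (t Y) \<longleftrightarrow>
      (\<forall>x\<in>fob F Y. t X (far F Y X f x) = far G Y X f (t Y x))" for X Y f
    by (auto simp: compose_def restrict_def fun_eq_iff)
  then show ?thesis by (auto simp: presheaf_cat_def nat_trans_def)
qed

lemma presheaf_arrowD:
  assumes "t \<in> Ar (presheaf_cat \<U> A) F G"
    and F: "F \<in> Ob (presheaf_cat \<U> A)" and G: "G \<in> Ob (presheaf_cat \<U> A)"
  shows "t \<in> extensional (Ob A)"
    "X \<in> Ob A \<Longrightarrow> t X \<in> fob F X \<rightarrow>\<^sub>E fob G X"
    "\<lbrakk>X \<in> Ob A; x \<in> fob F X\<rbrakk> \<Longrightarrow> t X x \<in> fob G X"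
    "\<lbrakk>X \<in> Ob A; Y \<in> Ob A; f \<in> Ar A X Y; x \<in> fob F Y\<rbrakk> \<Longrightarrow> t X (far F Y X f x) = far G Y X f (t Y x)"
proof -
  note * = assms(1)[unfolded presheaf_arrow_iff[OF F G]]
  then show "t \<in> extensional (Ob A)" "X \<in> Ob A \<Longrightarrow> t X \<in> fob F X \<rightarrow>\<^sub>E fob G X"
    "\<lbrakk>X \<in> Ob A; Y \<in> Ob A; f \<in> Ar A X Y; x \<in> fob F Y\<rbrakk> \<Longrightarrow> t X (far F Y X f x) = far G Y X f (t Y x)" by auto
  then show "\<lbrakk>X \<in> Ob A; x \<in> fob F X\<rbrakk> \<Longrightarrow> t X x \<in> fob G X" by blast
qed

lemma presheaf_arrow_eqI:
  assumes "t \<in> Ar (presheaf_cat \<U> A) F G" "s \<in> Ar (presheaf_cat \<U> A) F G"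
    and F: "F \<in> Ob (presheaf_cat \<U> A)" and G: "G \<in> Ob (presheaf_cat \<U> A)"
    and eq: "\<And>X x. X \<in> Ob A \<Longrightarrow> x \<in> fob F X \<Longrightarrow> t X x = s X x"
  shows "t = s"
proof (rule extensionalityI)
  show "t \<in> extensional (Ob A)" "s \<in> extensional (Ob A)" using assms presheaf_arrowD(1) by blast+
  fix X assume "X \<in> Ob A"
  then show "t X = s X" using presheaf_arrowD(2)[OF assms(1) F G] presheaf_arrowD(2)[OF assms(2) F G] eq
    by (intro PiE_ext[of "t X" "fob F X" "\<lambda>_. fob G X"]) auto
qed

lemma category_presheaf_cat: "category (presheaf_cat \<U> A)"
proof
  fix F assume F: "F \<in> Ob (presheaf_cat \<U> A)"
  show "Ident (presheaf_cat \<U> A) F \<in> Ar (presheaf_cat \<U> A) F F"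
    unfolding presheaf_arrow_iff[OF F F] using presheafD[OF F] by simp
next
  fix F G H s t
  assume F: "F \<in> Ob (presheaf_cat \<U> A)" and G: "G \<in> Ob (presheaf_cat \<U> A)" and H: "H \<in> Ob (presheaf_cat \<U> A)"
    and s: "s \<in> Ar (presheaf_cat \<U> A) F G" and t: "t \<in> Ar (presheaf_cat \<U> A) G H"
  note s = presheaf_arrowD(2-)[OF s F G] and t = presheaf_arrowD(2-)[OF t G H]
  show "Cmp (presheaf_cat \<U> A) F G H t s \<in> Ar (presheaf_cat \<U> A) F H"
    unfolding presheaf_arrow_iff[OF F H] using s t presheafD(2-3)[OF F]
    by (auto simp: compose_def)
next
  fix F G s
  assume F: "F \<in> Ob (presheaf_cat \<U> A)" and G: "G \<in> Ob (presheaf_cat \<U> A)"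
    and s: "s \<in> Ar (presheaf_cat \<U> A) F G"
  note s = presheaf_arrowD[OF s F G]
  have "compose (fob F X) (\<lambda>x\<in>fob G X. x) (s X) = s X" "compose (fob F X) (s X) (\<lambda>x\<in>fob F X. x) = s X"
    if "X \<in> Ob A" for X
    using s(2,3)[OF that] by (auto simp: compose_def restrict_def fun_eq_iff PiE_def extensional_def)
  then show "Cmp (presheaf_cat \<U> A) F G G (Ident (presheaf_cat \<U> A) G) s = s"
    "Cmp (presheaf_cat \<U> A) F F G s (Ident (presheaf_cat \<U> A) F) = s"
    using s(1) by (auto simp: restrict_def fun_eq_iff extensional_def)
next
  fix E F G H r s t
  assume E: "E \<in> Ob (presheaf_cat \<U> A)" and F: "F \<in> Ob (presheaf_cat \<U> A)" and G: "G \<in> Ob (presheaf_cat \<U> A)"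
    and H: "H \<in> Ob (presheaf_cat \<U> A)" and r: "r \<in> Ar (presheaf_cat \<U> A) E F"
    and s: "s \<in> Ar (presheaf_cat \<U> A) F G" and t: "t \<in> Ar (presheaf_cat \<U> A) G H"
  have "\<And>X x. X \<in> Ob A \<Longrightarrow> x \<in> fob E X \<Longrightarrow> r X x \<in> fob F X" using presheaf_arrowD(3)[OF r E F] .
  then show "Cmp (presheaf_cat \<U> A) E G H t (Cmp (presheaf_cat \<U> A) E F G s r) =
      Cmp (presheaf_cat \<U> A) E F H (Cmp (presheaf_cat \<U> A) F G H t s) r"
    by (auto simp: restrict_def compose_def fun_eq_iff)
qed

lemma presheaf_iso:
  assumes t: "t \<in> Ar (presheaf_cat \<U> A) F G"
    and F: "F \<in> Ob (presheaf_cat \<U> A)" and G: "G \<in> Ob (presheaf_cat \<U> A)"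
    and bij: "\<And>X. X \<in> Ob A \<Longrightarrow> bij_betw (t X) (fob F X) (fob G X)"
  shows "iso_arrow (presheaf_cat \<U> A) F G t"
proof -
  note t' = presheaf_arrowD[OF t F G]
  define s where "s = (\<lambda>X\<in>Ob A. \<lambda>y\<in>fob G X. inv_into (fob F X) (t X) y)"
  have ts: "t X (s X y) = y" "s X y \<in> fob F X" if "X \<in> Ob A" "y \<in> fob G X" for X y
    using bij[OF that(1)] that by (auto simp: s_def bij_betw_def f_inv_into_f inv_into_into)
  have st: "s X (t X x) = x" if "X \<in> Ob A" "x \<in> fob F X" for X x
    using bij[OF that(1)] that t'(3) by (simp add: s_def bij_betw_def)
  have "s X (far G Y X f y) = far F Y X f (s Y y)"
    if "X \<in> Ob A" "Y \<in> Ob A" "f \<in> Ar A X Y" "y \<in> fob G Y" for X Y f y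
  proof -
    have "s X (far G Y X f y) = s X (far G Y X f (t Y (s Y y)))" using that ts by simp
    also have "\<dots> = s X (t X (far F Y X f (s Y y)))" using that ts t'(4) by simp
    finally show ?thesis using that ts st presheafD(3)[OF F] by simp
  qed
  then have s: "s \<in> Ar (presheaf_cat \<U> A) G F"
    unfolding presheaf_arrow_iff[OF G F] using ts(2) by (auto simp: s_def)
  have "is_inverse (presheaf_cat \<U> A) F G t s"
    unfolding is_inverse_def using s ts st by (auto simp: restrict_def compose_def fun_eq_iff)
  then show ?thesis using t by (auto simp: iso_arrow_def)
qed

text \<open>Allows a presheaf to be described by sets \<open>N X\<close> of any type with an action
  of arrows. The bijections \<open>i X\<close> into type \<open>'u\<close> are chosen independently
  for each object, and the action is conjugated by them.\<close>

lemma presheaf_of_small_family: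
  fixes N :: "'o \<Rightarrow> 'v set" and \<U> :: "'u set set"
  assumes U: "set_universe \<U>" and A: "category A" and small: "\<And>X. X \<in> Ob A \<Longrightarrow> is_small \<U> (N X)"
    and act: "\<And>X Y f n. \<lbrakk>X \<in> Ob A; Y \<in> Ob A; f \<in> Ar A X Y; n \<in> N Y\<rbrakk> \<Longrightarrow> act Y X f n \<in> N X"
    and id: "\<And>X n. \<lbrakk>X \<in> Ob A; n \<in> N X\<rbrakk> \<Longrightarrow> act X X (Ident A X) n = n"
    and cmp: "\<And>X Y Z f g n. \<lbrakk>X \<in> Ob A; Y \<in> Ob A; Z \<in> Ob A; f \<in> Ar A X Y; g \<in> Ar A Y Z; n \<in> N Z\<rbrakk> \<Longrightarrow>
      act Z X (Cmp A X Y Z g f) n = act Y X f (act Z Y g n)"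
  obtains P i where "P \<in> Ob (presheaf_cat \<U> A)" "\<And>X. X \<in> Ob A \<Longrightarrow> bij_betw (i X) (N X) (fob P X)"
    "\<And>X Y f n. \<lbrakk>X \<in> Ob A; Y \<in> Ob A; f \<in> Ar A X Y; n \<in> N Y\<rbrakk> \<Longrightarrow> far P Y X f (i Y n) = i X (act Y X f n)"
proof -
  interpret A: category A by fact
  have "\<exists>i. inj_on i (N X) \<and> i ` N X \<in> \<U>" if "X \<in> Ob A" for X
    using is_small_encode[OF U small[OF that]] by blast
  then obtain i where i: "\<And>X. X \<in> Ob A \<Longrightarrow> inj_on (i X) (N X)" "\<And>X. X \<in> Ob A \<Longrightarrow> i X ` N X \<in> \<U>" by metis
  define P where "P = restrict_functor (opposite A) \<lparr>fob = (\<lambda>X. i X ` N X),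
      far = (\<lambda>Y X f. \<lambda>p\<in>i Y ` N Y. i X (act Y X f (inv_into (N Y) (i Y) p)))\<rparr>"
  have fob: "fob P X = i X ` N X" if "X \<in> Ob A" for X using that by (simp add: P_def)
  have far: "far P Y X f (i Y n) = i X (act Y X f n)"
    if "X \<in> Ob A" "Y \<in> Ob A" "f \<in> Ar A X Y" "n \<in> N Y" for X Y f n
    using that i(1) by (simp add: P_def)
  have far_in: "far P Y X f \<in> extensional (fob P Y)"
    if "X \<in> Ob A" "Y \<in> Ob A" "f \<in> Ar A X Y" for X Y f
    using that by (simp add: P_def)
  have "P \<in> Ob (presheaf_cat \<U> A)"
  proof (rule presheaf_intro[OF A])
    show "restrict_functor (opposite A) P = P" by (simp add: P_def)
    show "far P Y X f \<in> fob P Y \<rightarrow>\<^sub>E fob P X" if "X \<in> Ob A" "Y \<in> Ob A" "f \<in> Ar A X Y" for X Y f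
      using that far_in[OF that] act by (auto simp: PiE_def fob far)
  qed (auto simp: fob far i id cmp act A.cat_simps)
  moreover have "bij_betw (i X) (N X) (fob P X)" if "X \<in> Ob A" for X
    using i(1)[OF that] by (simp add: fob that bij_betw_def)
  ultimately show ?thesis using that far by blast
qed

section \<open>Constant presheaves and evaluation at an object\<close>

lemma constant_presheaf_sel [simp]:
  "X \<in> Ob A \<Longrightarrow> fob (fob (constant_presheaf A) T) X = T"
  "\<lbrakk>X \<in> Ob A; Y \<in> Ob A; f \<in> Ar A X Y\<rbrakk> \<Longrightarrow> far (fob (constant_presheaf A) T) Y X f = (\<lambda>x\<in>T. x)"
  "far (constant_presheaf A) T T' h = (\<lambda>X\<in>Ob A. h)"
  by (simp_all add: constant_presheaf_def)

lemma constant_presheaf_in: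
  assumes "category A" "T \<in> \<U>"
  shows "fob (constant_presheaf A) T \<in> Ob (presheaf_cat \<U> A)"
proof -
  interpret category A by fact
  show ?thesis
    by (rule presheaf_intro[OF assms(1)]) (use assms(2) in \<open>simp_all add: cat_simps\<close>, simp add: constant_presheaf_def)
qed

lemma cat_functor_constant_presheaf:
  assumes "category A"
  shows "cat_functor (set_cat \<U>) (presheaf_cat \<U> A) (constant_presheaf A)"
proof -
  interpret A: category A by fact
  interpret S: category "set_cat \<U>" by (rule category_set_cat)
  interpret P: category "presheaf_cat \<U> A" by (rule category_presheaf_cat)
  show ?thesis
  proof unfold_locales
    fix T T' h assume T: "T \<in> Ob (set_cat \<U>)" "T' \<in> Ob (set_cat \<U>)" "h \<in> Ar (set_cat \<U>) T T'"
    then have T': "fob (constant_presheaf A) T \<in> Ob (presheaf_cat \<U> A)"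
      "fob (constant_presheaf A) T' \<in> Ob (presheaf_cat \<U> A)"
      using constant_presheaf_in[OF assms] by auto
    show "far (constant_presheaf A) T T' h
        \<in> Ar (presheaf_cat \<U> A) (fob (constant_presheaf A) T) (fob (constant_presheaf A) T')"
      unfolding presheaf_arrow_iff[OF T'] using T by auto
  qed (auto simp: constant_presheaf_in[OF assms] restrict_def fun_eq_iff)
qed

text \<open>Limits of presheaves are computed at each object. Smallness of \<open>A\<close> is not
  assumed, so there is no left adjoint (connected components) at hand from which exactness would
  follow formally.\<close>

lemma left_exact_constant_presheaf:
  assumes A: "category A"
  shows "left_exact (set_cat \<U>) (presheaf_cat \<U> A) (constant_presheaf A)"
  unfolding left_exact_def
proof (intro allI impI, elim conjE)
  fix J :: "(nat, nat) cat" and D L \<pi>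
  assume D: "cat_functor J (set_cat \<U>) D" and lim: "limit_cone J (set_cat \<U>) D L \<pi>"
  let ?K = "constant_presheaf A"
  interpret K: cat_functor "set_cat \<U>" "presheaf_cat \<U> A" ?K using A by (rule cat_functor_constant_presheaf)
  interpret D: cat_functor J "set_cat \<U>" D by fact
  have c: "cone J (set_cat \<U>) D L \<pi>" and univ: "\<And>M \<rho>. cone J (set_cat \<U>) D M \<rho> \<Longrightarrow>
      \<exists>!h. h \<in> M \<rightarrow>\<^sub>E L \<and> (\<forall>i\<in>Ob J. compose M (\<pi> i) h = \<rho> i)"
    using lim by (simp_all add: limit_cone_def)
  have L: "L \<in> \<U>" and pi: "\<And>i. i \<in> Ob J \<Longrightarrow> \<pi> i \<in> L \<rightarrow>\<^sub>E fob D i"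
    and pi_nat: "\<And>i j w. \<lbrakk>i \<in> Ob J; j \<in> Ob J; w \<in> Ar J i j\<rbrakk> \<Longrightarrow> compose L (far D i j w) (\<pi> i) = \<pi> j"
    using c by (auto simp: cone_def)
  have DU: "fob D i \<in> \<U>" if "i \<in> Ob J" for i using D.fob_in[OF that] by simp
  note KD = constant_presheaf_in[OF A DU] and KL = constant_presheaf_in[OF A L]
  have "cone J (presheaf_cat \<U> A) (?K \<circ>\<^sub>F D) (fob ?K L) (\<lambda>i. far ?K L (fob D i) (\<pi> i))"
    unfolding cone_def
  proof (intro conjI ballI)
    fix i j w assume ij: "i \<in> Ob J" "j \<in> Ob J" "w \<in> Ar J i j"
    then show "Cmp (presheaf_cat \<U> A) (fob ?K L) (fob (?K \<circ>\<^sub>F D) i) (fob (?K \<circ>\<^sub>F D) j) (far (?K \<circ>\<^sub>F D) i j w)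
        (far ?K L (fob D i) (\<pi> i)) = far ?K L (fob D j) (\<pi> j)"
      using pi_nat[OF ij] by (auto simp: restrict_def fun_eq_iff)
  qed (use KL K.far_in[of L _ "\<pi> _"] L pi DU in auto)
  moreover have "\<exists>!h. h \<in> Ar (presheaf_cat \<U> A) M (fob ?K L) \<and> (\<forall>i\<in>Ob J.
      Cmp (presheaf_cat \<U> A) M (fob ?K L) (fob (?K \<circ>\<^sub>F D) i) (far ?K L (fob D i) (\<pi> i)) h = \<rho> i)"
    if cM: "cone J (presheaf_cat \<U> A) (?K \<circ>\<^sub>F D) M \<rho>" for M \<rho>
  proof -
    have M: "M \<in> Ob (presheaf_cat \<U> A)" using cM by (simp add: cone_def)
    have rho: "\<rho> i \<in> Ar (presheaf_cat \<U> A) M (fob ?K (fob D i))" if "i \<in> Ob J" for i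
      using cM that by (auto simp: cone_def)
    have rho_nat: "(\<lambda>X\<in>Ob A. compose (fob M X) (far D i j w) (\<rho> i X)) = \<rho> j"
      if "i \<in> Ob J" "j \<in> Ob J" "w \<in> Ar J i j" for i j w
    proof -
      have "(\<lambda>X\<in>Ob A. compose (fob M X) (far D i j w) (\<rho> i X))
        = (\<lambda>X\<in>Ob A. compose (fob M X) ((\<lambda>X\<in>Ob A. far D i j w) X) (\<rho> i X))"
        by (rule restrict_ext) simp
      also have "\<dots> = \<rho> j" using cM that by (auto simp: cone_def)
      finally show ?thesis .
    qed
    note r = presheaf_arrowD[OF rho M KD]
    have cX: "cone J (set_cat \<U>) D (fob M X) (\<lambda>i. \<rho> i X)" if X: "X \<in> Ob A" for X
      unfolding cone_def using presheafD(1)[OF M X] r(2)[OF _ _ X] X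
      by (auto simp flip: rho_nat)
    have ex1: "\<exists>!h. h \<in> fob M X \<rightarrow>\<^sub>E L \<and> (\<forall>i\<in>Ob J. compose (fob M X) (\<pi> i) h = \<rho> i X)"
      if "X \<in> Ob A" for X by (rule univ[OF cX[OF that]])
    then obtain h where h: "\<And>X. X \<in> Ob A \<Longrightarrow> h X \<in> fob M X \<rightarrow>\<^sub>E L"
      and hp: "\<And>X i. X \<in> Ob A \<Longrightarrow> i \<in> Ob J \<Longrightarrow> compose (fob M X) (\<pi> i) (h X) = \<rho> i X" by metis
    have uniq: "a = b" if "X \<in> Ob A" "a \<in> fob M X \<rightarrow>\<^sub>E L" "\<And>i. i \<in> Ob J \<Longrightarrow> compose (fob M X) (\<pi> i) a = \<rho> i X"
      "b \<in> fob M X \<rightarrow>\<^sub>E L" "\<And>i. i \<in> Ob J \<Longrightarrow> compose (fob M X) (\<pi> i) b = \<rho> i X" for X a b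
      using ex1[OF that(1)] that(2-5) by (elim ex1E) metis
    let ?h = "\<lambda>X\<in>Ob A. h X"
    have "h X (far M Y X f y) = h Y y" if X: "X \<in> Ob A" "Y \<in> Ob A" "f \<in> Ar A X Y" "y \<in> fob M Y" for X Y f y
    proof -
      \<comment> \<open>Naturality of the pointwise mediating maps: \<open>?g\<close> and
        \<open>h Y\<close> mediate the same cone at \<open>Y\<close>, so uniqueness identifies
        them.\<close>
      let ?g = "compose (fob M Y) (h X) (far M Y X f)"
      have g1: "?g \<in> fob M Y \<rightarrow>\<^sub>E L" using h[of X] presheafD(3)[OF M] X by (auto simp: compose_def)
      have g2: "compose (fob M Y) (\<pi> i) ?g = \<rho> i Y" if i: "i \<in> Ob J" for i
      proof (rule PiE_ext)
        show "compose (fob M Y) (\<pi> i) ?g \<in> fob M Y \<rightarrow>\<^sub>E fob D i"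
          using pi[OF i] h[of X] presheafD(3)[OF M] X by (fastforce simp: compose_def)
        show "\<rho> i Y \<in> fob M Y \<rightarrow>\<^sub>E fob D i" using r(2)[OF i i X(2)] X by simp
        fix z assume z: "z \<in> fob M Y"
        have "\<pi> i (h X (far M Y X f z)) = \<rho> i X (far M Y X f z)"
          using fun_cong[OF hp[OF X(1) i], of "far M Y X f z"] presheafD(3)[OF M] X z by (simp add: compose_def)
        also have "\<dots> = \<rho> i Y z" using r(4)[OF i i X(1-3) z] r(3)[OF i i X(2) z] X by simp
        finally show "compose (fob M Y) (\<pi> i) ?g z = \<rho> i Y z" using z by (simp add: compose_def)
      qed
      have "?g = h Y" by (rule uniq[OF X(2)]; (rule g1 g2 h hp X(2) | assumption)+)
      then show ?thesis using X by (metis compose_eq)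
    qed
    then have h_in: "?h \<in> Ar (presheaf_cat \<U> A) M (fob ?K L)"
      unfolding presheaf_arrow_iff[OF M KL] using h PiE_mem[OF h] by auto
    show ?thesis
    proof (rule ex1I)
      have "(\<lambda>X\<in>Ob A. compose (fob M X) (\<pi> i) (h X)) = \<rho> i" if i: "i \<in> Ob J" for i
        using hp r(1)[OF i i] i by (auto simp: restrict_def fun_eq_iff extensional_def)
      then show "?h \<in> Ar (presheaf_cat \<U> A) M (fob ?K L) \<and> (\<forall>i\<in>Ob J.
        Cmp (presheaf_cat \<U> A) M (fob ?K L) (fob (?K \<circ>\<^sub>F D) i) (far ?K L (fob D i) (\<pi> i)) ?h = \<rho> i)"
        using h_in by (simp cong: restrict_cong)
      fix g assume g: "g \<in> Ar (presheaf_cat \<U> A) M (fob ?K L) \<and> (\<forall>i\<in>Ob J.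
        Cmp (presheaf_cat \<U> A) M (fob ?K L) (fob (?K \<circ>\<^sub>F D) i) (far ?K L (fob D i) (\<pi> i)) g = \<rho> i)"
      have "g X = h X" if X: "X \<in> Ob A" for X
      proof -
        have g1: "g X \<in> fob M X \<rightarrow>\<^sub>E L" using presheaf_arrowD(2)[of g, OF _ M KL X] g X by simp
        have g2: "compose (fob M X) (\<pi> i) (g X) = \<rho> i X" if "i \<in> Ob J" for i
        proof -
          have "(\<lambda>X\<in>Ob A. compose (fob M X) ((\<lambda>X\<in>Ob A. \<pi> i) X) (g X)) = \<rho> i" using g that by simp
          from fun_cong[OF this, of X] show ?thesis using X by simp
        qed
        show ?thesis by (rule uniq[OF X]; (rule g1 g2 h hp X | assumption)+)
      qed
      moreover have "g \<in> extensional (Ob A)" using presheaf_arrowD(1)[of g, OF _ M KL] g by blast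
      ultimately show "g = ?h" by (intro extensionalityI[of g "Ob A"]) auto
    qed
  qed
  ultimately show "limit_cone J (presheaf_cat \<U> A) (?K \<circ>\<^sub>F D) (fob ?K L) (\<lambda>i. far ?K L (fob D i) (\<pi> i))"
    by (simp add: limit_cone_def)
qed

definition evaluation :: "'o \<Rightarrow> (('o, 'a, 'u) psh, 'o \<Rightarrow> 'u \<Rightarrow> 'u, 'u set, 'u \<Rightarrow> 'u) fctr" where
  "evaluation c = \<lparr>fob = (\<lambda>F. fob F c), far = (\<lambda>F G t. t c)\<rparr>"

lemma evaluation_sel [simp]: "fob (evaluation c) F = fob F c" "far (evaluation c) F G t = t c"
  by (simp_all add: evaluation_def)

lemma cat_functor_evaluation:
  assumes "c \<in> Ob A"
  shows "cat_functor (presheaf_cat \<U> A) (set_cat \<U>) (evaluation c)"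
proof -
  interpret S: category "set_cat \<U>" by (rule category_set_cat)
  interpret P: category "presheaf_cat \<U> A" by (rule category_presheaf_cat)
  show ?thesis
  proof unfold_locales
    fix F G t assume "F \<in> Ob (presheaf_cat \<U> A)" "G \<in> Ob (presheaf_cat \<U> A)" "t \<in> Ar (presheaf_cat \<U> A) F G"
    then show "far (evaluation c) F G t \<in> Ar (set_cat \<U>) (fob (evaluation c) F) (fob (evaluation c) G)"
      using presheaf_arrowD(2)[OF _ _ _ assms] by simp
  qed (use assms presheafD(1) in auto)
qed

definition terminal_object :: "('o, 'a) cat \<Rightarrow> 'o \<Rightarrow> bool" where
  "terminal_object A c \<longleftrightarrow> c \<in> Ob A \<and> (\<forall>X\<in>Ob A. \<exists>!f. f \<in> Ar A X c)"

text \<open>Global sections of a presheaf form its limit, which is the value at a terminal object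
  \<open>c\<close>: a map from a constant presheaf is determined by its component at
  \<open>c\<close>.\<close>

lemma constant_presheaf_adjunction:
  assumes A: "category A" and c: "terminal_object A c"
  shows "\<exists>\<eta> \<epsilon>. adjunction (set_cat \<U>) (presheaf_cat \<U> A) (constant_presheaf A) (evaluation c) \<eta> \<epsilon>"
proof -
  interpret A: category A by fact
  let ?P = "presheaf_cat \<U> A" and ?K = "constant_presheaf A"
  interpret P: category ?P by (rule category_presheaf_cat)
  have cO: "c \<in> Ob A" using c by (simp add: terminal_object_def)
  interpret K: cat_functor "set_cat \<U>" ?P ?K using A by (rule cat_functor_constant_presheaf)
  interpret E: cat_functor ?P "set_cat \<U>" "evaluation c" using cO by (rule cat_functor_evaluation)
  obtain b where b: "\<And>X. X \<in> Ob A \<Longrightarrow> b X \<in> Ar A X c" and b_eq: "\<And>X f. X \<in> Ob A \<Longrightarrow> f \<in> Ar A X c \<Longrightarrow> f = b X"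
    using c unfolding terminal_object_def by metis
  have bc: "b c = Ident A c" using b_eq[OF cO A.ident_in[OF cO]] by simp
  \<comment> \<open>The counit acts by the unique arrow from \<open>X\<close> to \<open>c\<close>.
    At \<open>c\<close> this arrow is the identity, so factorizations can be recovered by evaluating
    at \<open>c\<close>.\<close>
  define \<epsilon> :: "('a, 'b, 'c) psh \<Rightarrow> 'a \<Rightarrow> 'c \<Rightarrow> 'c" where "\<epsilon> F = (\<lambda>X\<in>Ob A. far F c X (b X))" for F
  have K: "fob ?K T \<in> Ob ?P" if "T \<in> \<U>" for T using constant_presheaf_in[OF A that] .
  have eps: "\<epsilon> F \<in> Ar ?P (fob ?K (fob F c)) F" if F: "F \<in> Ob ?P" for F
    unfolding presheaf_arrow_iff[OF K[OF presheafD(1)[OF F cO]] F]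
  proof (intro conjI ballI)
    show "\<epsilon> F X \<in> fob (fob ?K (fob F c)) X \<rightarrow>\<^sub>E fob F X" if "X \<in> Ob A" for X
      using presheafD(2)[OF F that cO b[OF that]] that by (simp add: \<epsilon>_def)
    fix X Y f x assume X: "X \<in> Ob A" "Y \<in> Ob A" "f \<in> Ar A X Y" "x \<in> fob (fob ?K (fob F c)) Y"
    have "b X = Cmp A X Y c (b Y) f" using b_eq[of X "Cmp A X Y c (b Y) f"] X b cO A.cmp_in by simp
    then show "\<epsilon> F X (far (fob ?K (fob F c)) Y X f x) = far F Y X f (\<epsilon> F Y x)"
      using X presheafD(5)[OF F X(1,2) cO X(3) b[OF X(2)]] by (simp add: \<epsilon>_def)
  qed (simp add: \<epsilon>_def)
  have nat: "nat_trans ?P ?P (?K \<circ>\<^sub>F evaluation c) id_functor \<epsilon>"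
    unfolding nat_trans_def
  proof (intro conjI ballI)
    fix F G t assume F: "F \<in> Ob ?P" and G: "G \<in> Ob ?P" and t: "t \<in> Ar ?P F G"
    note t' = presheaf_arrowD[OF t F G]
    show "Cmp ?P (fob (?K \<circ>\<^sub>F evaluation c) F) (fob (?K \<circ>\<^sub>F evaluation c) G) (fob id_functor G) (\<epsilon> G)
        (far (?K \<circ>\<^sub>F evaluation c) F G t)
      = Cmp ?P (fob (?K \<circ>\<^sub>F evaluation c) F) (fob id_functor F) (fob id_functor G) (far id_functor F G t) (\<epsilon> F)"
      using t'(4)[OF _ cO b] by (auto simp: \<epsilon>_def compose_def restrict_def fun_eq_iff)
  qed (simp add: eps)
  have "couniversal (set_cat \<U>) ?P ?K F (fob (evaluation c) F) (\<epsilon> F)" if F: "F \<in> Ob ?P" for F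
    unfolding couniversal_def
  proof (intro conjI ballI)
    show "F \<in> Ob ?P" "fob (evaluation c) F \<in> Ob (set_cat \<U>)"
      "\<epsilon> F \<in> Ar ?P (fob ?K (fob (evaluation c) F)) F"
      using F eps[OF F] presheafD(1)[OF F cO] by auto
    fix T f assume "T \<in> Ob (set_cat \<U>)" and f: "f \<in> Ar ?P (fob ?K T) F"
    then have T: "T \<in> \<U>" by simp
    note f' = presheaf_arrowD[OF f K[OF T] F]
    note e = presheaf_arrowD[OF eps[OF F] K[OF presheafD(1)[OF F cO]] F]
    have *: "(\<lambda>X\<in>Ob A. compose T (\<epsilon> F X) ((\<lambda>X\<in>Ob A. g) X)) = f \<longleftrightarrow> g = f c"
      if g: "g \<in> T \<rightarrow>\<^sub>E fob F c" for g
    proof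
      assume "(\<lambda>X\<in>Ob A. compose T (\<epsilon> F X) ((\<lambda>X\<in>Ob A. g) X)) = f"
      from fun_cong[OF this, of c] have "compose T (\<epsilon> F c) g = f c" using cO by simp
      moreover have "compose T (\<epsilon> F c) g = g"
        by (rule PiE_ext[of _ T "\<lambda>_. fob F c"])
          (use g PiE_mem[OF g] presheafD(4)[OF F cO] in \<open>auto simp: compose_def \<epsilon>_def cO bc\<close>)
      ultimately show "g = f c" by simp
    next
      assume [simp]: "g = f c"
      have "compose T (\<epsilon> F X) (f c) = f X" if X: "X \<in> Ob A" for X
      proof (rule PiE_ext)
        show "compose T (\<epsilon> F X) (f c) \<in> T \<rightarrow>\<^sub>E fob F X" using e(3)[OF X] g X cO by (auto simp: compose_def)
        show "f X \<in> T \<rightarrow>\<^sub>E fob F X" using f'(2)[OF X] X by simp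
        fix x assume "x \<in> T"
        then show "compose T (\<epsilon> F X) (f c) x = f X x"
          using f'(4)[OF X cO b[OF X], of x] X cO b by (simp add: compose_def \<epsilon>_def)
      qed
      then have "(\<lambda>X\<in>Ob A. compose T (\<epsilon> F X) ((\<lambda>X\<in>Ob A. f c) X)) = f"
        using f'(1) by (auto simp: restrict_def fun_eq_iff extensional_def)
      then show "(\<lambda>X\<in>Ob A. compose T (\<epsilon> F X) ((\<lambda>X\<in>Ob A. g) X)) = f" by simp
    qed
    have fc: "f c \<in> T \<rightarrow>\<^sub>E fob F c" using f'(2)[OF cO] cO by simp
    have Cmp_eq: "Cmp ?P (fob ?K T) (fob ?K (fob (evaluation c) F)) F (\<epsilon> F) (far ?K T (fob (evaluation c) F) g)
      = (\<lambda>X\<in>Ob A. compose T (\<epsilon> F X) ((\<lambda>X\<in>Ob A. g) X))" for g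
      by (simp add: restrict_def fun_eq_iff)
    show "\<exists>!g. g \<in> Ar (set_cat \<U>) T (fob (evaluation c) F) \<and>
      Cmp ?P (fob ?K T) (fob ?K (fob (evaluation c) F)) F (\<epsilon> F) (far ?K T (fob (evaluation c) F) g) = f"
      unfolding Cmp_eq
    proof (rule ex1I[of _ "f c"])
      fix g assume "g \<in> Ar (set_cat \<U>) T (fob (evaluation c) F) \<and>
        (\<lambda>X\<in>Ob A. compose T (\<epsilon> F X) ((\<lambda>X\<in>Ob A. g) X)) = f"
      then show "g = f c" using *[of g] by (simp only: set_cat_sel evaluation_sel) blast
    qed (use *[OF fc] fc in simp_all)
  qed
  from adjunction_of_counit[OF K.cat_functor_axioms E.cat_functor_axioms nat this]
  show ?thesis by blast
qed

text \<open>A presheaf is a diagram on the opposite of \<open>B\<close>, where the initial object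
  \<open>c\<close> becomes terminal; its colimit is therefore its value at \<open>c\<close>. The
  counit consists of identities, which is what later makes the constant presheaf functor full and
  faithful.\<close>

lemma evaluation_adjunction:
  assumes B: "category B" and c: "c \<in> Ob B" and init: "\<And>X. X \<in> Ob B \<Longrightarrow> \<exists>!f. f \<in> Ar B c X"
  shows "\<exists>\<eta>. adjunction (presheaf_cat \<U> B) (set_cat \<U>) (evaluation c) (constant_presheaf B) \<eta>
    (\<lambda>T. \<lambda>x\<in>T. x)"
proof (rule adjunction_of_counit)
  interpret B: category B by fact
  let ?P = "presheaf_cat \<U> B" and ?K = "constant_presheaf B"
  interpret K: cat_functor "set_cat \<U>" ?P ?K using B by (rule cat_functor_constant_presheaf)
  interpret E: cat_functor ?P "set_cat \<U>" "evaluation c" using c by (rule cat_functor_evaluation)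
  show "cat_functor ?P (set_cat \<U>) (evaluation c)" "cat_functor (set_cat \<U>) ?P ?K" by unfold_locales
  obtain b where b: "\<And>X. X \<in> Ob B \<Longrightarrow> b X \<in> Ar B c X" and b_eq: "\<And>X f. X \<in> Ob B \<Longrightarrow> f \<in> Ar B c X \<Longrightarrow> f = b X"
    using init by metis
  have bc: "b c = Ident B c" using b_eq[OF c B.ident_in[OF c]] by simp
  show "nat_trans (set_cat \<U>) (set_cat \<U>) (evaluation c \<circ>\<^sub>F ?K) id_functor (\<lambda>T. \<lambda>x\<in>T. x)"
    using c by (auto simp: nat_trans_def compose_def fun_eq_iff)
  fix T assume "T \<in> Ob (set_cat \<U>)"
  then have T: "T \<in> \<U>" by simp
  note KT = constant_presheaf_in[OF B T]
  show "couniversal ?P (set_cat \<U>) (evaluation c) T (fob ?K T) (\<lambda>x\<in>T. x)"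
    unfolding couniversal_def
  proof (intro conjI ballI)
    show "T \<in> Ob (set_cat \<U>)" "fob ?K T \<in> Ob ?P"
      "(\<lambda>x\<in>T. x) \<in> Ar (set_cat \<U>) (fob (evaluation c) (fob ?K T)) T" using T KT c by auto
    fix F f assume F: "F \<in> Ob ?P" and "f \<in> Ar (set_cat \<U>) (fob (evaluation c) F) T"
    then have f: "f \<in> fob F c \<rightarrow>\<^sub>E T" by simp
    \<comment> \<open>Naturality forces this formula: act by the unique arrow from \<open>c\<close>
      to \<open>X\<close>, landing in the value at \<open>c\<close>, and apply \<open>f\<close>
      there.\<close>
    let ?g = "\<lambda>X\<in>Ob B. \<lambda>x\<in>fob F X. f (far F X c (b X) x)"
    have g: "?g \<in> Ar ?P F (fob ?K T)" unfolding presheaf_arrow_iff[OF F KT]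
    proof (intro conjI ballI)
      show "?g X \<in> fob F X \<rightarrow>\<^sub>E fob (fob ?K T) X" if "X \<in> Ob B" for X
        using that f presheafD(3)[OF F c that b[OF that]] by auto
      fix X Y u x assume X: "X \<in> Ob B" "Y \<in> Ob B" "u \<in> Ar B X Y" "x \<in> fob F Y"
      have "b Y = Cmp B c X Y u (b X)" using b_eq[of Y "Cmp B c X Y u (b X)"] X b c B.cmp_in by simp
      then show "?g X (far F Y X u x) = far (fob ?K T) Y X u (?g Y x)"
        using X c f b presheafD(3)[OF F] by (auto simp: presheafD(5)[OF F c])
    qed simp
    have iff: "compose (fob F c) (\<lambda>x\<in>T. x) (g c) = f \<longleftrightarrow> g c = f" if g: "g \<in> Ar ?P F (fob ?K T)" for g
    proof -
      have gc: "g c \<in> fob F c \<rightarrow>\<^sub>E T" using presheaf_arrowD(2)[OF g F KT c] c by simp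
      have "compose (fob F c) (\<lambda>x\<in>T. x) (g c) = g c"
        by (rule PiE_ext[of _ "fob F c" "\<lambda>_. T"]) (use gc in \<open>auto simp: compose_def\<close>)
      then show ?thesis by simp
    qed
    show "\<exists>!g. g \<in> Ar ?P F (fob ?K T) \<and> Cmp (set_cat \<U>) (fob (evaluation c) F)
       (fob (evaluation c) (fob ?K T)) T (\<lambda>x\<in>T. x) (far (evaluation c) F (fob ?K T) g) = f"
    proof (rule ex1I)
      have "?g c = f" by (rule PiE_ext[of _ "fob F c" "\<lambda>_. T"])
          (use c f presheafD(4)[OF F c] in \<open>auto simp: bc\<close>)
      then show "?g \<in> Ar ?P F (fob ?K T) \<and> Cmp (set_cat \<U>) (fob (evaluation c) F)
       (fob (evaluation c) (fob ?K T)) T (\<lambda>x\<in>T. x) (far (evaluation c) F (fob ?K T) ?g) = f"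
        using g iff[OF g] by simp
      fix h assume "h \<in> Ar ?P F (fob ?K T) \<and> Cmp (set_cat \<U>) (fob (evaluation c) F)
       (fob (evaluation c) (fob ?K T)) T (\<lambda>x\<in>T. x) (far (evaluation c) F (fob ?K T) h) = f"
      then have h: "h \<in> Ar ?P F (fob ?K T)" and hc: "h c = f" using iff by auto
      show "h = ?g"
      proof (rule presheaf_arrow_eqI[OF h g F KT])
        fix X x assume X: "X \<in> Ob B" "x \<in> fob F X"
        then show "h X x = ?g X x"
          using presheaf_arrowD(4)[OF h F KT c X(1) b[OF X(1)] X(2)] presheaf_arrowD(3)[OF h F KT X]
            b c hc by simp
      qed
    qed
  qed
qed


section \<open>Restriction to a full subcategory\<close>

lemma full_subcategory_sel [simp]: "Ob (full_subcategory A S) = S"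
  "Ar (full_subcategory A S) = Ar A" "Cmp (full_subcategory A S) = Cmp A"
  "Ident (full_subcategory A S) = Ident A"
  by (simp_all add: full_subcategory_def)

text \<open>Collects what both Kan extensions need for their values to be small: \<open>R\<close>
  represents all objects of \<open>S\<close> up to isomorphism, \<open>hom_from\<close> bounds the
  product behind the right extension and \<open>hom_to\<close> the sum behind the left one.\<close>

locale small_full_subcategory = A: category A
  for A :: "('o, 'a) cat" and S :: "'o set" and \<U> :: "'u set set" and R :: "'o set" +
  assumes U: "set_universe \<U>" and S: "S \<subseteq> Ob A"
    and R: "R \<subseteq> S" "R \<lesssim> (UNIV :: complex set)"
    and R_iso: "\<And>b. b \<in> S \<Longrightarrow> \<exists>r\<in>R. \<exists>u. iso_arrow A b r u"
    and hom_from: "\<And>b X. b \<in> S \<Longrightarrow> X \<in> Ob A \<Longrightarrow> Ar A b X \<lesssim> (UNIV :: complex set)"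
    and hom_to: "\<And>b X. b \<in> S \<Longrightarrow> X \<in> Ob A \<Longrightarrow> Ar A X b \<lesssim> (UNIV :: complex set)"
begin

abbreviation "B \<equiv> full_subcategory A S"
abbreviation "PA \<equiv> presheaf_cat \<U> A"
abbreviation "PB \<equiv> presheaf_cat \<U> (full_subcategory A S)"

lemma inA: "b \<in> S \<Longrightarrow> b \<in> Ob A" using S by blast

lemma category_B: "category B"
  by unfold_locales (use S in \<open>simp_all add: subset_iff A.cat_simps A.cmp_assoc\<close>)

lemma restriction_sel [simp]:
  "b \<in> S \<Longrightarrow> fob (fob (restriction B) F) b = fob F b"
  "b \<in> S \<Longrightarrow> b' \<in> S \<Longrightarrow> f \<in> Ar A b' b \<Longrightarrow> far (fob (restriction B) F) b b' f = far F b b' f"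
  "far (restriction B) F G t = restrict t S"
  by (simp_all add: restriction_def)

lemma restriction_in: "F \<in> Ob PA \<Longrightarrow> fob (restriction B) F \<in> Ob PB"
  by (rule presheaf_intro[OF category_B])
    (simp_all add: inA presheafD A.cat_simps, simp add: restriction_def)

lemma restriction_arrow:
  assumes F: "F \<in> Ob PA" and G: "G \<in> Ob PA" and t: "t \<in> Ar PA F G"
  shows "restrict t S \<in> Ar PB (fob (restriction B) F) (fob (restriction B) G)"
  unfolding presheaf_arrow_iff[OF restriction_in[OF F] restriction_in[OF G]]
  using presheaf_arrowD(2,4)[OF t F G] presheafD(3)[OF F] by (auto simp: inA)

lemma cat_functor_restriction: "cat_functor PA PB (restriction B)"
proof -
  interpret PA: category PA by (rule category_presheaf_cat)
  interpret PB: category PB by (rule category_presheaf_cat)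
  show ?thesis
  proof unfold_locales
    fix F G t assume "F \<in> Ob PA" "G \<in> Ob PA" "t \<in> Ar PA F G"
    then show "far (restriction B) F G t \<in> Ar PB (fob (restriction B) F) (fob (restriction B) G)"
      using restriction_arrow by simp
  qed (auto simp: restriction_in restrict_def fun_eq_iff inA)
qed

text \<open>The value at \<open>X\<close> of the right Kan extension is the set of natural maps to
  \<open>G\<close> from the presheaf represented by \<open>X\<close>, restricted to
  \<open>B\<close>. At objects of \<open>S\<close> the Yoneda lemma returns \<open>G\<close> because
  the subcategory is full; hence the counit is invertible.\<close>

lemma restriction_right_adjoint:
  "\<exists>G \<eta> \<epsilon>. adjunction PA PB (restriction B) G \<eta> \<epsilon> \<and>
     (\<forall>Y\<in>Ob PB. iso_arrow PB (fob (restriction B) (fob G Y)) Y (\<epsilon> Y))"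
proof -
  let ?r = "restriction B"
  have "\<exists>P e. couniversal PA PB ?r G P e \<and> iso_arrow PB (fob ?r P) G e" if G: "G \<in> Ob PB" for G
  proof -
    note G' = presheafD(3-5)[OF G, simplified]
    define D where "D X = {(b, f). b \<in> S \<and> f \<in> Ar A b X}" for X
    \<comment> \<open>Compatible families indexed by all arrows from objects of \<open>S\<close> to
      \<open>X\<close>. The index set may be large; that \<open>N X\<close> is small is a separate
      argument.\<close>
    define N where "N X = {\<phi> \<in> extensional (D X). (\<forall>b\<in>S. \<forall>f\<in>Ar A b X. \<phi> (b, f) \<in> fob G b) \<and>
      (\<forall>b\<in>S. \<forall>b'\<in>S. \<forall>f\<in>Ar A b X. \<forall>u\<in>Ar A b' b. \<phi> (b', Cmp A b' b X f u) = far G b b' u (\<phi> (b, f)))}" for X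
    define act where "act Y X g \<phi> = (\<lambda>(b, f)\<in>D X. \<phi> (b, Cmp A b X Y g f))" for Y X g and \<phi> :: "'o \<times> 'a \<Rightarrow> 'u"
    have N_in: "\<phi> (b, f) \<in> fob G b" if "\<phi> \<in> N X" "b \<in> S" "f \<in> Ar A b X" for \<phi> b f X
      using that by (simp add: N_def)
    have N_nat: "\<phi> (b', Cmp A b' b X f u) = far G b b' u (\<phi> (b, f))"
      if "\<phi> \<in> N X" "b \<in> S" "b' \<in> S" "f \<in> Ar A b X" "u \<in> Ar A b' b" for \<phi> b b' f X u
      using that by (simp add: N_def)
    have N_eqI: "\<phi> = \<psi>" if "\<phi> \<in> N X" "\<psi> \<in> N X" "\<And>b f. b \<in> S \<Longrightarrow> f \<in> Ar A b X \<Longrightarrow> \<phi> (b, f) = \<psi> (b, f)" for \<phi> \<psi> X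
      using that by (intro extensionalityI[of \<phi> "D X" \<psi>]) (auto simp: N_def D_def)
    have act: "act Y X g \<phi> (b, f) = \<phi> (b, Cmp A b X Y g f)" if "b \<in> S" "f \<in> Ar A b X" for X Y g \<phi> b f
      using that by (simp add: act_def D_def)
    have act_in: "act Y X g \<phi> \<in> N X" if X: "X \<in> Ob A" "Y \<in> Ob A" "g \<in> Ar A X Y" "\<phi> \<in> N Y" for X Y g \<phi>
      unfolding N_def
    proof (intro CollectI conjI ballI)
      show "act Y X g \<phi> \<in> extensional (D X)" by (simp add: act_def)
      fix b f assume b: "b \<in> S" "f \<in> Ar A b X"
      show "act Y X g \<phi> (b, f) \<in> fob G b" using X b by (simp add: act inA A.cmp_in N_in)
      fix b' u assume b': "b' \<in> S" "u \<in> Ar A b' b"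
      show "act Y X g \<phi> (b', Cmp A b' b X f u) = far G b b' u (act Y X g \<phi> (b, f))"
        using X b b' by (simp add: act inA A.cmp_in A.cmp_assoc N_nat)
    qed
    have small: "is_small \<U> (N X)" if X: "X \<in> Ob A" for X
    proof -
      let ?I = "Sigma R (\<lambda>r. Ar A r X)"
      have "?I \<lesssim> (UNIV :: complex set)"
        by (rule Sigma_lepoll_complex) (use R X hom_from in auto)
      then have sm: "is_small \<U> (PiE ?I (\<lambda>(r, f). fob G r))"
        by (rule set_universe_indexed_family(2)[OF U]) (use R presheafD(1)[OF G] in auto)
      \<comment> \<open>A compatible family is determined at representatives: any \<open>f\<close>
        out of \<open>b\<close> factors as \<open>(f v) u\<close> with \<open>u\<close> an
        isomorphism to a representative and \<open>v\<close> its inverse, so its value is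
        \<open>G\<close> along \<open>u\<close> of a value at the representative.\<close>
      have "inj_on (\<lambda>\<phi>. restrict \<phi> ?I) (N X)"
      proof (rule inj_onI)
        fix \<phi> \<psi> assume n: "\<phi> \<in> N X" "\<psi> \<in> N X" and eq: "restrict \<phi> ?I = restrict \<psi> ?I"
        show "\<phi> = \<psi>"
        proof (rule N_eqI[OF n])
          fix b f assume b: "b \<in> S" "f \<in> Ar A b X"
          then obtain r u where r: "r \<in> R" "iso_arrow A b r u" using R_iso by blast
          then obtain v where v: "v \<in> Ar A r b" "u \<in> Ar A b r" "Cmp A b r b v u = Ident A b"
            by (auto simp: iso_arrow_def is_inverse_def)
          have rS: "r \<in> S" using r R by auto
          have f: "f = Cmp A b r X (Cmp A r b X f v) u"
            using b v rS X by (simp add: inA A.cat_assoc A.cat_simps)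
          have "(r, Cmp A r b X f v) \<in> ?I" using r b v rS X by (auto simp: inA A.cmp_in)
          then have "\<phi> (r, Cmp A r b X f v) = \<psi> (r, Cmp A r b X f v)"
            using fun_cong[OF eq, of "(r, Cmp A r b X f v)"] by simp
          then show "\<phi> (b, f) = \<psi> (b, f)"
            using N_nat[OF n(1) rS b(1) _ v(2), of "Cmp A r b X f v"]
              N_nat[OF n(2) rS b(1) _ v(2), of "Cmp A r b X f v"] f b v rS X by (simp add: inA A.cmp_in)
        qed
      qed
      moreover have "(\<lambda>\<phi>. restrict \<phi> ?I) ` N X \<subseteq> PiE ?I (\<lambda>(r, f). fob G r)"
        unfolding image_subset_iff restrict_PiE_iff using N_in R(1) by fastforce
      ultimately have "N X \<lesssim> PiE ?I (\<lambda>(r, f). fob G r)" unfolding lepoll_def by blast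
      with sm show ?thesis by (rule is_small_lepoll)
    qed
    obtain P i where P: "P \<in> Ob PA" and i: "\<And>X. X \<in> Ob A \<Longrightarrow> bij_betw (i X) (N X) (fob P X)"
      and P_act: "\<And>X Y f n. \<lbrakk>X \<in> Ob A; Y \<in> Ob A; f \<in> Ar A X Y; n \<in> N Y\<rbrakk> \<Longrightarrow> far P Y X f (i Y n) = i X (act Y X f n)"
    proof -
      have 1: "act X X (Ident A X) n = n" if "X \<in> Ob A" "n \<in> N X" for X n
        by (rule N_eqI[of _ X]) (use that act_in A.ident_in in \<open>simp_all add: act inA A.cmp_ident_left\<close>)
      have 2: "act Z X (Cmp A X Y Z g f) n = act Y X f (act Z Y g n)"
        if "X \<in> Ob A" "Y \<in> Ob A" "Z \<in> Ob A" "f \<in> Ar A X Y" "g \<in> Ar A Y Z" "n \<in> N Z" for X Y Z f g n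
        by (rule N_eqI[of _ X]) (use that in \<open>simp_all add: act_in A.cmp_in\<close>, simp add: act inA A.cmp_in A.cmp_assoc)
      show thesis using presheaf_of_small_family[OF U A.category_axioms small act_in 1 2] that by blast
    qed
    \<comment> \<open>The Yoneda map: decode the family and read off its entry at the
      identity.\<close>
    define e where "e = (\<lambda>b\<in>S. \<lambda>p\<in>fob P b. inv_into (N b) (i b) p (b, Ident A b))"
    have e: "e b (i b n) = n (b, Ident A b)" if "b \<in> S" "n \<in> N b" for b n
      using i[OF inA[OF that(1)]] that by (auto simp: e_def bij_betw_def)
    have PE: "\<exists>n\<in>N X. p = i X n" if "X \<in> Ob A" "p \<in> fob P X" for p X
      using i[OF that(1)] that(2) by (auto simp: bij_betw_def)
    have iN: "i X n \<in> fob P X" if "X \<in> Ob A" "n \<in> N X" for X n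
      using i[OF that(1)] that(2) by (auto simp: bij_betw_def)
    have e_act: "e b (far P X b f (i X n)) = n (b, f)" if "b \<in> S" "X \<in> Ob A" "f \<in> Ar A b X" "n \<in> N X" for b X f n
      using that by (simp add: P_act inA e act_in act A.ident_in A.cmp_ident_right)
    have e_in: "e b p \<in> fob G b" if "b \<in> S" "p \<in> fob P b" for b p
      using PE[OF inA[OF that(1)] that(2)] that by (auto simp: e N_in inA A.ident_in)
    note rP = restriction_in[OF P]
    have e_nat: "e b' (far P b b' u p) = far G b b' u (e b p)"
      if b: "b \<in> S" "b' \<in> S" "u \<in> Ar A b' b" "p \<in> fob P b" for b b' u p
    proof -
      obtain n where n: "n \<in> N b" "p = i b n" using PE b inA by blast
      then show ?thesis using N_nat[OF n(1) b(1,2) A.ident_in b(3)] b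
        by (simp add: inA e_act e A.cmp_ident_left)
    qed
    have e_ar: "e \<in> Ar PB (fob ?r P) G"
      unfolding presheaf_arrow_iff[OF rP G] using e_in e_nat by (auto simp: e_def)
    have iso: "iso_arrow PB (fob ?r P) G e"
    proof (rule presheaf_iso[OF e_ar rP G])
      fix b assume "b \<in> Ob B"
      then have b: "b \<in> S" by simp
      have inj: "inj_on (e b) (fob P b)"
      proof (rule inj_onI)
        fix p q assume p: "p \<in> fob P b" and q: "q \<in> fob P b" and eq: "e b p = e b q"
        obtain m n where mn: "m \<in> N b" "p = i b m" "n \<in> N b" "q = i b n" using p q PE b inA by metis
        have "m = n"
        proof (rule N_eqI[OF mn(1,3)])
          fix b' f assume b': "b' \<in> S" "f \<in> Ar A b' b"
          have "e b' (far P b b' f p) = e b' (far P b b' f q)" using e_nat[OF b b'(1,2)] p q eq by simp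
          then show "m (b', f) = n (b', f)" using mn e_act[OF b'(1) inA[OF b] b'(2)] by simp
        qed
        then show "p = q" using mn by simp
      qed
      have "\<exists>p\<in>fob P b. e b p = y" if y: "y \<in> fob G b" for y
      proof -
        \<comment> \<open>Inverse Yoneda map: an element \<open>y\<close> generates the family of
          its restrictions.\<close>
        let ?n = "\<lambda>(b', f)\<in>D b. far G b b' f y"
        have n: "?n (b', f) = far G b b' f y" if "b' \<in> S" "f \<in> Ar A b' b" for b' f using that by (simp add: D_def)
        have "?n \<in> N b" unfolding N_def
        proof (intro CollectI conjI ballI)
          fix b' f assume b': "b' \<in> S" "f \<in> Ar A b' b"
          show "?n (b', f) \<in> fob G b'" using b b' y by (simp only: n) (simp add: G')
          fix b'' u assume "b'' \<in> S" "u \<in> Ar A b'' b'"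
          then show "?n (b'', Cmp A b'' b' b f u) = far G b' b'' u (?n (b', f))"
            using b b' y A.cmp_in[of b'' b' b u f] by (simp only: n inA) (simp add: G'(3))
        qed simp
        then show ?thesis using e[OF b, of ?n] n[OF b A.ident_in] G'(2)[OF b y] iN b inA by metis
      qed
      then show "bij_betw (e b) (fob (fob ?r P) b) (fob G b)"
        using inj e_in[OF b] b by (auto simp: bij_betw_def)
    qed
    have "couniversal PA PB ?r G P e"
      unfolding couniversal_def
    proof (intro conjI ballI G P e_ar)
      fix M \<tau> assume M: "M \<in> Ob PA" and t: "\<tau> \<in> Ar PB (fob ?r M) G"
      note rM = restriction_in[OF M]
      note t' = presheaf_arrowD[OF t rM G, simplified]
      \<comment> \<open>The family which \<open>m\<close> must be sent to: naturality and the entry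
        at the identity leave no other value at \<open>(b, f)\<close>.\<close>
      let ?n = "\<lambda>X m. \<lambda>(b, f)\<in>D X. \<tau> b (far M X b f m)"
      have n: "?n X m (b, f) = \<tau> b (far M X b f m)" if "b \<in> S" "f \<in> Ar A b X" for X m b f using that by (simp add: D_def)
      have nN: "?n X m \<in> N X" if X: "X \<in> Ob A" "m \<in> fob M X" for X m
        unfolding N_def
      proof (intro CollectI conjI ballI)
        fix b f assume b: "b \<in> S" "f \<in> Ar A b X"
        have m: "far M X b f m \<in> fob M b" using X b presheafD(3)[OF M] inA by simp
        show "?n X m (b, f) \<in> fob G b" using b m by (simp only: n) (simp add: t'(3))
        fix b' u assume b': "b' \<in> S" "u \<in> Ar A b' b"
        show "?n X m (b', Cmp A b' b X f u) = far G b b' u (?n X m (b, f))"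
          using X b b' m A.cmp_in[of b' b X u f] t'(4)[OF b'(1) b(1) b'(2), of "far M X b f m"]
          by (simp only: n inA) (simp add: inA presheafD(5)[OF M])
      qed simp
      define \<sigma> where "\<sigma> = (\<lambda>X\<in>Ob A. \<lambda>m\<in>fob M X. i X (?n X m))"
      have s: "\<sigma> \<in> Ar PA M P" unfolding presheaf_arrow_iff[OF M P]
      proof (intro conjI ballI)
        show "\<sigma> X \<in> fob M X \<rightarrow>\<^sub>E fob P X" if "X \<in> Ob A" for X using that iN nN by (auto simp: \<sigma>_def)
        fix X Y g m assume X: "X \<in> Ob A" "Y \<in> Ob A" "g \<in> Ar A X Y" "m \<in> fob M Y"
        have gm: "far M Y X g m \<in> fob M X" using X presheafD(3)[OF M] by simp
        have "?n X (far M Y X g m) = act Y X g (?n Y m)"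
        proof (rule N_eqI[OF nN[OF X(1) gm] act_in[OF X(1-3) nN[OF X(2,4)]]])
          fix b f assume b: "b \<in> S" "f \<in> Ar A b X"
          show "?n X (far M Y X g m) (b, f) = act Y X g (?n Y m) (b, f)"
            using X b A.cmp_in[of b X Y f g] by (simp only: act n inA) (simp add: presheafD(5)[OF M] inA)
        qed
        then show "\<sigma> X (far M Y X g m) = far P Y X g (\<sigma> Y m)"
          using X gm nN by (simp add: \<sigma>_def P_act)
      qed (simp add: \<sigma>_def)
      have es: "e b (\<sigma> b m) = \<tau> b m" if "b \<in> S" "m \<in> fob M b" for b m
        using that by (simp add: \<sigma>_def inA e nN) (simp add: D_def inA A.ident_in presheafD(4)[OF M])
      have "(\<lambda>b\<in>S. compose (fob (fob ?r M) b) (e b) ((restrict h S) b)) = \<tau> \<longleftrightarrow>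
        (\<forall>b\<in>S. \<forall>m\<in>fob M b. e b (h b m) = \<tau> b m)" for h
        using t'(1) t'(2) by (auto simp: restrict_def compose_def fun_eq_iff extensional_def PiE_def)
      then have iff: "Cmp PB (fob ?r M) (fob ?r P) G e (far ?r M P h) = \<tau> \<longleftrightarrow>
        (\<forall>b\<in>S. \<forall>m\<in>fob M b. e b (h b m) = \<tau> b m)" for h
        by (simp only: presheaf_cat_sel full_subcategory_sel restriction_sel(3))
      show "\<exists>!h. h \<in> Ar PA M P \<and> Cmp PB (fob ?r M) (fob ?r P) G e (far ?r M P h) = \<tau>"
      proof (rule ex1I)
        show "\<sigma> \<in> Ar PA M P \<and> Cmp PB (fob ?r M) (fob ?r P) G e (far ?r M P \<sigma>) = \<tau>"
          using s iff es by blast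
        fix h assume h0: "h \<in> Ar PA M P \<and> Cmp PB (fob ?r M) (fob ?r P) G e (far ?r M P h) = \<tau>"
        then have h: "h \<in> Ar PA M P" and eh: "\<And>b m. b \<in> S \<Longrightarrow> m \<in> fob M b \<Longrightarrow> e b (h b m) = \<tau> b m"
          using iff by blast+
        note h' = presheaf_arrowD[OF h M P]
        show "h = \<sigma>"
        proof (rule presheaf_arrow_eqI[OF h s M P])
          fix X m assume X: "X \<in> Ob A" "m \<in> fob M X"
          obtain n where n: "n \<in> N X" "h X m = i X n" using PE[OF X(1) h'(3)[OF X]] by blast
          have "n = ?n X m"
          proof (rule N_eqI[OF n(1) nN[OF X]])
            fix b f assume b: "b \<in> S" "f \<in> Ar A b X"
            have "n (b, f) = e b (far P X b f (h X m))" using e_act b X n by simp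
            also have "\<dots> = e b (h b (far M X b f m))" using h'(4)[of b X f m] b X inA by simp
            also have "\<dots> = \<tau> b (far M X b f m)" using eh b X presheafD(3)[OF M] inA by simp
            finally show "n (b, f) = ?n X m (b, f)" using b by (simp add: D_def)
          qed
          then show "h X m = \<sigma> X m" using X n by (simp add: \<sigma>_def)
        qed
      qed
    qed
    then show ?thesis using iso by blast
  qed
  then obtain P \<epsilon> where u: "\<And>G. G \<in> Ob PB \<Longrightarrow> couniversal PA PB ?r G (P G) (\<epsilon> G)"
    and iso: "\<And>G. G \<in> Ob PB \<Longrightarrow> iso_arrow PB (fob ?r (P G)) G (\<epsilon> G)" by metis
  obtain Q \<eta> where "fob Q = P" "adjunction PA PB ?r Q \<eta> \<epsilon>"
    using right_adjoint_exists[OF cat_functor_restriction u] by blast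
  then show ?thesis using iso by blast
qed
end

context small_full_subcategory begin

text \<open>The left Kan extension is carried by the image of the family
  \<open>(b, f, y) \<mapsto> far M b X f (\<tau> b y)\<close> indexed by all presheaves \<open>M\<close> and arrows \<open>\<tau> : G \<rightarrow> restriction B M\<close>:
  no quotient has to be formed, and the universal arrow into \<open>M\<close> is a projection.\<close>

lemma restriction_left_adjoint: "\<exists>F \<eta> \<epsilon>. adjunction PB PA F (restriction B) \<eta> \<epsilon>"
proof (rule left_adjoint_exists[OF cat_functor_restriction])
  let ?r = "restriction B"
  fix G assume G: "G \<in> Ob PB"
  note G' = presheafD(3-5)[OF G, simplified]
  \<comment> \<open>All tests of a presheaf on \<open>A\<close> against \<open>G\<close>.
    \<open>Q\<close> is as large as the presheaf category, but it only indexes coordinates: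
    \<open>N X\<close> is the image of the formal elements \<open>T X\<close>, and its size is
    bounded from that side.\<close>
  define Q where "Q = {(M, \<tau>). M \<in> Ob PA \<and> \<tau> \<in> Ar PB G (fob ?r M)}"
  define T where "T X = {(b, f, y). b \<in> S \<and> f \<in> Ar A X b \<and> y \<in> fob G b}" for X
  define ev where "ev X = (\<lambda>(b, f, y). \<lambda>(M, \<tau>)\<in>Q. far M b X f (\<tau> b y))" for X
  define N where "N X = ev X ` T X" for X
  define act where "act Y X g \<phi> = (\<lambda>(M, \<tau>)\<in>Q. far M Y X g (\<phi> (M, \<tau>)))"
    for Y X :: 'o and g :: 'a and \<phi> :: "('o, 'a, 'u) psh \<times> ('o \<Rightarrow> 'u \<Rightarrow> 'u) \<Rightarrow> 'u"
  have QD: "M \<in> Ob PA" "\<tau> \<in> Ar PB G (fob ?r M)" if "(M, \<tau>) \<in> Q" for M \<tau> using that by (auto simp: Q_def)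
  have tau_in: "\<tau> b y \<in> fob M b" if "(M, \<tau>) \<in> Q" "b \<in> S" "y \<in> fob G b" for M \<tau> b y
    using presheaf_arrowD(3)[OF QD(2)[OF that(1)] G restriction_in[OF QD(1)[OF that(1)]], of b y] that by simp
  have tau_nat: "\<tau> b' (far G b b' u y) = far M b b' u (\<tau> b y)"
    if "(M, \<tau>) \<in> Q" "b \<in> S" "b' \<in> S" "u \<in> Ar A b' b" "y \<in> fob G b" for M \<tau> b b' u y
    using presheaf_arrowD(4)[OF QD(2)[OF that(1)] G restriction_in[OF QD(1)[OF that(1)]], of b' b u y] that by simp
  have ev: "ev X (b, f, y) (M, \<tau>) = far M b X f (\<tau> b y)" if "(M, \<tau>) \<in> Q" for X b f y M \<tau>
    using that by (simp add: ev_def)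
  have ev_act: "act Y X g (ev Y (b, f, y)) = ev X (b, Cmp A X Y b f g, y)"
    if "X \<in> Ob A" "Y \<in> Ob A" "b \<in> S" "g \<in> Ar A X Y" "f \<in> Ar A Y b" "y \<in> fob G b" for X Y b g f y
  proof -
    have "act Y X g (ev Y (b, f, y)) p = ev X (b, Cmp A X Y b f g, y) p" for p
    proof (cases "p \<in> Q")
      case True
      then obtain M \<tau> where p: "p = (M, \<tau>)" "(M, \<tau>) \<in> Q" by (cases p) auto
      then show ?thesis using that tau_in[OF p(2)]
        by (simp add: act_def ev presheafD(5)[OF QD(1)[OF p(2)]] inA)
    qed (auto simp: act_def ev_def)
    then show ?thesis by blast
  qed
  \<comment> \<open>The defining relation of the coend. It holds in every coordinate because each
    \<open>\<tau>\<close> is natural, so identifications need not be imposed.\<close>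
  have ev_rel: "ev X (b', Cmp A X b b' u f, y) = ev X (b, f, far G b' b u y)"
    if "X \<in> Ob A" "b \<in> S" "b' \<in> S" "u \<in> Ar A b b'" "f \<in> Ar A X b" "y \<in> fob G b'" for X b b' u f y
  proof -
    have "ev X (b', Cmp A X b b' u f, y) p = ev X (b, f, far G b' b u y) p" for p
    proof (cases "p \<in> Q")
      case True
      then obtain M \<tau> where p: "p = (M, \<tau>)" "(M, \<tau>) \<in> Q" by (cases p) auto
      then show ?thesis using that tau_in[OF p(2)] tau_nat[OF p(2) that(3,2,4,6)]
        by (simp add: ev presheafD(5)[OF QD(1)[OF p(2)]] inA)
    qed (auto simp: ev_def)
    then show ?thesis by blast
  qed
  have N_cases: "\<exists>b f y. b \<in> S \<and> f \<in> Ar A X b \<and> y \<in> fob G b \<and> n = ev X (b, f, y)" if "n \<in> N X" for n X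
    using that by (auto simp: N_def T_def)
  have N_in: "ev X (b, f, y) \<in> N X" if "b \<in> S" "f \<in> Ar A X b" "y \<in> fob G b" for X b f y
    using that by (auto simp: N_def T_def)
  have small: "is_small \<U> (N X)" if X: "X \<in> Ob A" for X
  proof -
    let ?I = "Sigma R (\<lambda>r. Ar A X r)"
    have "?I \<lesssim> (UNIV :: complex set)"
      by (rule Sigma_lepoll_complex) (use R X hom_to in auto)
    then have sm: "is_small \<U> (Sigma ?I (\<lambda>(r, f). fob G r))"
      by (rule set_universe_indexed_family(1)[OF U]) (use R presheafD(1)[OF G] in auto)
    \<comment> \<open>An isomorphism \<open>u\<close> from \<open>b\<close> to a representative
      moves across \<open>ev_rel\<close>, so formal elements over representatives already give all
      of \<open>N X\<close>.\<close>
    have "N X \<subseteq> (\<lambda>((r, f), y). ev X (r, f, y)) ` Sigma ?I (\<lambda>(r, f). fob G r)"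
    proof
      fix n assume "n \<in> N X"
      then obtain b f y where b: "b \<in> S" "f \<in> Ar A X b" "y \<in> fob G b" and n: "n = ev X (b, f, y)"
        using N_cases by blast
      obtain r u where r: "r \<in> R" "iso_arrow A b r u" using R_iso b by blast
      then obtain v where v: "v \<in> Ar A r b" "u \<in> Ar A b r" "Cmp A b r b v u = Ident A b"
        by (auto simp: iso_arrow_def is_inverse_def)
      have rS: "r \<in> S" using r R by auto
      have "far G r b u (far G b r v y) = y"
        using G'(3)[OF b(1) rS b(1) v(2,1) b(3)] v(3) G'(2)[OF b(1,3)] by simp
      then have "n = ev X (r, Cmp A X b r u f, far G b r v y)"
        using ev_rel[OF X b(1) rS v(2) b(2), of "far G b r v y"] G'(1)[OF rS b(1) v(1) b(3)] n by simp
      moreover have "((r, Cmp A X b r u f), far G b r v y) \<in> Sigma ?I (\<lambda>(r, f). fob G r)"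
        using r X b v rS G'(1) by (auto simp: inA A.cmp_in)
      ultimately show "n \<in> (\<lambda>((r, f), y). ev X (r, f, y)) ` Sigma ?I (\<lambda>(r, f). fob G r)"
        by (intro image_eqI) auto
    qed
    with sm show ?thesis using is_small_lepoll subset_image_lepoll by blast
  qed
  have act_in: "act Y X g n \<in> N X" if X: "X \<in> Ob A" "Y \<in> Ob A" "g \<in> Ar A X Y" "n \<in> N Y" for X Y g n
  proof -
    obtain b f y where b: "b \<in> S" "f \<in> Ar A Y b" "y \<in> fob G b" "n = ev Y (b, f, y)"
      using N_cases X(4) by blast
    then show ?thesis using X by (simp add: ev_act N_in A.cmp_in inA)
  qed
  obtain P i where P: "P \<in> Ob PA" and i: "\<And>X. X \<in> Ob A \<Longrightarrow> bij_betw (i X) (N X) (fob P X)"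
    and P_act: "\<And>X Y f n. \<lbrakk>X \<in> Ob A; Y \<in> Ob A; f \<in> Ar A X Y; n \<in> N Y\<rbrakk> \<Longrightarrow> far P Y X f (i Y n) = i X (act Y X f n)"
  proof -
    have 1: "act X X (Ident A X) n = n" if X: "X \<in> Ob A" and n: "n \<in> N X" for X n
    proof -
      obtain b f y where b: "b \<in> S" "f \<in> Ar A X b" "y \<in> fob G b" "n = ev X (b, f, y)"
        using N_cases n by blast
      then show ?thesis using X by (simp add: ev_act A.ident_in A.cmp_ident_right inA)
    qed
    have 2: "act Z X (Cmp A X Y Z g f) n = act Y X f (act Z Y g n)"
      if X: "X \<in> Ob A" "Y \<in> Ob A" "Z \<in> Ob A" "f \<in> Ar A X Y" "g \<in> Ar A Y Z" and n: "n \<in> N Z" for X Y Z f g n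
    proof -
      obtain b h y where b: "b \<in> S" "h \<in> Ar A Z b" "y \<in> fob G b" "n = ev Z (b, h, y)"
        using N_cases n by blast
      then show ?thesis using X by (simp add: ev_act A.cmp_in A.cmp_assoc inA)
    qed
    show thesis using presheaf_of_small_family[OF U A.category_axioms small act_in 1 2] that by blast
  qed
  have PE: "\<exists>b f y. b \<in> S \<and> f \<in> Ar A X b \<and> y \<in> fob G b \<and> p = i X (ev X (b, f, y))"
    if "X \<in> Ob A" "p \<in> fob P X" for p X
    using i[OF that(1)] that(2) N_cases by (fastforce simp: bij_betw_def)
  have iN: "i X n \<in> fob P X" if "X \<in> Ob A" "n \<in> N X" for X n
    using i[OF that(1)] that(2) by (auto simp: bij_betw_def)
  note rP = restriction_in[OF P]
  define e where "e = (\<lambda>b\<in>S. \<lambda>y\<in>fob G b. i b (ev b (b, Ident A b, y)))"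
  have e_in: "e b y \<in> fob P b" if "b \<in> S" "y \<in> fob G b" for b y
    using that by (simp add: e_def iN N_in inA A.ident_in)
  have e_far: "far P b X f (e b y) = i X (ev X (b, f, y))"
    if "X \<in> Ob A" "b \<in> S" "f \<in> Ar A X b" "y \<in> fob G b" for X b f y
    using that by (simp add: e_def P_act N_in ev_act inA A.ident_in A.cmp_ident_left)
  have e_ar: "e \<in> Ar PB G (fob ?r P)"
    unfolding presheaf_arrow_iff[OF G rP]
  proof (intro conjI ballI)
    show "e b \<in> fob G b \<rightarrow>\<^sub>E fob (fob ?r P) b" if "b \<in> Ob B" for b
      using that e_in by (auto simp: e_def)
    fix b' b u y assume "b' \<in> Ob B" "b \<in> Ob B" "u \<in> Ar B b' b" and y: "y \<in> fob G b"
    then have b: "b' \<in> S" "b \<in> S" "u \<in> Ar A b' b" by auto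
    have "ev b' (b, u, y) = ev b' (b', Ident A b', far G b b' u y)"
      using ev_rel[of b' b' b u "Ident A b'" y] b y by (simp add: inA A.ident_in A.cmp_ident_right)
    then show "e b' (far G b b' u y) = far (fob ?r P) b b' u (e b y)"
      using b y G'(1) e_far[OF inA[OF b(1)] b(2,3) y] by (simp add: e_def)
  qed (simp add: e_def)
  have "couniversal (opposite PA) (opposite PB) (opposite_functor ?r) G P e"
    unfolding couniversal_def opposite_sel opposite_functor_sel
  proof (intro conjI ballI G P e_ar)
    fix M \<tau> assume M: "M \<in> Ob PA" and t: "\<tau> \<in> Ar PB G (fob ?r M)"
    note rM = restriction_in[OF M]
    have Mt: "(M, \<tau>) \<in> Q" using M t by (simp add: Q_def)
    note t' = presheaf_arrowD[OF t G rM, simplified]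
    have M_N: "n (M, \<tau>) \<in> fob M X" if "X \<in> Ob A" "n \<in> N X" for n X
      using N_cases[OF that(2)] that(1) Mt tau_in[OF Mt] presheafD(3)[OF M] by (auto simp: ev inA)
    \<comment> \<open>The factorization of \<open>\<tau>\<close> decodes an element and takes its
      coordinate at \<open>(M, \<tau>)\<close>.\<close>
    define \<sigma> where "\<sigma> = (\<lambda>X\<in>Ob A. \<lambda>p\<in>fob P X. inv_into (N X) (i X) p (M, \<tau>))"
    have s_i: "\<sigma> X (i X n) = n (M, \<tau>)" if "X \<in> Ob A" "n \<in> N X" for X n
      using i[OF that(1)] that iN by (simp add: \<sigma>_def bij_betw_def)
    have s: "\<sigma> \<in> Ar PA P M" unfolding presheaf_arrow_iff[OF P M]
    proof (intro conjI ballI)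
      fix X assume X: "X \<in> Ob A"
      have "\<sigma> X p \<in> fob M X" if p: "p \<in> fob P X" for p
      proof -
        obtain n where "n \<in> N X" "p = i X n" using i[OF X] p by (auto simp: bij_betw_def)
        then show ?thesis using s_i M_N X by simp
      qed
      then show "\<sigma> X \<in> fob P X \<rightarrow>\<^sub>E fob M X" using X by (auto simp: \<sigma>_def)
    next
      fix X Y g p assume X: "X \<in> Ob A" "Y \<in> Ob A" "g \<in> Ar A X Y" "p \<in> fob P Y"
      obtain n where n: "n \<in> N Y" "p = i Y n" using i[OF X(2)] X(4) by (auto simp: bij_betw_def)
      then show "\<sigma> X (far P Y X g p) = far M Y X g (\<sigma> Y p)"
        using X Mt by (simp add: P_act s_i act_in) (simp add: act_def)
    qed (simp add: \<sigma>_def)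
    have "(\<lambda>b\<in>S. compose (fob G b) ((restrict h S) b) (e b)) = \<tau> \<longleftrightarrow>
        (\<forall>b\<in>S. \<forall>y\<in>fob G b. h b (e b y) = \<tau> b y)" for h
      using t'(1) t'(2) by (auto simp: restrict_def compose_def fun_eq_iff extensional_def PiE_def)
    then have iff: "Cmp PB G (fob ?r P) (fob ?r M) (far ?r P M h) e = \<tau> \<longleftrightarrow>
        (\<forall>b\<in>S. \<forall>y\<in>fob G b. h b (e b y) = \<tau> b y)" for h
      by (simp only: presheaf_cat_sel full_subcategory_sel restriction_sel(3))
    have se: "\<sigma> b (e b y) = \<tau> b y" if b: "b \<in> S" "y \<in> fob G b" for b y
      using b Mt tau_in[OF Mt b] by (simp add: e_def s_i N_in inA A.ident_in ev presheafD(4)[OF M])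
    show "\<exists>!h. h \<in> Ar PA P M \<and> Cmp PB G (fob ?r P) (fob ?r M) (far ?r P M h) e = \<tau>"
    proof (rule ex1I)
      show "\<sigma> \<in> Ar PA P M \<and> Cmp PB G (fob ?r P) (fob ?r M) (far ?r P M \<sigma>) e = \<tau>"
        using s iff se by blast
      fix h assume h0: "h \<in> Ar PA P M \<and> Cmp PB G (fob ?r P) (fob ?r M) (far ?r P M h) e = \<tau>"
      then have h: "h \<in> Ar PA P M" and he: "\<And>b y. b \<in> S \<Longrightarrow> y \<in> fob G b \<Longrightarrow> h b (e b y) = \<tau> b y"
        using iff by blast+
      show "h = \<sigma>"
      proof (rule presheaf_arrow_eqI[OF h s P M])
        fix X p assume X: "X \<in> Ob A" "p \<in> fob P X"
        then obtain b f y where b: "b \<in> S" "f \<in> Ar A X b" "y \<in> fob G b" "p = i X (ev X (b, f, y))"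
          using PE by blast
        \<comment> \<open>\<open>P\<close> is generated by the image of \<open>e\<close> under the
          action of arrows, so a natural map out of \<open>P\<close> is determined by its composite
          with \<open>e\<close>.\<close>
        have p: "p = far P b X f (e b y)" using b X e_far by simp
        show "h X p = \<sigma> X p" unfolding p
          using presheaf_arrowD(4)[OF h P M X(1) inA[OF b(1)] b(2) e_in[OF b(1,3)]]
            presheaf_arrowD(4)[OF s P M X(1) inA[OF b(1)] b(2) e_in[OF b(1,3)]] he se b by simp
      qed
    qed
  qed
  then show "\<exists>P e. couniversal (opposite PA) (opposite PB) (opposite_functor ?r) G P e" by blast
qed

text \<open>An equality and not merely an isomorphism, thanks to the \<open>undefined\<close> values
  outside the domains. Hence the inverse image of the composite with \<open>p\<close> is literally
  the constant presheaf functor of \<open>B\<close>.\<close>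

lemma restriction_constant_presheaf: "restriction B \<circ>\<^sub>F constant_presheaf A = constant_presheaf B"
  by (rule fctr_eqI) (use S in \<open>auto simp: restriction_def constant_presheaf_def restrict_functor_def
    restrict_def fun_eq_iff subset_iff intro!: fctr_eqI\<close>)

text \<open>The categorical core, free of algebra: \<open>c\<close> is terminal in \<open>A\<close>,
  and initial with respect to the objects of \<open>S\<close>, hence a zero object of the
  subcategory.\<close>

theorem essential_subquality_of_zero_object:
  assumes c: "c \<in> S" "terminal_object A c" and init: "\<And>b. b \<in> S \<Longrightarrow> \<exists>!f. f \<in> Ar A c b"
  shows "\<exists>p. canonical_geom \<U> A p" and "\<exists>j. induced_geom \<U> B A j"
    and "canonical_geom \<U> A p \<Longrightarrow> induced_geom \<U> B A j \<Longrightarrow>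
      essential_subquality PB PA (set_cat \<U>) p j"
proof -
  let ?S = "set_cat \<U>" and ?K = "constant_presheaf B"
  have cB: "terminal_object B c" using c by (auto simp: terminal_object_def inA)
  obtain \<eta>K \<epsilon>K where K: "adjunction ?S PA (constant_presheaf A) (evaluation c) \<eta>K \<epsilon>K"
    using constant_presheaf_adjunction[OF A.category_axioms c(2)] by blast
  then have "geometric_morphism PA ?S
      \<lparr>inv_img = constant_presheaf A, dir_img = evaluation c, gm_unit = \<eta>K, gm_counit = \<epsilon>K\<rparr>"
    using left_exact_constant_presheaf[OF A.category_axioms] by (simp add: geometric_morphism_def)
  then show "\<exists>p. canonical_geom \<U> A p" by (force simp: canonical_geom_def)
  obtain Ran \<eta>R \<epsilon>R where R: "adjunction PA PB (restriction B) Ran \<eta>R \<epsilon>R"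
    and R_iso: "\<And>Y. Y \<in> Ob PB \<Longrightarrow> iso_arrow PB (fob (restriction B) (fob Ran Y)) Y (\<epsilon>R Y)"
    using restriction_right_adjoint by blast
  obtain Lan \<eta>L \<epsilon>L where L: "adjunction PB PA Lan (restriction B) \<eta>L \<epsilon>L"
    using restriction_left_adjoint by blast
  have "geometric_morphism PB PA
      \<lparr>inv_img = restriction B, dir_img = Ran, gm_unit = \<eta>R, gm_counit = \<epsilon>R\<rparr>"
    using R right_adjoint_left_exact[OF L] by (simp add: geometric_morphism_def)
  then show "\<exists>j. induced_geom \<U> B A j" by (force simp: induced_geom_def)
  assume p: "canonical_geom \<U> A p" and j: "induced_geom \<U> B A j"
  have pg: "geometric_morphism PA ?S p" and pK: "inv_img p = constant_presheaf A"
    using p by (simp_all add: canonical_geom_def)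
  have jg: "geometric_morphism PB PA j" and jr: "inv_img j = restriction B"
    using j by (simp_all add: induced_geom_def)
  have p_adj: "adjunction ?S PA (constant_presheaf A) (dir_img p) (gm_unit p) (gm_counit p)"
    using pg pK by (simp add: geometric_morphism_def)
  have j_adj: "adjunction PA PB (restriction B) (dir_img j) (gm_unit j) (gm_counit j)"
    using jg jr by (simp add: geometric_morphism_def)
  have j_ff: "full_and_faithful PB PA (dir_img j)"
    by (rule full_and_faithful_of_counit_iso[OF j_adj counit_iso_transfer[OF R j_adj R_iso]])
  have "\<exists>\<eta>. adjunction PB ?S (evaluation c) ?K \<eta> (\<lambda>T. \<lambda>x\<in>T. x)"
    by (rule evaluation_adjunction[OF category_B]) (use c init in simp_all)
  then obtain \<eta>E where E: "adjunction PB ?S (evaluation c) ?K \<eta>E (\<lambda>T. \<lambda>x\<in>T. x)" by blast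
  have id_iso: "iso_arrow ?S T T (\<lambda>x\<in>T. x)" if "T \<in> \<U>" for T
    using category.iso_arrow_ident[OF category_set_cat, of T \<U>] that by simp
  have K_fun: "cat_functor ?S PB ?K" by (rule cat_functor_constant_presheaf[OF category_B])
  have K_ff: "full_and_faithful ?S PB ?K"
    by (rule full_and_faithful_of_counit_iso[OF E]) (use id_iso c in simp)
  \<comment> \<open>The right adjoint of \<open>dir_img p\<close> is chosen as a composite with
    \<open>dir_img j\<close>, so its factorization through \<open>j\<close> needs only identity
    isomorphisms. It is full and faithful because both factors are.\<close>
  let ?N = "dir_img j \<circ>\<^sub>F ?K"
  have N_ff: "full_and_faithful ?S PA ?N" by (rule full_and_faithful_comp[OF K_fun K_ff j_ff])
  have ev: "evaluation c \<circ>\<^sub>F restriction B = (evaluation c :: (('o, 'a, 'u) psh, _, _, _) fctr)"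
    by (rule fctr_eqI) (use c in simp_all)
  have ev_adj: "\<exists>\<eta> \<epsilon>. adjunction PA ?S (evaluation c) ?N \<eta> \<epsilon>"
    using adjunction_comp[OF j_adj E] unfolding ev by blast
  have "\<exists>\<theta>. nat_iso PA ?S (dir_img p) (evaluation c) \<theta>"
    using right_adjoint_unique[OF p_adj K] by blast
  \<comment> \<open>Evaluation at \<open>c\<close> on \<open>A\<close> is restriction followed by
    evaluation on \<open>B\<close>, so \<open>?N\<close> is right adjoint to it; the isomorphism
    \<open>dir_img p\<close> to \<open>evaluation c\<close> moves the adjunction to
    \<open>p\<close>.\<close>
  then obtain \<eta>N \<epsilon>N where N_adj: "adjunction PA ?S (dir_img p) ?N \<eta>N \<epsilon>N"
    using ev_adj left_adjoint_transfer[OF _ adjunctionD(2)[OF p_adj]] by blast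
  have "local_data PA ?S p ?N \<eta>N \<epsilon>N"
    using pg N_adj N_ff by (simp add: local_data_def)
  moreover have "above PB ?S PA j (centre p ?N \<eta>N \<epsilon>N)"
  proof -
    have N_fun: "cat_functor ?S PA ?N" using N_adj by (rule adjunctionD)
    interpret N: cat_functor ?S PA ?N by (rule N_fun)
    have "nat_iso ?S PA ?N ?N (\<lambda>T. Ident PA (fob ?N T))"
      unfolding nat_iso_def nat_trans_def
      by (intro conjI ballI N.B.iso_arrow_ident N.B.ident_in)
        (simp_all only: N.B.cmp_ident_left N.B.cmp_ident_right N.fob_in N.far_in)
    then show ?thesis using K_fun by (auto simp: above_def centre_def)
  qed
  moreover have "quality_type PB ?S (comp_geom PB ?S p j)"
  proof -
    let ?q = "comp_geom PB ?S p j"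
    have qg: "geometric_morphism PB ?S ?q" by (rule geometric_morphism_comp[OF jg pg])
    have qK: "inv_img ?q = ?K" by (simp add: comp_geom_def jr pK restriction_constant_presheaf)
    have q_adj: "adjunction ?S PB ?K (dir_img ?q) (gm_unit ?q) (gm_counit ?q)"
      using qg qK by (simp add: geometric_morphism_def)
    obtain \<eta> \<epsilon> where KB: "adjunction ?S PB ?K (evaluation c) \<eta> \<epsilon>"
      using constant_presheaf_adjunction[OF category_B cB] by blast
    obtain \<theta> where t: "nat_iso PB ?S (dir_img ?q) (evaluation c) \<theta>"
      using right_adjoint_unique[OF q_adj KB] by blast
    let ?e = "\<lambda>T. Cmp ?S (fob (dir_img ?q) (fob ?K T)) (fob (evaluation c) (fob ?K T)) T (\<lambda>x\<in>T. x) (\<theta> (fob ?K T))"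
    obtain \<eta>' where adj': "adjunction PB ?S (dir_img ?q) ?K \<eta>' ?e"
      using left_adjoint_transfer[OF E adjunctionD(2)[OF q_adj] t] by blast
    interpret q: cat_functor PB ?S "dir_img ?q" using q_adj by (rule adjunctionD)
    have e_iso: "iso_arrow ?S (fob (dir_img ?q) (fob ?K T)) T (?e T)" if T: "T \<in> Ob ?S" for T
    proof (rule q.B.iso_arrow_cmp)
      have KT: "fob ?K T \<in> Ob PB" using constant_presheaf_in[OF category_B] T by simp
      then show "iso_arrow ?S (fob (dir_img ?q) (fob ?K T)) (fob (evaluation c) (fob ?K T)) (\<theta> (fob ?K T))"
        using t by (simp only: nat_iso_def)
      show "fob (dir_img ?q) (fob ?K T) \<in> Ob ?S" by (rule q.fob_in[OF KT])
      show "iso_arrow ?S (fob (evaluation c) (fob ?K T)) T (\<lambda>x\<in>T. x)" using id_iso T c by simp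
    qed (use T c in simp_all)
    have "local_data PB ?S ?q ?K \<eta>' ?e"
      using qg adj' K_ff unfolding local_data_def by blast
    \<comment> \<open>The right adjoint has been taken equal to the inverse image \<open>?K\<close>,
      which is the situation treated by \<open>canonical_transf_iso\<close>.\<close>
    moreover have "nat_iso ?S PB (inv_img ?q) ?K (canonical_transf PB ?S ?q ?K \<eta>')"
      using canonical_transf_iso[of ?S PB ?q \<eta>' ?e] q_adj adj' e_iso unfolding qK by blast
    ultimately show ?thesis unfolding quality_type_def by blast
  qed
  ultimately have "subquality PB PA ?S p j"
    using jg j_ff unfolding subquality_def subtopos_def by blast
  moreover have "essential PB PA j" using jg L unfolding essential_def jr by blast
  ultimately show "essential_subquality PB PA ?S p j" by (simp add: essential_subquality_def)
qed

end


section \<open>Complex algebras\<close>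

lemma complex_field_sel [simp]: "carrier complex_field = UNIV" "x \<otimes>\<^bsub>complex_field\<^esub> y = x * y"
  "x \<oplus>\<^bsub>complex_field\<^esub> y = x + y" "\<one>\<^bsub>complex_field\<^esub> = 1" "\<zero>\<^bsub>complex_field\<^esub> = 0"
  by (simp_all add: complex_field_def)

lemma field_complex_field: "field complex_field"
proof -
  have "cring complex_field"
  proof (rule cringI)
    show "abelian_group complex_field"
      by (rule abelian_groupI) (auto intro: exI[of _ "- x" for x])
    show "Group.comm_monoid complex_field" by (rule comm_monoidI) auto
  qed (simp add: algebra_simps)
  then show ?thesis
    by (rule cring.cring_fieldI) (force simp: Units_def dvd_def field_simps intro: exI[of _ "1 / x" for x])
qed

locale complex_algebra = algebra complex_field A for A :: "(complex, 'u) module" (structure)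
begin

lemma smult_in: "x \<in> carrier A \<Longrightarrow> c \<odot> x \<in> carrier A"
  by simp

lemma smult_add_left: "x \<in> carrier A \<Longrightarrow> (c + d) \<odot> x = c \<odot> x \<oplus> d \<odot> x"
  using smult_l_distr[of c d x] by simp

lemma smult_mult: "x \<in> carrier A \<Longrightarrow> (c * d) \<odot> x = c \<odot> (d \<odot> x)"
  using smult_assoc1[of c d x] by simp

lemma smult_1: "x \<in> carrier A \<Longrightarrow> 1 \<odot> x = x"
  using smult_one[of x] by simp

lemma smult_0: "x \<in> carrier A \<Longrightarrow> 0 \<odot> x = \<zero>"
  using smult_l_null[of x] by simp

lemma smult_otimes: "x \<in> carrier A \<Longrightarrow> y \<in> carrier A \<Longrightarrow> (c \<odot> x) \<otimes> y = c \<odot> (x \<otimes> y)"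
  by (simp add: smult_assoc2)

lemma otimes_smult: "x \<in> carrier A \<Longrightarrow> y \<in> carrier A \<Longrightarrow> x \<otimes> (c \<odot> y) = c \<odot> (x \<otimes> y)"
  using smult_otimes[of y x c] by (simp add: m_comm)

lemma smult_one_otimes: "x \<in> carrier A \<Longrightarrow> (c \<odot> \<one>) \<otimes> x = c \<odot> x"
  by (simp add: smult_otimes)

end

lemma algebra_homI:
  assumes "h \<in> extensional (carrier A)" "\<And>x. x \<in> carrier A \<Longrightarrow> h x \<in> carrier B"
    "\<And>x y. x \<in> carrier A \<Longrightarrow> y \<in> carrier A \<Longrightarrow> h (x \<otimes>\<^bsub>A\<^esub> y) = h x \<otimes>\<^bsub>B\<^esub> h y"
    "\<And>x y. x \<in> carrier A \<Longrightarrow> y \<in> carrier A \<Longrightarrow> h (x \<oplus>\<^bsub>A\<^esub> y) = h x \<oplus>\<^bsub>B\<^esub> h y"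
    "h \<one>\<^bsub>A\<^esub> = \<one>\<^bsub>B\<^esub>" "\<And>c x. x \<in> carrier A \<Longrightarrow> h (c \<odot>\<^bsub>A\<^esub> x) = c \<odot>\<^bsub>B\<^esub> h x"
  shows "h \<in> algebra_hom complex_field A B"
  using assms by (auto simp: algebra_hom_def intro!: ring_hom_memI)

lemma algebra_homD:
  assumes "h \<in> algebra_hom complex_field A B"
  shows "h \<in> extensional (carrier A)" "\<And>x. x \<in> carrier A \<Longrightarrow> h x \<in> carrier B"
    "\<And>x y. x \<in> carrier A \<Longrightarrow> y \<in> carrier A \<Longrightarrow> h (x \<otimes>\<^bsub>A\<^esub> y) = h x \<otimes>\<^bsub>B\<^esub> h y"
    "\<And>x y. x \<in> carrier A \<Longrightarrow> y \<in> carrier A \<Longrightarrow> h (x \<oplus>\<^bsub>A\<^esub> y) = h x \<oplus>\<^bsub>B\<^esub> h y"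
    "h \<one>\<^bsub>A\<^esub> = \<one>\<^bsub>B\<^esub>" "\<And>c x. x \<in> carrier A \<Longrightarrow> h (c \<odot>\<^bsub>A\<^esub> x) = c \<odot>\<^bsub>B\<^esub> h x"
  using assms by (auto simp: algebra_hom_def dest: ring_hom_memE)

lemma fg_indec_algebras_sel [simp]:
  "Ob fg_indec_algebras = {A. fg_algebra complex_field A \<and> indecomposable A}"
  "Ar fg_indec_algebras = algebra_hom complex_field"
  "Cmp fg_indec_algebras A B C g f = compose (carrier A) g f"
  "Ident fg_indec_algebras A = (\<lambda>x\<in>carrier A. x)"
  by (simp_all add: fg_indec_algebras_def)

lemma fg_algebra_complex_algebra: "fg_algebra complex_field A \<Longrightarrow> complex_algebra A"
  by (simp add: fg_algebra_def complex_algebra_def)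

lemma category_fg_indec_algebras: "category fg_indec_algebras"
proof
  fix A :: "(complex, 'u) module"
  assume "A \<in> Ob fg_indec_algebras"
  then interpret complex_algebra A by (simp add: fg_algebra_complex_algebra)
  show "Ident fg_indec_algebras A \<in> Ar fg_indec_algebras A A"
    by (auto intro!: algebra_homI)
next
  fix A B C :: "(complex, 'u) module" and f g
  assume "A \<in> Ob fg_indec_algebras" and f: "f \<in> Ar fg_indec_algebras A B" and g: "g \<in> Ar fg_indec_algebras B C"
  then interpret complex_algebra A by (simp add: fg_algebra_complex_algebra)
  note f = algebra_homD[OF f[simplified]] and g = algebra_homD[OF g[simplified]]
  show "Cmp fg_indec_algebras A B C g f \<in> Ar fg_indec_algebras A C"
    using f g by (auto intro!: algebra_homI simp: compose_def)
next
  fix A B :: "(complex, 'u) module" and f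
  assume f: "f \<in> Ar fg_indec_algebras A B"
  note f = algebra_homD[OF f[simplified]]
  show "Cmp fg_indec_algebras A B B (Ident fg_indec_algebras B) f = f"
    "Cmp fg_indec_algebras A A B f (Ident fg_indec_algebras A) = f"
    using f(1,2) by (auto simp: compose_def restrict_def extensional_def fun_eq_iff)
next
  fix A B C D :: "(complex, 'u) module" and f g h
  assume f: "f \<in> Ar fg_indec_algebras A B"
  note f = algebra_homD[OF f[simplified]]
  show "Cmp fg_indec_algebras A C D h (Cmp fg_indec_algebras A B C g f) =
      Cmp fg_indec_algebras A B D (Cmp fg_indec_algebras B C D h g) f"
    using f(2) by (auto simp: compose_def restrict_def fun_eq_iff)
qed

subsection \<open>Cardinality bounds\<close>

lemma lists_complex_lepoll: "(UNIV :: complex list set) \<lesssim> (UNIV :: complex set)"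
proof -
  obtain e :: "complex \<times> complex \<Rightarrow> complex" where e: "inj e"
    using complex_times_complex_lepoll by (auto simp: lepoll_def)
  \<comment> \<open>Iterated pairing; the tags 0 and 1 separate the empty list from a nonempty
    one.\<close>
  define enc where "enc = rec_list (e (0, 0)) (\<lambda>x _ r. e (1, e (x, r)))"
  have enc: "enc [] = e (0, 0)" "enc (x # xs) = e (1, e (x, enc xs))" for x xs
    by (simp_all add: enc_def)
  have "enc xs = enc ys \<Longrightarrow> xs = ys" for xs ys
  proof (induction xs arbitrary: ys)
    case Nil then show ?case by (cases ys) (auto simp: enc inj_eq[OF e])
  next
    case (Cons x xs) then show ?case by (cases ys) (auto simp: enc inj_eq[OF e])
  qed
  then show ?thesis by (auto simp: lepoll_def inj_def)
qed

lemma lists_lepoll_complex: "X \<lesssim> (UNIV :: complex set) \<Longrightarrow> lists X \<lesssim> (UNIV :: complex set)"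
  using lists_lepoll_mono[of X "UNIV :: complex set"] lists_complex_lepoll lepoll_trans by (metis lists_UNIV)

text \<open>Names for elements of a generated subring, one constructor per rule of
  \<open>generate_ring\<close>. The subring is an image of the set of terms, and terms over complex
  generators are coded by complex numbers with a tag for each constructor.\<close>

datatype 'g ring_term = One | Gen 'g | Neg "'g ring_term"
  | Add "'g ring_term" "'g ring_term" | Mul "'g ring_term" "'g ring_term"

primrec ring_term_value :: "('u, 'm) ring_scheme \<Rightarrow> ('g \<Rightarrow> 'u) \<Rightarrow> 'g ring_term \<Rightarrow> 'u" where
  "ring_term_value A v One = \<one>\<^bsub>A\<^esub>"
| "ring_term_value A v (Gen g) = v g"
| "ring_term_value A v (Neg t) = \<ominus>\<^bsub>A\<^esub> ring_term_value A v t"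
| "ring_term_value A v (Add s t) = ring_term_value A v s \<oplus>\<^bsub>A\<^esub> ring_term_value A v t"
| "ring_term_value A v (Mul s t) = ring_term_value A v s \<otimes>\<^bsub>A\<^esub> ring_term_value A v t"

primrec ring_term_code :: "(complex \<times> complex \<Rightarrow> complex) \<Rightarrow> complex ring_term \<Rightarrow> complex" where
  "ring_term_code e One = e (0, 0)"
| "ring_term_code e (Gen g) = e (1, g)"
| "ring_term_code e (Neg t) = e (2, ring_term_code e t)"
| "ring_term_code e (Add s t) = e (3, e (ring_term_code e s, ring_term_code e t))"
| "ring_term_code e (Mul s t) = e (4, e (ring_term_code e s, ring_term_code e t))"

lemma generate_ring_lepoll_complex:
  assumes "H \<lesssim> (UNIV :: complex set)"
  shows "generate_ring A H \<lesssim> (UNIV :: complex set)"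
proof -
  obtain e :: "complex \<times> complex \<Rightarrow> complex" where e: "inj e"
    using complex_times_complex_lepoll by (auto simp: lepoll_def)
  have "ring_term_code e s = ring_term_code e t \<Longrightarrow> s = t" for s t
  proof (induction s arbitrary: t)
    case One then show ?case by (cases t) (auto simp: inj_eq[OF e])
  next
    case (Gen g) then show ?case by (cases t) (auto simp: inj_eq[OF e])
  next
    case (Neg s) then show ?case by (cases t) (auto simp: inj_eq[OF e])
  next
    case (Add s1 s2) then show ?case by (cases t) (auto simp: inj_eq[OF e])
  next
    case (Mul s1 s2) then show ?case by (cases t) (auto simp: inj_eq[OF e])
  qed
  then have terms: "(UNIV :: complex ring_term set) \<lesssim> (UNIV :: complex set)"
    by (auto simp: lepoll_def inj_def)
  obtain v where v: "H \<subseteq> v ` (UNIV :: complex set)" using assms by (auto simp: lepoll_iff)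
  have "x \<in> range (ring_term_value A v)" if "x \<in> generate_ring A H" for x
    using that
  proof induction
    case one then show ?case by (rule range_eqI[of _ _ One]) simp
  next
    case (incl h)
    then obtain z where "h = v z" using v by blast
    then show ?case by (intro range_eqI[of _ _ "Gen z"]) simp
  next
    case (a_inv h)
    then obtain t where "h = ring_term_value A v t" by blast
    then show ?case by (intro range_eqI[of _ _ "Neg t"]) simp
  next
    case (eng_add h1 h2)
    then obtain s t where "h1 = ring_term_value A v s" "h2 = ring_term_value A v t" by blast
    then show ?case by (intro range_eqI[of _ _ "Add s t"]) simp
  next
    case (eng_mult h1 h2)
    then obtain s t where "h1 = ring_term_value A v s" "h2 = ring_term_value A v t" by blast
    then show ?case by (intro range_eqI[of _ _ "Mul s t"]) simp
  qed
  then have "generate_ring A H \<lesssim> (UNIV :: complex ring_term set)"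
    by (intro subset_image_lepoll) blast
  then show ?thesis using terms lepoll_trans by blast
qed

lemma fg_algebra_lepoll_complex:
  assumes "fg_algebra complex_field A"
  shows "carrier A \<lesssim> (UNIV :: complex set)"
proof -
  obtain T where T: "finite T"
    "generate_ring A (T \<union> range (\<lambda>c. c \<odot>\<^bsub>A\<^esub> \<one>\<^bsub>A\<^esub>)) = carrier A"
    using assms by (auto simp: fg_algebra_def)
  have inf: "infinite (UNIV :: complex set)" by (rule infinite_UNIV_char_0)
  have "T \<union> range (\<lambda>c. c \<odot>\<^bsub>A\<^esub> \<one>\<^bsub>A\<^esub>) \<lesssim> (UNIV :: complex set)"
  proof -
    obtain g :: "complex \<Rightarrow> 'a" where "T \<subseteq> range g"
      using finite_lepoll_infinite[OF inf T(1)] by (auto simp: lepoll_iff)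
    \<comment> \<open>One map enumerates both kinds of generators: first coordinate 0 selects
      \<open>T\<close>, any other value the scalars.\<close>
    have "c \<odot>\<^bsub>A\<^esub> \<one>\<^bsub>A\<^esub> \<in> (\<lambda>(b :: complex, c). if b = 0 then g c else c \<odot>\<^bsub>A\<^esub> \<one>\<^bsub>A\<^esub>) ` (UNIV \<times> UNIV)" for c
      by (rule image_eqI[of _ _ "(1, c)"]) auto
    moreover have "g z \<in> (\<lambda>(b :: complex, c). if b = 0 then g c else c \<odot>\<^bsub>A\<^esub> \<one>\<^bsub>A\<^esub>) ` (UNIV \<times> UNIV)" for z
      by (rule image_eqI[of _ _ "(0, z)"]) auto
    ultimately have "T \<union> range (\<lambda>c. c \<odot>\<^bsub>A\<^esub> \<one>\<^bsub>A\<^esub>) \<subseteq>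
        (\<lambda>(b, c). if b = 0 then g c else c \<odot>\<^bsub>A\<^esub> \<one>\<^bsub>A\<^esub>) ` ((UNIV :: complex set) \<times> (UNIV :: complex set))"
      using \<open>T \<subseteq> range g\<close> by blast
    from subset_image_lepoll[OF this] show ?thesis
      using complex_times_complex_lepoll lepoll_trans by blast
  qed
  from generate_ring_lepoll_complex[OF this, of A] T(2) show ?thesis by simp
qed

text \<open>A homomorphism is determined by the list of its values on finitely many generators, the
  scalars being fixed by linearity; so the hom-set embeds into lists over
  \<open>carrier B\<close>.\<close>

lemma algebra_hom_lepoll_complex:
  assumes A: "fg_algebra complex_field A" and B: "fg_algebra complex_field B"
  shows "algebra_hom complex_field A B \<lesssim> (UNIV :: complex set)"
proof -
  interpret A: complex_algebra A using A by (rule fg_algebra_complex_algebra)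
  interpret B: complex_algebra B using B by (rule fg_algebra_complex_algebra)
  obtain T where T: "finite T" "T \<subseteq> carrier A"
    "generate_ring A (T \<union> range (\<lambda>c. c \<odot>\<^bsub>A\<^esub> \<one>\<^bsub>A\<^esub>)) = carrier A"
    using A by (auto simp: fg_algebra_def)
  obtain xs where xs: "set xs = T" using T(1) finite_list by blast
  have "inj_on (\<lambda>h. map h xs) (algebra_hom complex_field A B)"
  proof (rule inj_onI)
    fix h k assume h: "h \<in> algebra_hom complex_field A B" and k: "k \<in> algebra_hom complex_field A B"
      and eq: "map h xs = map k xs"
    note hD = algebra_homD[OF h] and kD = algebra_homD[OF k]
    interpret h: ring_hom_cring A B h
      using h by (auto simp: algebra_hom_def ring_hom_cring_def ring_hom_cring_axioms_def A.M_cring B.M_cring)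
    interpret k: ring_hom_cring A B k
      using k by (auto simp: algebra_hom_def ring_hom_cring_def ring_hom_cring_axioms_def A.M_cring B.M_cring)
    have H: "T \<union> range (\<lambda>c. c \<odot>\<^bsub>A\<^esub> \<one>\<^bsub>A\<^esub>) \<subseteq> carrier A" using T(2) by auto
    have "x \<in> carrier A \<and> h x = k x" if "x \<in> generate_ring A (T \<union> range (\<lambda>c. c \<odot>\<^bsub>A\<^esub> \<one>\<^bsub>A\<^esub>))" for x
      using that
    proof induction
      case (incl x)
      then show ?case using eq xs H hD(5,6) kD(5,6) by auto
    qed auto
    then have "h x = k x" if "x \<in> carrier A" for x using that T(3) by simp
    then show "h = k" using hD(1) kD(1) by (intro extensionalityI[of h "carrier A" k]) auto
  qed
  moreover have "map h xs \<in> lists (carrier B)" if "h \<in> algebra_hom complex_field A B" for h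
    using algebra_homD(2)[OF that] xs T(2) by (auto simp: subset_iff)
  ultimately have "algebra_hom complex_field A B \<lesssim> lists (carrier B)"
    unfolding lepoll_def by blast
  then show ?thesis using lists_lepoll_complex[OF fg_algebra_lepoll_complex[OF B]] lepoll_trans by blast
qed

subsection \<open>Weil algebras\<close>

lemma weil_algebra_complex_algebra: "weil_algebra complex_field A \<Longrightarrow> complex_algebra A"
  by (simp add: weil_algebra_def complex_algebra_def)

text \<open>\<open>\<chi>\<close> is the quotient map to the residue field followed by the inverse
  of the structure isomorphism. Its kernel lies in the nilpotent maximal ideal. Later arguments use
  only \<open>\<chi>\<close> and never the ideal.\<close>

lemma weil_algebra_augmentation:
  assumes "weil_algebra complex_field A"
  obtains \<chi> where "\<chi> \<in> ring_hom A complex_field" "\<And>c. \<chi> (c \<odot>\<^bsub>A\<^esub> \<one>\<^bsub>A\<^esub>) = c"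
    "\<And>x. x \<in> carrier A \<Longrightarrow> \<chi> x = 0 \<Longrightarrow> \<exists>n. x [^]\<^bsub>A\<^esub> (n :: nat) = \<zero>\<^bsub>A\<^esub>"
proof -
  interpret complex_algebra A using assms by (rule weil_algebra_complex_algebra)
  obtain \<mm> n where max: "maximalideal \<mm> A"
    and iso: "(\<lambda>c. \<mm> +>\<^bsub>A\<^esub> (c \<odot>\<^bsub>A\<^esub> \<one>\<^bsub>A\<^esub>)) \<in> ring_iso complex_field (A Quot \<mm>)"
    and nil: "ideal_power A \<mm> n = {\<zero>\<^bsub>A\<^esub>}"
    using assms by (auto simp: weil_algebra_def)
  interpret \<mm>: ideal \<mm> A using max by (rule maximalideal.axioms)
  define \<phi> where "\<phi> = (\<lambda>c. \<mm> +>\<^bsub>A\<^esub> (c \<odot>\<^bsub>A\<^esub> \<one>\<^bsub>A\<^esub>))"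
  have bij: "bij_betw \<phi> UNIV (carrier (A Quot \<mm>))" and phi: "\<phi> \<in> ring_hom complex_field (A Quot \<mm>)"
    using iso by (simp_all add: ring_iso_def \<phi>_def)
  define \<chi> where "\<chi> x = the_inv \<phi> (\<mm> +>\<^bsub>A\<^esub> x)" for x
  note r = ring_hom_memE[OF \<mm>.rcos_ring_hom]
  have \<phi>\<chi>: "\<phi> (\<chi> x) = \<mm> +>\<^bsub>A\<^esub> x" if "x \<in> carrier A" for x
    using bij r(1)[OF that] by (simp add: \<chi>_def bij_betw_def f_the_inv_into_f)
  have \<phi>_eq: "c = d" if "\<phi> c = \<phi> d" for c d using bij that by (auto simp: bij_betw_def dest: injD)
  have scal: "\<chi> (c \<odot>\<^bsub>A\<^esub> \<one>\<^bsub>A\<^esub>) = c" for c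
    by (rule \<phi>_eq) (simp add: \<phi>\<chi>, simp add: \<phi>_def)
  have hom: "\<chi> \<in> ring_hom A complex_field"
  proof (rule ring_hom_memI)
    show "\<chi> (x \<otimes>\<^bsub>A\<^esub> y) = \<chi> x \<otimes>\<^bsub>complex_field\<^esub> \<chi> y" "\<chi> (x \<oplus>\<^bsub>A\<^esub> y) = \<chi> x \<oplus>\<^bsub>complex_field\<^esub> \<chi> y"
      if "x \<in> carrier A" "y \<in> carrier A" for x y
      by (rule \<phi>_eq; use that ring_hom_memE(2,3)[OF phi, of "\<chi> x" "\<chi> y"] in \<open>simp add: \<phi>\<chi> r\<close>)+
    show "\<chi> \<one>\<^bsub>A\<^esub> = \<one>\<^bsub>complex_field\<^esub>" using scal[of 1] by (simp add: smult_1)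
  qed simp
  have "x [^]\<^bsub>A\<^esub> n = \<zero>\<^bsub>A\<^esub>" if x: "x \<in> carrier A" "\<chi> x = 0" for x
  proof -
    have "\<mm> +>\<^bsub>A\<^esub> x = \<mm>" using \<phi>\<chi>[OF x(1)] x(2) a_rcos_zero[OF \<mm>.ideal_axioms \<mm>.zero_closed]
      by (simp add: \<phi>_def smult_0)
    then have xm: "x \<in> \<mm>" using x(1) by (rule_tac \<mm>.rcos_const_imp_mem)
    \<comment> \<open>Powers of an element of the ideal lie in the powers of the ideal, so the
      exponent killing the ideal kills the element.\<close>
    have "x [^]\<^bsub>A\<^esub> k \<in> ideal_power A \<mm> k" for k :: nat
    proof (induction k)
      case (Suc k)
      then show ?case using xm x(1) ideal_prod.prod[of x \<mm> "x [^]\<^bsub>A\<^esub> k" "ideal_power A \<mm> k" A]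
        by (simp add: m_comm)
    qed simp
    then show ?thesis using nil by blast
  qed
  then show ?thesis using that[OF hom scal] by blast
qed

text \<open>Module generators generate the algebra too: a scalar multiple \<open>c \<odot> s\<close>
  is the product of the scalar \<open>c \<odot> \<one>\<close> and \<open>s\<close>, and sums of
  such products stay in the subring.\<close>

lemma fg_algebra_of_fg_module:
  assumes A: "algebra complex_field A" and fg: "fg_module complex_field A"
  shows "fg_algebra complex_field A"
proof -
  interpret complex_algebra A using A by (simp add: complex_algebra_def)
  obtain T where T: "finite T" "T \<subseteq> carrier A"
    "\<And>x. x \<in> carrier A \<Longrightarrow> \<exists>c. x = (\<Oplus>\<^bsub>A\<^esub>s\<in>T. c s \<odot>\<^bsub>A\<^esub> s)"
    using fg by (auto simp: fg_module_def)
  let ?H = "T \<union> range (\<lambda>c. c \<odot>\<^bsub>A\<^esub> \<one>\<^bsub>A\<^esub>)"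
  have H: "?H \<subseteq> carrier A" using T(2) by auto
  have "(\<Oplus>\<^bsub>A\<^esub>s\<in>T'. c s \<odot>\<^bsub>A\<^esub> s) \<in> generate_ring A ?H" if "finite T'" "T' \<subseteq> T" for c and T'
    using that
  proof (induction T' rule: finite_induct)
    case empty
    show ?case using zero_in_generate by simp
  next
    case (insert s T')
    have s: "s \<in> carrier A" using insert T(2) by auto
    have "(c s \<odot>\<^bsub>A\<^esub> \<one>\<^bsub>A\<^esub>) \<otimes>\<^bsub>A\<^esub> s \<in> generate_ring A ?H"
      using insert by (intro generate_ring.eng_mult generate_ring.incl) auto
    then have "c s \<odot>\<^bsub>A\<^esub> s \<in> generate_ring A ?H" using s by (simp add: smult_one_otimes)
    moreover have "(\<Oplus>\<^bsub>A\<^esub>s\<in>insert s T'. c s \<odot>\<^bsub>A\<^esub> s) = c s \<odot>\<^bsub>A\<^esub> s \<oplus>\<^bsub>A\<^esub> (\<Oplus>\<^bsub>A\<^esub>s\<in>T'. c s \<odot>\<^bsub>A\<^esub> s)"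
      using insert T(2) by (intro M.finsum_insert) auto
    ultimately show ?case using insert by (auto intro: generate_ring.eng_add)
  qed
  from this[OF T(1) order_refl] have "carrier A \<subseteq> generate_ring A ?H" using T(3) by blast
  then have "generate_ring A ?H = carrier A" using generate_ring_incl[OF H] by blast
  then show ?thesis using A T by (auto simp: fg_algebra_def)
qed

text \<open>The augmentation sends an idempotent to 0 or 1. If to 0, the idempotent is nilpotent and
  so zero; if to 1, the same applies to its complement.\<close>

lemma weil_algebra_indecomposable:
  assumes A: "weil_algebra complex_field A"
  shows "indecomposable A"
proof -
  interpret complex_algebra A using A by (rule weil_algebra_complex_algebra)
  obtain \<chi> where hom: "\<chi> \<in> ring_hom A complex_field"
    and nil: "\<And>x. x \<in> carrier A \<Longrightarrow> \<chi> x = 0 \<Longrightarrow> \<exists>n. x [^]\<^bsub>A\<^esub> (n :: nat) = \<zero>\<^bsub>A\<^esub>"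
    using weil_algebra_augmentation[OF A] by blast
  note h = ring_hom_memE[OF hom]
  have h0: "\<chi> \<zero>\<^bsub>A\<^esub> = 0"
    using ring_hom_zero[OF hom cring.axioms(1)[OF M_cring] cring.axioms(1)[OF R_cring]] by simp
  \<comment> \<open>An idempotent equals all its positive powers; multiplying the vanishing power
    once more by \<open>e\<close> also covers the exponent 0.\<close>
  have ker: "e = \<zero>\<^bsub>A\<^esub>" if e: "e \<in> carrier A" "e \<otimes>\<^bsub>A\<^esub> e = e" "\<chi> e = 0" for e
  proof -
    obtain n :: nat where n: "e [^]\<^bsub>A\<^esub> n = \<zero>\<^bsub>A\<^esub>" using nil[OF e(1,3)] by blast
    have "e [^]\<^bsub>A\<^esub> Suc k = e" for k :: nat using e by (induction k) simp_all
    then have "e = e [^]\<^bsub>A\<^esub> n \<otimes>\<^bsub>A\<^esub> e" by simp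
    then show ?thesis using n e(1) by simp
  qed
  have "e = \<zero>\<^bsub>A\<^esub> \<or> e = \<one>\<^bsub>A\<^esub>" if e: "e \<in> carrier A" "e \<otimes>\<^bsub>A\<^esub> e = e" for e
  proof (cases "\<chi> e = 0")
    case False
    have "\<chi> e * \<chi> e = \<chi> e" using h(2)[OF e(1) e(1)] e(2) by simp
    then have "\<chi> e = 1" using False by simp
    let ?f = "\<one>\<^bsub>A\<^esub> \<ominus>\<^bsub>A\<^esub> e"
    have "\<chi> ?f + \<chi> e = \<chi> (?f \<oplus>\<^bsub>A\<^esub> e)" using h(3)[of ?f e] e by simp
    also have "?f \<oplus>\<^bsub>A\<^esub> e = \<one>\<^bsub>A\<^esub>" using e by (simp add: a_minus_def M.a_assoc M.l_neg)
    finally have "\<chi> ?f = 0" using \<open>\<chi> e = 1\<close> h(4) by simp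
    moreover have "?f \<otimes>\<^bsub>A\<^esub> ?f = ?f"
      using e by (simp add: a_minus_def l_distr r_distr l_minus r_minus M.r_neg)
    ultimately have "?f = \<zero>\<^bsub>A\<^esub>" using e ker by simp
    then show ?thesis using e by simp
  qed (use ker e in blast)
  then have "{e \<in> carrier A. e \<otimes>\<^bsub>A\<^esub> e = e} = {\<zero>\<^bsub>A\<^esub>, \<one>\<^bsub>A\<^esub>}" by auto
  moreover have "\<zero>\<^bsub>A\<^esub> \<noteq> \<one>\<^bsub>A\<^esub>" using h0 h(4) by auto
  ultimately show ?thesis by (simp add: indecomposable_def)
qed

text \<open>The algebras of the site have carriers of type \<open>'u\<close>, so the complex numbers
  have to be transported there along an injection \<open>k\<close>.\<close>

definition complex_copy :: "(complex \<Rightarrow> 'u) \<Rightarrow> (complex, 'u) module" where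
  "complex_copy k = \<lparr>carrier = range k, mult = (\<lambda>x y. k (the_inv k x * the_inv k y)), one = k 1, zero = k 0,
     add = (\<lambda>x y. k (the_inv k x + the_inv k y)), smult = (\<lambda>c x. k (c * the_inv k x))\<rparr>"

context
  fixes k :: "complex \<Rightarrow> 'u"
  assumes k: "inj k"
begin

lemma complex_copy_sel [simp]: "carrier (complex_copy k) = range k"
  "k x \<otimes>\<^bsub>complex_copy k\<^esub> k y = k (x * y)" "k x \<oplus>\<^bsub>complex_copy k\<^esub> k y = k (x + y)"
  "\<one>\<^bsub>complex_copy k\<^esub> = k 1" "\<zero>\<^bsub>complex_copy k\<^esub> = k 0" "c \<odot>\<^bsub>complex_copy k\<^esub> k x = k (c * x)"
  using k by (simp_all add: complex_copy_def the_inv_f_f)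

lemma field_complex_copy: "field (complex_copy k)"
proof -
  have "cring (complex_copy k)"
  proof (rule cringI)
    show "abelian_group (complex_copy k)"
      by (rule abelian_groupI) (auto simp: algebra_simps, metis add.right_inverse)
    show "Group.comm_monoid (complex_copy k)" by (rule comm_monoidI) (auto simp: algebra_simps)
  qed (auto simp: algebra_simps)
  moreover have "Units (complex_copy k) = carrier (complex_copy k) - {\<zero>\<^bsub>complex_copy k\<^esub>}"
    by (auto simp: Units_def inj_eq[OF k]) (metis left_inverse right_inverse)
  ultimately show ?thesis by (rule cring.cring_fieldI)
qed

lemma algebra_complex_copy: "algebra complex_field (complex_copy k)"
  by (rule algebraI[OF fieldE(1)[OF field_complex_field] fieldE(1)[OF field_complex_copy]])
    (auto simp: algebra_simps)

text \<open>In a field the zero ideal is the only maximal ideal; its cosets are singletons, so the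
  quotient is again the field of complex numbers.\<close>

lemma weil_algebra_complex_copy: "weil_algebra complex_field (complex_copy k)"
proof -
  let ?C = "complex_copy k"
  interpret complex_algebra ?C using algebra_complex_copy by (simp add: complex_algebra_def)
  interpret C: field ?C by (rule field_complex_copy)
  let ?z = "{\<zero>\<^bsub>?C\<^esub>}"
  have max: "maximalideal ?z ?C" by (rule C.zeromaximalideal)
  have uniq: "I = ?z" if "maximalideal I ?C" for I
  proof -
    interpret I: maximalideal I ?C by fact
    have "I \<in> {?z, carrier ?C}" using C.all_ideals I.is_ideal by blast
    then show ?thesis using I.I_notcarr by auto
  qed
  have coset: "{k 0} +>\<^bsub>?C\<^esub> k x = {k x}" for x by (simp add: a_r_coset_def')
  have "(\<lambda>c. ?z +>\<^bsub>?C\<^esub> (c \<odot>\<^bsub>?C\<^esub> \<one>\<^bsub>?C\<^esub>)) \<in> ring_iso complex_field (?C Quot ?z)"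
  proof (rule ring_iso_memI)
    interpret z: ideal ?z ?C using max by (rule maximalideal.axioms)
    note r = ring_hom_memE[OF z.rcos_ring_hom]
    show "?z +>\<^bsub>?C\<^esub> (x \<odot>\<^bsub>?C\<^esub> \<one>\<^bsub>?C\<^esub>) \<in> carrier (?C Quot ?z)" for x using r(1) by simp
    show "?z +>\<^bsub>?C\<^esub> (\<one>\<^bsub>complex_field\<^esub> \<odot>\<^bsub>?C\<^esub> \<one>\<^bsub>?C\<^esub>) = \<one>\<^bsub>?C Quot ?z\<^esub>" using r(4) by simp
    show "?z +>\<^bsub>?C\<^esub> ((x \<otimes>\<^bsub>complex_field\<^esub> y) \<odot>\<^bsub>?C\<^esub> \<one>\<^bsub>?C\<^esub>) =
        (?z +>\<^bsub>?C\<^esub> (x \<odot>\<^bsub>?C\<^esub> \<one>\<^bsub>?C\<^esub>)) \<otimes>\<^bsub>?C Quot ?z\<^esub> (?z +>\<^bsub>?C\<^esub> (y \<odot>\<^bsub>?C\<^esub> \<one>\<^bsub>?C\<^esub>))" for x y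
      using r(2)[of "k x" "k y"] by simp
    show "?z +>\<^bsub>?C\<^esub> ((x \<oplus>\<^bsub>complex_field\<^esub> y) \<odot>\<^bsub>?C\<^esub> \<one>\<^bsub>?C\<^esub>) =
        (?z +>\<^bsub>?C\<^esub> (x \<odot>\<^bsub>?C\<^esub> \<one>\<^bsub>?C\<^esub>)) \<oplus>\<^bsub>?C Quot ?z\<^esub> (?z +>\<^bsub>?C\<^esub> (y \<odot>\<^bsub>?C\<^esub> \<one>\<^bsub>?C\<^esub>))" for x y
      using r(3)[of "k x" "k y"] by simp
    have "carrier (?C Quot ?z) = (\<lambda>x. ?z +>\<^bsub>?C\<^esub> k x) ` UNIV"
      by (auto simp: FactRing_def A_RCOSETS_def')
    then show "bij_betw (\<lambda>c. ?z +>\<^bsub>?C\<^esub> (c \<odot>\<^bsub>?C\<^esub> \<one>\<^bsub>?C\<^esub>)) (carrier complex_field) (carrier (?C Quot ?z))"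
      using k by (auto simp: bij_betw_def coset inj_def)
  qed
  \<comment> \<open>Exponent 1 and not 0, since the power 0 of an ideal is the whole carrier; the
    first power is the product of the zero ideal with the carrier.\<close>
  moreover have "ideal_power ?C ?z 1 = {\<zero>\<^bsub>?C\<^esub>}"
  proof -
    have "x = k 0" if "x \<in> ideal_prod ?C ?z (range k)" for x
      using that by induction auto
    moreover have "k 0 \<in> ideal_prod ?C ?z (range k)"
      using ideal_prod.prod[of "k 0" ?z "k 0" "range k" ?C] by simp
    ultimately show ?thesis by auto
  qed
  moreover have "fg_module complex_field ?C"
  proof -
    have "x = (\<Oplus>\<^bsub>?C\<^esub>s\<in>{k 1}. the_inv k x \<odot>\<^bsub>?C\<^esub> s)" if "x \<in> range k" for x
      using that by (auto simp: M.finsum_insert the_inv_f_f[OF k])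
    then show ?thesis using module unfolding fg_module_def
      by (intro conjI exI[of _ "{k 1}"]) (auto intro!: bexI[of _ "\<lambda>_. the_inv k x" for x])
  qed
  ultimately show ?thesis
    unfolding weil_algebra_def using field_complex_field algebra_complex_copy max uniq by blast
qed

text \<open>The unit map is the only homomorphism by linearity. In the opposite category this is
  terminality in the site.\<close>

lemma complex_copy_initial:
  assumes "complex_algebra A"
  shows "\<exists>!h. h \<in> algebra_hom complex_field (complex_copy k) A"
proof -
  interpret complex_algebra A by fact
  let ?h = "\<lambda>x\<in>range k. the_inv k x \<odot>\<^bsub>A\<^esub> \<one>\<^bsub>A\<^esub>"
  have "?h \<in> algebra_hom complex_field (complex_copy k) A"
    by (rule algebra_homI) (auto simp: the_inv_f_f[OF k] inj_eq[OF k] smult_otimes smult_mult smult_add_left smult_1)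
  moreover have "h = ?h" if h: "h \<in> algebra_hom complex_field (complex_copy k) A" for h
  proof (rule extensionalityI[of _ "range k"])
    note hD = algebra_homD[OF h]
    show "h \<in> extensional (range k)" using hD(1) by simp
    fix x assume "x \<in> range k"
    then obtain c where "x = k c" by blast
    then show "h x = ?h x" using hD(6)[of "k 1" c] hD(5) by (simp add: the_inv_f_f[OF k])
  qed simp
  ultimately show ?thesis by blast
qed

text \<open>For any \<open>x\<close> the element \<open>x - \<chi>(x)\<close> is nilpotent, and a
  field has no nonzero nilpotents; so a homomorphism to the complex numbers must send
  \<open>x\<close> to the value of the augmentation.\<close>

lemma complex_copy_weil_terminal:
  assumes A: "weil_algebra complex_field A"
  shows "\<exists>!h. h \<in> algebra_hom complex_field A (complex_copy k)"
proof -
  interpret complex_algebra A using A by (rule weil_algebra_complex_algebra)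
  obtain \<chi> where hom: "\<chi> \<in> ring_hom A complex_field" and scal: "\<And>c. \<chi> (c \<odot>\<^bsub>A\<^esub> \<one>\<^bsub>A\<^esub>) = c"
    and nil: "\<And>x. x \<in> carrier A \<Longrightarrow> \<chi> x = 0 \<Longrightarrow> \<exists>n. x [^]\<^bsub>A\<^esub> (n :: nat) = \<zero>\<^bsub>A\<^esub>"
    using weil_algebra_augmentation[OF A] by blast
  note c = ring_hom_memE[OF hom]
  have "\<chi> (d \<odot>\<^bsub>A\<^esub> x) = d * \<chi> x" if "x \<in> carrier A" for d x
    using c(2)[of "d \<odot>\<^bsub>A\<^esub> \<one>\<^bsub>A\<^esub>" x] that scal by (simp add: smult_one_otimes)
  then have "(\<lambda>x\<in>carrier A. k (\<chi> x)) \<in> algebra_hom complex_field A (complex_copy k)"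
    using c by (intro algebra_homI) auto
  moreover have eq: "h x = k (\<chi> x)"
    if h: "h \<in> algebra_hom complex_field A (complex_copy k)" and x: "x \<in> carrier A" for h x
  proof -
    interpret C: field "complex_copy k" by (rule field_complex_copy)
    note hD = algebra_homD[OF h]
    have hr: "h \<in> ring_hom A (complex_copy k)" using h by (simp add: algebra_hom_def)
    \<comment> \<open>Adding \<open>?d\<close> shifts \<open>x\<close> into the kernel of the
      augmentation, where elements are nilpotent.\<close>
    let ?d = "(- \<chi> x) \<odot>\<^bsub>A\<^esub> \<one>\<^bsub>A\<^esub>"
    have "\<chi> (x \<oplus>\<^bsub>A\<^esub> ?d) = 0" using x scal c(3)[of x ?d] by simp
    then obtain n :: nat where n: "(x \<oplus>\<^bsub>A\<^esub> ?d) [^]\<^bsub>A\<^esub> n = \<zero>\<^bsub>A\<^esub>" using nil x by (meson M.a_closed one_closed smult_in)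
    have y: "x \<oplus>\<^bsub>A\<^esub> ?d \<in> carrier A" using x by simp
    have pow: "h (y [^]\<^bsub>A\<^esub> m) = h y [^]\<^bsub>complex_copy k\<^esub> m" if "y \<in> carrier A" for y and m :: nat
      using that hD(2,3,5) by (induction m) auto
    have "h (x \<oplus>\<^bsub>A\<^esub> ?d) [^]\<^bsub>complex_copy k\<^esub> n = \<zero>\<^bsub>complex_copy k\<^esub>"
      using pow[OF y] n ring_hom_zero[OF hr cring.axioms(1)[OF M_cring] C.ring_axioms] by metis
    then have "h (x \<oplus>\<^bsub>A\<^esub> ?d) = \<zero>\<^bsub>complex_copy k\<^esub>"
    proof (induction n)
      case 0
      then show ?case using C.one_not_zero by simp
    next
      case (Suc n)
      have hy: "h (x \<oplus>\<^bsub>A\<^esub> ?d) \<in> carrier (complex_copy k)" using hD(2)[OF y] .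
      show ?case using Suc C.integral[of "h (x \<oplus>\<^bsub>A\<^esub> ?d) [^]\<^bsub>complex_copy k\<^esub> n" "h (x \<oplus>\<^bsub>A\<^esub> ?d)"]
        C.nat_pow_closed[OF hy, of n] hy by auto
    qed
    moreover obtain z where z: "h x = k z" using hD(2)[OF x] by auto
    moreover have "h (x \<oplus>\<^bsub>A\<^esub> ?d) = k (z - \<chi> x)"
      using x z hD(4)[of x ?d] hD(6)[of "\<one>\<^bsub>A\<^esub>" "- \<chi> x"] hD(5) by simp
    ultimately show ?thesis using k by (simp add: inj_eq)
  qed
  moreover have "h = (\<lambda>x\<in>carrier A. k (\<chi> x))" if h: "h \<in> algebra_hom complex_field A (complex_copy k)" for h
    by (rule extensionalityI[OF algebra_homD(1)[OF h] restrict_extensional]) (use eq[OF h] in simp)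
  ultimately show ?thesis by blast
qed

end

lemma gaeta_site_sel [simp]:
  "Ob gaeta_site = {A. fg_algebra complex_field A \<and> indecomposable A}"
  "Ar gaeta_site A B = algebra_hom complex_field B A"
  "Cmp gaeta_site A B C g f = compose (carrier C) f g"
  "Ident gaeta_site A = (\<lambda>x\<in>carrier A. x)"
  by (simp_all add: gaeta_site_def)

subsection \<open>Structure constants\<close>

definition lin_comb :: "(complex, 'u) module \<Rightarrow> nat \<Rightarrow> (nat \<Rightarrow> 'u) \<Rightarrow> (nat \<Rightarrow> complex) \<Rightarrow> 'u" where
  "lin_comb A n s c = (\<Oplus>\<^bsub>A\<^esub>i\<in>{..<n}. c i \<odot>\<^bsub>A\<^esub> s i)"

text \<open>\<open>s\<close> lists a basis at the indices below \<open>n\<close>: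
  \<open>expand\<close> says that it spans, \<open>co_lin_comb\<close> that it is independent.
  Coordinates at indices from \<open>n\<close> on are arbitrary.\<close>

locale based_algebra = complex_algebra A for A :: "(complex, 'u) module" (structure) +
  fixes n :: nat and s :: "nat \<Rightarrow> 'u" and co :: "'u \<Rightarrow> nat \<Rightarrow> complex"
  assumes basis_in: "i < n \<Longrightarrow> s i \<in> carrier A"
    and expand: "x \<in> carrier A \<Longrightarrow> lin_comb A n s (co x) = x"
    and co_lin_comb: "i < n \<Longrightarrow> co (lin_comb A n s c) i = c i"
begin

lemma lin_comb_in: "lin_comb A n s c \<in> carrier A"
  unfolding lin_comb_def by (rule M.finsum_closed) (auto simp: basis_in)

lemma lin_comb_cong: "(\<And>i. i < n \<Longrightarrow> c i = d i) \<Longrightarrow> lin_comb A n s c = lin_comb A n s d"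
  unfolding lin_comb_def by (rule M.finsum_cong') (auto simp: basis_in)

lemma lin_comb_add: "lin_comb A n s (\<lambda>i. c i + d i) = lin_comb A n s c \<oplus> lin_comb A n s d"
proof -
  have "lin_comb A n s (\<lambda>i. c i + d i) = (\<Oplus>\<^bsub>A\<^esub>i\<in>{..<n}. c i \<odot>\<^bsub>A\<^esub> s i \<oplus> d i \<odot>\<^bsub>A\<^esub> s i)"
    unfolding lin_comb_def by (rule M.finsum_cong') (auto simp: basis_in smult_add_left)
  then show ?thesis unfolding lin_comb_def by (simp add: M.finsum_addf basis_in Pi_def)
qed

lemma lin_comb_smult: "lin_comb A n s (\<lambda>i. d * c i) = d \<odot> lin_comb A n s c"
proof -
  have "lin_comb A n s (\<lambda>i. d * c i) = (\<Oplus>\<^bsub>A\<^esub>i\<in>{..<n}. d \<odot>\<^bsub>A\<^esub> (c i \<odot>\<^bsub>A\<^esub> s i))"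
    unfolding lin_comb_def by (rule M.finsum_cong') (auto simp: basis_in smult_mult)
  then show ?thesis unfolding lin_comb_def by (simp add: finsum_smult_ldistr basis_in Pi_def)
qed

lemma lin_comb_basis:
  assumes "i < n"
  shows "lin_comb A n s (\<lambda>j. if i = j then 1 else 0) = s i"
proof -
  have "lin_comb A n s (\<lambda>j. if i = j then 1 else 0) = (\<Oplus>\<^bsub>A\<^esub>j\<in>{..<n}. if i = j then s j else \<zero>)"
    unfolding lin_comb_def by (rule M.finsum_cong') (auto simp: basis_in smult_1 smult_0)
  also have "\<dots> = s i" using assms by (intro M.finsum_singleton) (auto simp: basis_in)
  finally show ?thesis .
qed

lemma co_add: "\<lbrakk>x \<in> carrier A; y \<in> carrier A; i < n\<rbrakk> \<Longrightarrow> co (x \<oplus> y) i = co x i + co y i"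
  using co_lin_comb[of i "\<lambda>i. co x i + co y i"] by (simp add: lin_comb_add expand)

lemma co_smult: "\<lbrakk>x \<in> carrier A; i < n\<rbrakk> \<Longrightarrow> co (d \<odot> x) i = d * co x i"
  using co_lin_comb[of i "\<lambda>i. d * co x i"] by (simp add: lin_comb_smult expand)

lemma basis_induct [consumes 1, case_names zero basis add smult]:
  assumes "x \<in> carrier A" and "P \<zero>" and "\<And>i. i < n \<Longrightarrow> P (s i)"
    and "\<And>x y. \<lbrakk>x \<in> carrier A; y \<in> carrier A; P x; P y\<rbrakk> \<Longrightarrow> P (x \<oplus> y)"
    and "\<And>c x. \<lbrakk>x \<in> carrier A; P x\<rbrakk> \<Longrightarrow> P (c \<odot> x)"
  shows "P x"
proof -
  have "P (\<Oplus>\<^bsub>A\<^esub>i\<in>I. c i \<odot>\<^bsub>A\<^esub> s i) \<and> (\<Oplus>\<^bsub>A\<^esub>i\<in>I. c i \<odot>\<^bsub>A\<^esub> s i) \<in> carrier A" if "finite I" "I \<subseteq> {..<n}" for I c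
    using that
  proof (induction I rule: finite_induct)
    case (insert i I)
    have "(\<Oplus>\<^bsub>A\<^esub>i\<in>insert i I. c i \<odot>\<^bsub>A\<^esub> s i) = c i \<odot>\<^bsub>A\<^esub> s i \<oplus> (\<Oplus>\<^bsub>A\<^esub>i\<in>I. c i \<odot>\<^bsub>A\<^esub> s i)"
      using insert by (intro M.finsum_insert) (auto simp: basis_in)
    then show ?case using insert assms(3-5) basis_in by auto
  qed (use assms(2) in simp)
  from this[of "{..<n}" "co x"] show ?thesis using expand[OF assms(1)] by (simp add: lin_comb_def)
qed

end

text \<open>The linear map matching the two bases respects products because multiplication is
  bilinear and the structure constants agree.\<close>

lemma based_algebra_hom:
  assumes A: "based_algebra A n s co" and B: "based_algebra B n s' co'"
    and one: "\<And>i. i < n \<Longrightarrow> co \<one>\<^bsub>A\<^esub> i = co' \<one>\<^bsub>B\<^esub> i"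
    and mult: "\<And>i j l. \<lbrakk>i < n; j < n; l < n\<rbrakk> \<Longrightarrow> co (s i \<otimes>\<^bsub>A\<^esub> s j) l = co' (s' i \<otimes>\<^bsub>B\<^esub> s' j) l"
  shows "(\<lambda>x\<in>carrier A. lin_comb B n s' (co x)) \<in> algebra_hom complex_field A B"
proof -
  interpret A: based_algebra A n s co by fact
  interpret B: based_algebra B n s' co' by fact
  let ?g = "\<lambda>x. lin_comb B n s' (co x)"
  have g_add: "?g (x \<oplus>\<^bsub>A\<^esub> y) = ?g x \<oplus>\<^bsub>B\<^esub> ?g y" if "x \<in> carrier A" "y \<in> carrier A" for x y
    using that by (simp add: A.co_add cong: B.lin_comb_cong) (simp add: B.lin_comb_add)
  have g_smult: "?g (c \<odot>\<^bsub>A\<^esub> x) = c \<odot>\<^bsub>B\<^esub> ?g x" if "x \<in> carrier A" for c x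
    using that by (simp add: A.co_smult cong: B.lin_comb_cong) (simp add: B.lin_comb_smult)
  have g_basis: "?g (s i) = s' i" if "i < n" for i
  proof -
    have "?g (s i) = lin_comb B n s' (\<lambda>j. if i = j then 1 else 0)"
      by (rule B.lin_comb_cong) (subst A.lin_comb_basis[OF that, symmetric], rule A.co_lin_comb)
    then show ?thesis using B.lin_comb_basis[OF that] by simp
  qed
  have g_zero: "?g \<zero>\<^bsub>A\<^esub> = \<zero>\<^bsub>B\<^esub>"
    using g_smult[of "\<zero>\<^bsub>A\<^esub>" 0] by (simp add: A.smult_0 B.smult_0 B.lin_comb_in)
  have g1: "?g \<one>\<^bsub>A\<^esub> = \<one>\<^bsub>B\<^esub>"
    using B.lin_comb_cong[of "co \<one>\<^bsub>A\<^esub>" "co' \<one>\<^bsub>B\<^esub>"] one by (simp add: B.expand)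
  \<comment> \<open>Bilinearity is used in two rounds: the left factor is first kept a basis element
    while the right one varies, then the left factor is freed.\<close>
  have basis_mult: "?g (s i \<otimes>\<^bsub>A\<^esub> y) = s' i \<otimes>\<^bsub>B\<^esub> ?g y" if "y \<in> carrier A" and i: "i < n" for i y
    using that(1)
  proof (induction y rule: A.basis_induct)
    case zero
    then show ?case using g_zero i by (simp add: A.basis_in B.basis_in)
  next
    case (basis j)
    have "?g (s i \<otimes>\<^bsub>A\<^esub> s j) = lin_comb B n s' (co' (s' i \<otimes>\<^bsub>B\<^esub> s' j))"
      by (rule B.lin_comb_cong) (rule mult[OF i basis])
    then show ?case using i basis g_basis by (simp add: B.expand B.basis_in)
  next
    case (add x y)
    then show ?case using i g_add
      by (simp add: A.r_distr B.r_distr A.basis_in B.basis_in B.lin_comb_in)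
  next
    case (smult c x)
    then show ?case using i g_smult
      by (simp add: A.otimes_smult B.otimes_smult A.basis_in B.basis_in B.lin_comb_in)
  qed
  have "?g (x \<otimes>\<^bsub>A\<^esub> y) = ?g x \<otimes>\<^bsub>B\<^esub> ?g y" if x: "x \<in> carrier A" and y: "y \<in> carrier A" for x y
    using x
  proof (induction x rule: A.basis_induct)
    case zero
    then show ?case using g_zero y by (simp add: B.lin_comb_in)
  next
    case (basis i)
    then show ?case using basis_mult[OF y] g_basis by simp
  next
    case (add u v)
    then show ?case using y g_add
      by (simp add: A.l_distr B.l_distr B.lin_comb_in)
  next
    case (smult c u)
    then show ?case using y g_smult
      by (simp add: A.smult_otimes B.smult_otimes B.lin_comb_in)
  qed
  then show ?thesis using g_add g_smult g1 by (intro algebra_homI) (auto simp: B.lin_comb_in)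
qed

lemma based_algebra_iso:
  assumes A: "based_algebra A n s co" and B: "based_algebra B n s' co'"
    and one: "\<And>i. i < n \<Longrightarrow> co \<one>\<^bsub>A\<^esub> i = co' \<one>\<^bsub>B\<^esub> i"
    and mult: "\<And>i j l. \<lbrakk>i < n; j < n; l < n\<rbrakk> \<Longrightarrow> co (s i \<otimes>\<^bsub>A\<^esub> s j) l = co' (s' i \<otimes>\<^bsub>B\<^esub> s' j) l"
  shows "\<exists>u. iso_arrow gaeta_site A B u"
proof -
  interpret A: based_algebra A n s co by fact
  interpret B: based_algebra B n s' co' by fact
  let ?h = "\<lambda>x\<in>carrier A. lin_comb B n s' (co x)" and ?g = "\<lambda>y\<in>carrier B. lin_comb A n s (co' y)"
  have "?g (?h x) = x" if "x \<in> carrier A" for x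
  proof -
    have "lin_comb A n s (co' (lin_comb B n s' (co x))) = lin_comb A n s (co x)"
      by (rule A.lin_comb_cong) (rule B.co_lin_comb)
    then show ?thesis using that by (simp add: A.expand B.lin_comb_in)
  qed
  moreover have "?h (?g y) = y" if "y \<in> carrier B" for y
  proof -
    have "lin_comb B n s' (co (lin_comb A n s (co' y))) = lin_comb B n s' (co' y)"
      by (rule B.lin_comb_cong) (rule A.co_lin_comb)
    then show ?thesis using that by (simp add: B.expand A.lin_comb_in)
  qed
  ultimately have "compose (carrier A) ?g ?h = (\<lambda>x\<in>carrier A. x)" "compose (carrier B) ?h ?g = (\<lambda>x\<in>carrier B. x)"
    unfolding compose_def by (auto intro!: restrict_ext simp del: restrict_apply)
  moreover have "?h \<in> algebra_hom complex_field A B" by (rule based_algebra_hom[OF A B one mult])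
  moreover have "?g \<in> algebra_hom complex_field B A"
    by (rule based_algebra_hom[OF B A one[symmetric] mult[symmetric]])
  \<comment> \<open>Arrows of the site are reversed homomorphisms, so the arrow from
    \<open>A\<close> to \<open>B\<close> is the map \<open>?g\<close> from \<open>B\<close> to
    \<open>A\<close>.\<close>
  ultimately have "iso_arrow gaeta_site A B ?g" unfolding iso_arrow_def is_inverse_def gaeta_site_sel by blast
  then show ?thesis by blast
qed

text \<open>A spanning set of least cardinality is independent. Coefficients are first indexed by
  the spanning elements themselves and renumbered by natural numbers at the end.\<close>

lemma based_algebra_exists:
  assumes A: "algebra complex_field A" and fg: "fg_module complex_field A"
  shows "\<exists>n s co. based_algebra A n s co"
proof -
  interpret complex_algebra A using A by (simp add: complex_algebra_def)
  define sum where "sum T c = (\<Oplus>\<^bsub>A\<^esub>t\<in>T. c t \<odot>\<^bsub>A\<^esub> t)" for T and c :: "'a \<Rightarrow> complex"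
  define spans where "spans T \<longleftrightarrow> finite T \<and> T \<subseteq> carrier A \<and> (\<forall>x\<in>carrier A. \<exists>c. x = sum T c)" for T
  have "\<exists>T. spans T" using fg unfolding fg_module_def spans_def sum_def by auto
  then obtain T where T: "spans T" and least: "\<And>T'. spans T' \<Longrightarrow> card T \<le> card T'"
    using ex_has_least_nat[of spans _ card] by blast
  have fin: "finite T" and TA: "T \<subseteq> carrier A" and span: "\<And>x. x \<in> carrier A \<Longrightarrow> \<exists>c. x = sum T c"
    using T by (auto simp: spans_def)
  have sum_in: "sum T c \<in> carrier A" for c
    unfolding sum_def by (rule M.finsum_closed) (use TA in auto)
  have sum_combine: "sum T (\<lambda>t. a t + d * e t) = sum T a \<oplus>\<^bsub>A\<^esub> d \<odot>\<^bsub>A\<^esub> sum T e" for a d e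
  proof -
    have "sum T (\<lambda>t. a t + d * e t) = (\<Oplus>\<^bsub>A\<^esub>t\<in>T. a t \<odot>\<^bsub>A\<^esub> t \<oplus>\<^bsub>A\<^esub> d \<odot>\<^bsub>A\<^esub> (e t \<odot>\<^bsub>A\<^esub> t))"
      unfolding sum_def by (rule M.finsum_cong') (use TA in \<open>auto simp: smult_add_left smult_mult subset_iff\<close>)
    also have "\<dots> = sum T a \<oplus>\<^bsub>A\<^esub> (\<Oplus>\<^bsub>A\<^esub>t\<in>T. d \<odot>\<^bsub>A\<^esub> (e t \<odot>\<^bsub>A\<^esub> t))"
      unfolding sum_def by (rule M.finsum_addf) (use TA in auto)
    also have "(\<Oplus>\<^bsub>A\<^esub>t\<in>T. d \<odot>\<^bsub>A\<^esub> (e t \<odot>\<^bsub>A\<^esub> t)) = d \<odot>\<^bsub>A\<^esub> sum T e"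
      unfolding sum_def by (rule finsum_smult_ldistr[symmetric]) (use fin TA in auto)
    finally show ?thesis .
  qed
  have indep: "c t = d t" if eq: "sum T c = sum T d" and t: "t \<in> T" for c d t
  proof (rule ccontr)
    assume ne: "c t \<noteq> d t"
    \<comment> \<open>The difference of the two representations is a linear relation with nonzero
      coefficient at \<open>t\<close>.\<close>
    define e where "e t = c t + (- 1) * d t" for t
    have "sum T e = sum T d \<oplus>\<^bsub>A\<^esub> (- 1) \<odot>\<^bsub>A\<^esub> sum T d" unfolding e_def sum_combine eq ..
    also have "\<dots> = (1 + - 1) \<odot>\<^bsub>A\<^esub> sum T d"
      using sum_in[of d] by (subst smult_add_left) (simp_all add: smult_1)
    finally have e0: "sum T e = \<zero>\<^bsub>A\<^esub>" using sum_in by (simp add: smult_0)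
    have "spans (T - {t})" unfolding spans_def
    proof (intro conjI ballI)
      fix x assume x: "x \<in> carrier A"
      then obtain a where a: "x = sum T a" using span by blast
      let ?b = "\<lambda>u. a u + (- a t / e t) * e u"
      have "x = sum T ?b" unfolding sum_combine e0 using x a by simp
      also have "sum T ?b = sum (insert t (T - {t})) ?b" using t by (simp add: insert_absorb)
      also have "\<dots> = ?b t \<odot>\<^bsub>A\<^esub> t \<oplus>\<^bsub>A\<^esub> sum (T - {t}) ?b"
        unfolding sum_def by (rule M.finsum_insert) (use fin TA t in auto)
      also have "?b t = 0" using ne by (simp add: e_def)
      also have "0 \<odot>\<^bsub>A\<^esub> t \<oplus>\<^bsub>A\<^esub> sum (T - {t}) ?b = sum (T - {t}) ?b"
      proof -
        have "sum (T - {t}) ?b \<in> carrier A" unfolding sum_def by (rule M.finsum_closed) (use TA in auto)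
        then show ?thesis using t TA by (simp add: smult_0 subset_iff)
      qed
      finally show "\<exists>c. x = sum (T - {t}) c" by blast
    qed (use fin TA in auto)
    from least[OF this] show False using t fin by (metis card_Diff1_less not_le)
  qed
  obtain h where h: "bij_betw h {..<card T} T"
    using ex_bij_betw_nat_finite[OF fin] by (auto simp: atLeast0LessThan)
  have hA: "h i \<in> carrier A" if "i < card T" for i using h TA that by (auto simp: bij_betw_def)
  have lin_comb: "lin_comb A (card T) h c = sum T (\<lambda>t. c (the_inv_into {..<card T} h t))" for c
  proof -
    have "sum T (\<lambda>t. c (the_inv_into {..<card T} h t)) = (\<Oplus>\<^bsub>A\<^esub>t\<in>h ` {..<card T}. c (the_inv_into {..<card T} h t) \<odot>\<^bsub>A\<^esub> t)"
      using h by (simp add: sum_def bij_betw_def)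
    also have "\<dots> = (\<Oplus>\<^bsub>A\<^esub>i\<in>{..<card T}. c (the_inv_into {..<card T} h (h i)) \<odot>\<^bsub>A\<^esub> h i)"
      by (rule M.finsum_reindex) (use h TA hA in \<open>auto simp: bij_betw_def subset_iff\<close>)
    also have "\<dots> = lin_comb A (card T) h c"
      unfolding lin_comb_def
      by (rule M.finsum_cong') (use h hA in \<open>auto simp: bij_betw_def the_inv_into_f_f\<close>)
    finally show ?thesis ..
  qed
  obtain c where c: "\<And>x. x \<in> carrier A \<Longrightarrow> x = sum T (c x)" using span by metis
  have "based_algebra A (card T) h (\<lambda>x i. c x (h i))"
  proof unfold_locales
    show "h i \<in> carrier A" if "i < card T" for i using that by (rule hA)
    have hi: "h (the_inv_into {..<card T} h t) = t" if "t \<in> T" for t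
      using h that by (auto simp: bij_betw_def f_the_inv_into_f)
    show "lin_comb A (card T) h (\<lambda>i. c x (h i)) = x" if x: "x \<in> carrier A" for x
    proof -
      have "lin_comb A (card T) h (\<lambda>i. c x (h i)) = sum T (c x)"
        unfolding lin_comb unfolding sum_def by (rule M.finsum_cong') (use TA hi in auto)
      then show ?thesis using c[OF x] by simp
    qed
    fix i d assume i: "i < card T"
    let ?x = "lin_comb A (card T) h d"
    have "?x \<in> carrier A" unfolding lin_comb by (rule sum_in)
    then have "sum T (c ?x) = sum T (\<lambda>t. d (the_inv_into {..<card T} h t))" using c lin_comb by metis
    then have "c ?x (h i) = d (the_inv_into {..<card T} h (h i))"
      by (rule indep) (use h i in \<open>auto simp: bij_betw_def\<close>)
    then show "c ?x (h i) = d i" using h i by (simp add: bij_betw_def the_inv_into_f_f)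
  qed
  then show ?thesis by blast
qed

text \<open>The coordinates of the unit and the multiplication table in a chosen basis determine the
  algebra up to isomorphism. Such tables are finite lists of complex numbers; picking one algebra
  for each occurring table gives \<open>R\<close>.\<close>

lemma weil_algebra_representatives:
  "\<exists>R \<subseteq> {A :: (complex, 'u) module. weil_algebra complex_field A}. R \<lesssim> (UNIV :: complex set) \<and>
    (\<forall>A. weil_algebra complex_field A \<longrightarrow> (\<exists>B\<in>R. \<exists>u. iso_arrow gaeta_site A B u))"
proof -
  let ?W = "{A :: (complex, 'u) module. weil_algebra complex_field A}"
  have "\<exists>n s co. based_algebra A n s co" if "A \<in> ?W" for A
    using that based_algebra_exists by (auto simp: weil_algebra_def)
  then obtain n s co where based: "\<And>A. A \<in> ?W \<Longrightarrow> based_algebra A (n A) (s A) (co A)" by metis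
  \<comment> \<open>The first row holds the coordinates of the unit; its length also records the
    dimension, which makes the remaining rows comparable.\<close>
  define code where "code A = map (co A \<one>\<^bsub>A\<^esub>) [0..<n A] #
      map (\<lambda>(i, j). map (co A (s A i \<otimes>\<^bsub>A\<^esub> s A j)) [0..<n A]) (List.product [0..<n A] [0..<n A])" for A
  define R where "R = inv_into ?W code ` code ` ?W"
  have "(UNIV :: complex list list set) \<lesssim> (UNIV :: complex set)"
    using lists_lepoll_complex[OF lists_complex_lepoll] by simp
  then have "code ` ?W \<lesssim> (UNIV :: complex set)"
    using subset_imp_lepoll[of "code ` ?W" UNIV] lepoll_trans by blast
  then have "R \<lesssim> (UNIV :: complex set)"
    unfolding R_def using image_lepoll lepoll_trans by blast
  moreover have "R \<subseteq> ?W" unfolding R_def using inv_into_into[of _ code ?W] by blast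
  moreover have "\<exists>B\<in>R. \<exists>u. iso_arrow gaeta_site A B u" if A: "A \<in> ?W" for A
  proof -
    define B where "B = inv_into ?W code (code A)"
    have BR: "B \<in> R" using A by (auto simp: B_def R_def)
    have B: "B \<in> ?W" unfolding B_def by (rule inv_into_into) (use A in blast)
    have code: "code B = code A" unfolding B_def by (rule f_inv_into_f) (use A in blast)
    then have one: "map (co B \<one>\<^bsub>B\<^esub>) [0..<n B] = map (co A \<one>\<^bsub>A\<^esub>) [0..<n A]" by (simp add: code_def)
    from arg_cong[OF this, of length] have n: "n B = n A" by simp
    have "co A \<one>\<^bsub>A\<^esub> i = co B \<one>\<^bsub>B\<^esub> i" if "i < n A" for i
      using one that by (simp add: n)
    moreover have "co A (s A i \<otimes>\<^bsub>A\<^esub> s A j) l = co B (s B i \<otimes>\<^bsub>B\<^esub> s B j) l"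
      if "i < n A" "j < n A" "l < n A" for i j l
    proof -
      have "\<forall>(i, j)\<in>set (List.product [0..<n A] [0..<n A]).
        map (co B (s B i \<otimes>\<^bsub>B\<^esub> s B j)) [0..<n A] = map (co A (s A i \<otimes>\<^bsub>A\<^esub> s A j)) [0..<n A]"
        using code unfolding code_def n by (auto simp: map_eq_conv)
      then show ?thesis using that by auto
    qed
    moreover have "based_algebra B (n A) (s B) (co B)" using based[OF B] n by simp
    ultimately show ?thesis using BR based_algebra_iso[OF based[OF A]] by blast
  qed
  ultimately show ?thesis by blast
qed


section \<open>The Weil topos inside the Gaeta topos\<close>

text \<open>Passing to the opposite and to a full subcategory commute on the nose, which puts
  \<open>weil_topos\<close> into the form of presheaves on a full subcategory of the site.\<close>

lemma opposite_weil_algebras: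
  "opposite weil_algebras = full_subcategory gaeta_site {A. weil_algebra complex_field A}"
  by (simp add: weil_algebras_def gaeta_site_def opposite_def full_subcategory_def)

lemma weil_algebra_in_gaeta_site: "weil_algebra complex_field A \<Longrightarrow> A \<in> Ob gaeta_site"
  using weil_algebra_indecomposable fg_algebra_of_fg_module by (auto simp: weil_algebra_def)

theorem proposition6p3:
  fixes \<U> :: "'u set set"
  assumes "set_universe \<U>"
  shows "(\<exists>p. gaeta_canonical \<U> p) \<and> (\<exists>j. weil_inclusion \<U> j) \<and>
    (\<forall>p j. gaeta_canonical \<U> p \<and> weil_inclusion \<U> j \<longrightarrow>
       essential_subquality (weil_topos \<U>) (gaeta_topos \<U>) (set_cat \<U>) p j)"
proof -
  let ?W = "{A :: (complex, 'u) module. weil_algebra complex_field A}"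
  obtain X :: "'u set" where "(UNIV :: complex set) \<lesssim> X"
    using assms by (auto simp: set_universe_def)
  \<comment> \<open>The member of \<open>\<U>\<close> at least as large as the complex numbers
    provides room in \<open>'u\<close> for a copy of them.\<close>
  then obtain k :: "complex \<Rightarrow> 'u" where k: "inj k" by (auto simp: lepoll_def)
  obtain R :: "(complex, 'u) module set" where R: "R \<subseteq> ?W" "R \<lesssim> (UNIV :: complex set)"
    "\<And>A. weil_algebra complex_field A \<Longrightarrow> \<exists>B\<in>R. \<exists>u. iso_arrow gaeta_site A B u"
    using weil_algebra_representatives by blast
  interpret small_full_subcategory gaeta_site ?W \<U> R
  proof (intro small_full_subcategory.intro small_full_subcategory_axioms.intro)
    show "category (gaeta_site :: ((complex, 'u) module, _) cat)"
      unfolding gaeta_site_def by (intro category_opposite category_fg_indec_algebras)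
    show "?W \<subseteq> Ob gaeta_site" using weil_algebra_in_gaeta_site by blast
    show "\<exists>r\<in>R. \<exists>u. iso_arrow gaeta_site b r u" if "b \<in> ?W" for b
      using R(3) that by simp
    fix b X :: "(complex, 'u) module" assume "b \<in> ?W" and X: "X \<in> Ob gaeta_site"
    \<comment> \<open>Weil algebras are finitely generated, so the bound on homomorphisms applies in
      both directions between \<open>b\<close> and \<open>X\<close>.\<close>
    then have "b \<in> Ob gaeta_site" using weil_algebra_in_gaeta_site by blast
    then show "Ar gaeta_site b X \<lesssim> (UNIV :: complex set)" "Ar gaeta_site X b \<lesssim> (UNIV :: complex set)"
      using X algebra_hom_lepoll_complex by auto
  qed (use assms R in auto)
  let ?c = "complex_copy k"
  have c: "?c \<in> ?W" using weil_algebra_complex_copy[OF k] by simp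
  have terminal: "terminal_object gaeta_site ?c"
    unfolding terminal_object_def
  proof (intro conjI ballI)
    show "?c \<in> Ob gaeta_site" using weil_algebra_in_gaeta_site c by blast
    fix X :: "(complex, 'u) module" assume "X \<in> Ob gaeta_site"
    then show "\<exists>!f. f \<in> Ar gaeta_site X ?c"
      using complex_copy_initial[OF k fg_algebra_complex_algebra, of X] by simp
  qed
  have init: "\<exists>!f. f \<in> Ar gaeta_site ?c b" if "b \<in> ?W" for b
    using complex_copy_weil_terminal[OF k, of b] that by simp
  show ?thesis
    unfolding gaeta_canonical_def weil_inclusion_def weil_topos_def gaeta_topos_def opposite_weil_algebras
    using essential_subquality_of_zero_object[OF c terminal init] by blast
qed

end
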